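(* Consider two bilinear systems $(A,N_1,\dots,N_n,B,C)$ on $X$ and $(\widetilde A,\widetilde N_1,\dots,\widetilde N_n,\widetilde B,\widetilde C)$ on $\widetilde X$ with the same input space $\mathbb R^n$ and output space $\mathbb R^m$, each satisfying $M^2\Gamma^2(2\nu)^{-1}<1$ with its own constants. Let $u\in L^\infty((0,\infty),\mathbb R^n)\cap L^2((0,\infty),\mathbb R^n)$ with $\|u\|_{L^2((0,\infty),(\mathbb R^n,\|\cdot\|_\infty))}<\min\big(\tfrac1{\sqrt n},\tfrac{\sqrt{2\nu}}{M\Xi}\big)$ for both systems, where $\Xi=\sum_{i=1}^n\|N_i\|$. Let $\varphi,\widetilde\varphi$ be the mild solutions of the two systems with control $u$ and initial condition zero, and $\Delta(C\varphi(t))=C\varphi(t)-\widetilde C\widetilde\varphi(t)$. Then $$\sup_{t\in(0,\infty)}\|\Delta(C\varphi(t))\|_{\mathbb R^m}\le4\sqrt n\,\|\Delta(H)\|_{\mathrm{TC}}\,\|u\|_{L^\infty((0,\infty),(\mathbb R^n,\|\cdot\|_\infty))},$$ where $\Delta(H)=H-\widetilde H$ is the difference of the Hankel operators.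
   Context: A bilinear system: $X$ separable real Hilbert space, $A$ generator of a $C_0$-semigroup $(T(t))$ with $\|T(t)\|\le Me^{-\nu t}$ ($M\ge1,\nu>0$), $N_1,\dots,N_n\in\mathcal L(X)$, $Bu=\sum_i\psi_iu_i$ ($\psi_i\in X$), $C\in\mathcal L(X,\mathbb R^m)$, $\Gamma=(\sum_i\|N_iN_i^*\|)^{1/2}$. The mild solution with initial state $\varphi_0$ and control $u$ is the continuous $\varphi$ with $\varphi(t)=T(t)\varphi_0+\int_0^tT(t-s)(\sum_iu_i(s)N_i\varphi(s)+Bu(s))ds$. With $\widehat e_i$ the standard basis of $\mathbb R^n$ and $t\in(0,\infty)^{k+1}$: $O_0(t_1)=CT(t_1)$, $P_0(t_1)=T(t_1)^*$, and for $k\ge1$, $O_k(t)y=\sum_{n_1,\dots,n_k}CT(t_1)N_{n_1}T(t_2)\cdots N_{n_k}T(t_{k+1})y\otimes(\widehat e_{n_1}\otimes\dots\otimes\widehat e_{n_k})$, $P_k(t)y=\sum_{n_1,\dots,n_k}T(t_1)^*N_{n_1}^*\cdots T(t_k)^*N_{n_k}^*T(t_{k+1})^*y\otimes(\widehat e_{n_1}\otimes\dots\otimes\widehat e_{n_k})$. Fock spaces $F^n_k(K)=L^2((0,\infty)^k,K\otimes(\mathbb R^n)^{\otimes(k-1)})$, $F^n(K)=\bigoplus_{k\ge1}F^n_k(K)$. $W:X\to F^n(\mathbb R^m)$, $Wx=(O_k(\cdot)x)_{k\ge0}$; $R:F^n(\mathbb R^n)\to X$, $R((f_k)_{k\ge0})=\sum_k\int_{(0,\infty)^{k+1}}P_k(s)^*(B\otimes\mathrm{id})f_k(s)ds$;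 Hankel operator $H=WR$ (trace class); $\|\cdot\|_{\mathrm{TC}}$ trace norm. *)

theory Defs
  imports "HOL-Analysis.Analysis" "HOL-Probability.Essential_Supremum"
begin

definition C0_semigroup :: "(real \<Rightarrow> 'x::real_normed_vector \<Rightarrow> 'x) \<Rightarrow> bool" where
  "C0_semigroup T \<longleftrightarrow>
     (\<forall>t\<ge>0. bounded_linear (T t)) \<and> T 0 = id \<and>
     (\<forall>t\<ge>0. \<forall>s\<ge>0. T (t + s) = T t \<circ> T s) \<and>
     (\<forall>x. ((\<lambda>t. T t x) \<longlongrightarrow> x) (at_right 0))"

definition Gamma_const :: "('n::finite \<Rightarrow> 'x::real_inner \<Rightarrow> 'x) \<Rightarrow> real" where
  "Gamma_const N = sqrt (\<Sum>i\<in>UNIV. onorm (N i \<circ> adjoint (N i)))"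

definition Xi_const :: "('n::finite \<Rightarrow> 'x::real_normed_vector \<Rightarrow> 'x) \<Rightarrow> real" where
  "Xi_const N = (\<Sum>i\<in>UNIV. onorm (N i))"

text \<open>A bilinear system (A, N_1..N_n, B, C): A is represented by the semigroup T it generates,
  B u = sum_i u_i psi_i, C : X -> R^m bounded linear; with the exponential bound
  norm (T t) <= M exp(-nu t), M >= 1, nu > 0, and the standing smallness condition
  M^2 Gamma^2 (2 nu)^(-1) < 1.\<close>
definition bilinear_system ::
  "(real \<Rightarrow> 'x::real_inner \<Rightarrow> 'x) \<Rightarrow> ('n::finite \<Rightarrow> 'x \<Rightarrow> 'x) \<Rightarrow> ('n \<Rightarrow> 'x)
   \<Rightarrow> ('x \<Rightarrow> real^'m) \<Rightarrow> real \<Rightarrow> real \<Rightarrow> bool" where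
  "bilinear_system T N psi C M \<nu> \<longleftrightarrow>
     C0_semigroup T \<and> M \<ge> 1 \<and> \<nu> > 0 \<and>
     (\<forall>t\<ge>0. onorm (T t) \<le> M * exp (- \<nu> * t)) \<and>
     (\<forall>i. bounded_linear (N i)) \<and> bounded_linear C \<and>
     M\<^sup>2 * (Gamma_const N)\<^sup>2 / (2 * \<nu>) < 1"

definition mild_solution ::
  "(real \<Rightarrow> 'x::{real_inner,banach,second_countable_topology} \<Rightarrow> 'x) \<Rightarrow> ('n::finite \<Rightarrow> 'x \<Rightarrow> 'x)
   \<Rightarrow> ('n \<Rightarrow> 'x) \<Rightarrow> (real \<Rightarrow> real^'n) \<Rightarrow> 'x \<Rightarrow> (real \<Rightarrow> 'x) \<Rightarrow> bool" where
  "mild_solution T N psi u phi0 phi \<longleftrightarrow>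
     continuous_on {0..} phi \<and>
     (\<forall>t\<ge>0.
        set_integrable lebesgue {0..t}
          (\<lambda>s. T (t - s) ((\<Sum>i\<in>UNIV. u s $ i *\<^sub>R N i (phi s)) + (\<Sum>i\<in>UNIV. u s $ i *\<^sub>R psi i))) \<and>
        phi t = T t phi0 + (LINT s:{0..t}|lebesgue.
                   T (t - s) ((\<Sum>i\<in>UNIV. u s $ i *\<^sub>R N i (phi s)) + (\<Sum>i\<in>UNIV. u s $ i *\<^sub>R psi i))))"

definition L2inf_norm :: "(real \<Rightarrow> real^'n::finite) \<Rightarrow> real" where
  "L2inf_norm u = sqrt (LINT t:{0<..}|lebesgue. (infnorm (u t))\<^sup>2)"

definition Linf_norm :: "(real \<Rightarrow> real^'n::finite) \<Rightarrow> ereal" where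
  "Linf_norm u = esssup (restrict_space lebesgue {0<..}) (\<lambda>t. ereal (infnorm (u t)))"

text \<open>An element f of F^n(K) = direct sum over k >= 0 of L^2((0,oo)^(k+1), K (x) (R^n)^(x)k)
  is represented by its components: f k s (j, ns) is the (j, ns)-coordinate (j indexes a basis
  of K, ns a list of length k indexing the basis e_{n_1} (x) ... (x) e_{n_k}) at the time
  vector s = (s 0, ..., s k).\<close>
type_synonym ('k, 'n) fock = "nat \<Rightarrow> (nat \<Rightarrow> real) \<Rightarrow> 'k \<times> 'n list \<Rightarrow> real"

definition tmeas :: "nat \<Rightarrow> (nat \<Rightarrow> real) measure" where
  "tmeas k = PiM {..k} (\<lambda>_. lborel)"

definition tdom :: "nat \<Rightarrow> (nat \<Rightarrow> real) set" where
  "tdom k = PiE {..k} (\<lambda>_. {0<..})"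

definition nlists :: "nat \<Rightarrow> 'n list set" where
  "nlists k = {ns. length ns = k}"

definition tidx :: "nat \<Rightarrow> ('k \<times> 'n list) set" where
  "tidx k = UNIV \<times> nlists k"

definition in_fock :: "('k::finite, 'n::finite) fock \<Rightarrow> bool" where
  "in_fock f \<longleftrightarrow>
     (\<forall>k. \<forall>jns\<in>tidx k. (\<lambda>s. f k s jns) \<in> borel_measurable (tmeas k)) \<and>
     (\<forall>k. set_integrable (tmeas k) (tdom k) (\<lambda>s. \<Sum>jns\<in>tidx k. (f k s jns)\<^sup>2)) \<and>
     summable (\<lambda>k. LINT s:tdom k|tmeas k. (\<Sum>jns\<in>tidx k. (f k s jns)\<^sup>2))"

definition fock_inner :: "('k::finite, 'n::finite) fock \<Rightarrow> ('k, 'n) fock \<Rightarrow> real" where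
  "fock_inner f g = (\<Sum>k. LINT s:tdom k|tmeas k. (\<Sum>jns\<in>tidx k. f k s jns * g k s jns))"

definition fock_orthonormal :: "(nat \<Rightarrow> ('k::finite, 'n::finite) fock) \<Rightarrow> bool" where
  "fock_orthonormal e \<longleftrightarrow>
     (\<forall>i. in_fock (e i)) \<and> (\<forall>i j. fock_inner (e i) (e j) = (if i = j then 1 else 0))"

definition trace_norm :: "(('a::finite, 'n::finite) fock \<Rightarrow> ('b::finite, 'n) fock) \<Rightarrow> ereal" where
  "trace_norm L = Sup {(\<Sum>i. ereal \<bar>fock_inner (L (e i)) (f i)\<bar>) | e f.
                         fock_orthonormal e \<and> fock_orthonormal f}"

fun Ochain :: "(real \<Rightarrow> 'x \<Rightarrow> 'x) \<Rightarrow> ('n \<Rightarrow> 'x \<Rightarrow> 'x) \<Rightarrow> (nat \<Rightarrow> real) \<Rightarrow> nat \<Rightarrow> 'n list \<Rightarrow> 'x \<Rightarrow> 'x" where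
  "Ochain T N s i [] y = T (s i) y"
| "Ochain T N s i (n # ns) y = T (s i) (N n (Ochain T N s (Suc i) ns y))"

fun Pchain :: "(real \<Rightarrow> 'x::real_inner \<Rightarrow> 'x) \<Rightarrow> ('n \<Rightarrow> 'x \<Rightarrow> 'x) \<Rightarrow> (nat \<Rightarrow> real) \<Rightarrow> nat \<Rightarrow> 'n list \<Rightarrow> 'x \<Rightarrow> 'x" where
  "Pchain T N s i [] y = adjoint (T (s i)) y"
| "Pchain T N s i (n # ns) y = adjoint (T (s i)) (adjoint (N n) (Pchain T N s (Suc i) ns y))"

text \<open>P_k(s) : X -> X (x) (R^n)^(x)k, elements of the tensor product represented as
  functions on index lists of length k.\<close>
definition Pk :: "(real \<Rightarrow> 'x::real_inner \<Rightarrow> 'x) \<Rightarrow> ('n \<Rightarrow> 'x \<Rightarrow> 'x) \<Rightarrow> nat \<Rightarrow> (nat \<Rightarrow> real) \<Rightarrow> 'x \<Rightarrow> 'n list \<Rightarrow> 'x" where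
  "Pk T N k s y = (\<lambda>ns. if length ns = k then Pchain T N s 0 ns y else 0)"

definition tensor_adjoint :: "nat \<Rightarrow> ('x::real_inner \<Rightarrow> 'n list \<Rightarrow> 'x) \<Rightarrow> ('n list \<Rightarrow> 'x) \<Rightarrow> 'x" where
  "tensor_adjoint k L = (SOME L'. \<forall>y z. (\<Sum>ns\<in>nlists k. inner (L y ns) (z ns)) = inner y (L' z))"

definition Wop :: "(real \<Rightarrow> 'x \<Rightarrow> 'x) \<Rightarrow> ('n::finite \<Rightarrow> 'x \<Rightarrow> 'x) \<Rightarrow> ('x \<Rightarrow> real^'m::finite) \<Rightarrow> 'x \<Rightarrow> ('m, 'n) fock" where
  "Wop T N C y = (\<lambda>k s (j, ns). if length ns = k then C (Ochain T N s 0 ns y) $ j else 0)"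

definition Rop :: "(real \<Rightarrow> 'x::{real_inner,banach,second_countable_topology} \<Rightarrow> 'x) \<Rightarrow> ('n::finite \<Rightarrow> 'x \<Rightarrow> 'x)
   \<Rightarrow> ('n \<Rightarrow> 'x) \<Rightarrow> ('n, 'n) fock \<Rightarrow> 'x" where
  "Rop T N psi f = (\<Sum>k. LINT s:tdom k|tmeas k.
       tensor_adjoint k (Pk T N k s) (\<lambda>ns. \<Sum>i\<in>UNIV. f k s (i, ns) *\<^sub>R psi i))"

definition Hankel :: "(real \<Rightarrow> 'x::{real_inner,banach,second_countable_topology} \<Rightarrow> 'x) \<Rightarrow> ('n::finite \<Rightarrow> 'x \<Rightarrow> 'x)
   \<Rightarrow> ('n \<Rightarrow> 'x) \<Rightarrow> ('x \<Rightarrow> real^'m::finite) \<Rightarrow> ('n, 'n) fock \<Rightarrow> ('m, 'n) fock" where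
  "Hankel T N psi C f = Wop T N C (Rop T N psi f)"

end

theory Submission
  imports Defs
begin

text \<open>
  Expand \<open>C \<phi>(t)\<close> in its Volterra series. In the term of order \<open>k = j + l\<close>, split the gap
  \<open>\<sigma>\<^sub>j = s\<^sub>j - s\<^sub>j\<^sub>+\<^sub>1\<close> between consecutive input times as \<open>\<tau> + \<tau>\<close>: the Volterra kernel becomes the
  diagonal of the kernel of the Hankel operator between the components of degree \<open>j\<close> and \<open>l\<close>, and the
  term is twice a trace \<open>tr(H Y)\<close>. The operator \<open>Y\<close> is block diagonal in \<open>\<tau>\<close>, and the
  Hilbert-Schmidt norm of a block is at most \<open>\<surd>n \<parallel>u\<parallel>\<^sub>\<infinity> \<parallel>u\<parallel>\<^sub>2\<^sup>k\<close>, with the Euclidean norm in \<open>\<parallel>u\<parallel>\<^sub>2 < 1\<close>: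
  the control at the first time after the gap is estimated by its supremum, all others in \<open>L\<^sup>2\<close>.
  All terms of even order (\<open>j = l\<close>) occupy different blocks, hence their sum is at most
  \<open>2 \<surd>n \<parallel>u\<parallel>\<^sub>\<infinity> \<parallel>\<Delta>H\<parallel>\<close> in trace norm; likewise for odd order (\<open>j = l + 1\<close>).

  To stay within the supremum over orthonormal sequences that defines the trace norm, the control is
  approximated by a continuous one, time is discretised with mesh \<open>t / Q\<close>, and \<open>H\<close> is tested against
  normalised indicator functions of cubes of this mesh.
\<close>

section \<open>Trace norm and block contractions\<close>

text \<open>In the kernel of the Hankel operator the last output time and the last input time meet
  and enter only through their sum, so this one gap can be split. With the split fixed, a term of
  order k has k + 1 input times but only k gaps left to integrate over: one control value remains
  without an integral and costs its supremum, and its n labels cost sqrt n. Smallness of the control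
  has two separate roles. The threshold 1 / sqrt n bounds the blocks of all orders by one constant,
  so nothing is summed over orders; the threshold sqrt (2 \<nu>) / (M \<Xi>) makes the Picard
  iteration contract. Within a parity class every output degree and every input degree occurs once,
  which keeps the blocks apart; the two classes share degrees and are estimated separately, so 4 is
  two classes times the 2 of d\<sigma> = 2 d\<tau>. In continuous time Y would carry a Dirac mass on
  the diagonal in \<tau>. On the mesh this becomes pairing of cells with equal index: the entries of
  Y have no factor for \<tau>, and the missing power of the mesh size comes from the normalisation
  of the two indicator functions.\<close>

lemma gram_vectors_exist:
  fixes P :: "'i \<Rightarrow> 'i \<Rightarrow> real"
  assumes "finite I"
    and "\<And>a b. a \<in> I \<Longrightarrow> b \<in> I \<Longrightarrow> P a b = P b a"
    and "\<And>x. 0 \<le> (\<Sum>a\<in>I. \<Sum>b\<in>I. x a * x b * P a b)"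
  shows "\<exists>z. \<forall>a\<in>I. \<forall>b\<in>I. (\<Sum>c\<in>I. z a c * z b c) = P a b"
  using assms
proof (induction I arbitrary: P rule: finite_induct)
  case empty
  then show ?case by simp
next
  case (insert d I)
  have split: "(\<Sum>a\<in>insert d I. \<Sum>b\<in>insert d I. x a * x b * P a b) =
      x d * x d * P d d + 2 * x d * (\<Sum>a\<in>I. x a * P a d) + (\<Sum>a\<in>I. \<Sum>b\<in>I. x a * x b * P a b)" for x
  proof -
    have "(\<Sum>a\<in>I. x d * x a * P d a) = x d * (\<Sum>a\<in>I. x a * P a d)"
      unfolding sum_distrib_left by (rule sum.cong) (use insert.prems(1) in auto)
    moreover have "(\<Sum>a\<in>I. x a * x d * P a d) = x d * (\<Sum>a\<in>I. x a * P a d)"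
      unfolding sum_distrib_left by (rule sum.cong) auto
    ultimately show ?thesis
      using insert.hyps by (simp add: sum.distrib)
  qed
  have psd: "0 \<le> x d * x d * P d d + 2 * x d * (\<Sum>a\<in>I. x a * P a d)
      + (\<Sum>a\<in>I. \<Sum>b\<in>I. x a * x b * P a b)" for x
    using insert.prems(2)[of x] unfolding split .
  have repl: "(\<Sum>a\<in>I. (x(d := y)) a * P a d) = (\<Sum>a\<in>I. x a * P a d)"
    "(\<Sum>a\<in>I. \<Sum>b\<in>I. (x(d := y)) a * (x(d := y)) b * P a b) = (\<Sum>a\<in>I. \<Sum>b\<in>I. x a * x b * P a b)" for x y
    using insert.hyps by (auto intro!: sum.cong)
  have psd': "0 \<le> y * y * P d d + 2 * y * (\<Sum>a\<in>I. x a * P a d)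
      + (\<Sum>a\<in>I. \<Sum>b\<in>I. x a * x b * P a b)" for x y
    using psd[of "x(d := y)"] unfolding repl by simp
  have "0 \<le> P d d"
    using psd'[of 1 "\<lambda>_. 0"] by simp
  \<comment> \<open>Schur complement of the pivot \<open>P d d\<close>. A zero pivot forces its
    whole row to vanish, and then \<open>P\<close> itself is kept.\<close>
  define S where "S a b = (if P d d = 0 then P a b else P a b - P a d * P b d / P d d)" for a b
  have S_sym: "S a b = S b a" if "a \<in> I" "b \<in> I" for a b
    using insert.prems(1) that by (simp add: S_def)
  have S_psd: "0 \<le> (\<Sum>a\<in>I. \<Sum>b\<in>I. x a * x b * S a b)" for x
  proof (cases "P d d = 0")
    case True
    then show ?thesis using psd'[of 0 x] by (simp add: S_def)
  next
    case False
    define r where "r = (\<Sum>a\<in>I. x a * P a d)"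
    have "(\<Sum>a\<in>I. \<Sum>b\<in>I. x a * x b * S a b) =
       (\<Sum>a\<in>I. \<Sum>b\<in>I. x a * x b * P a b) - (\<Sum>a\<in>I. \<Sum>b\<in>I. (x a * P a d) * (x b * P b d)) / P d d"
      unfolding S_def using False
      by (simp add: sum_subtractf[symmetric] sum_divide_distrib algebra_simps)
    also have "(\<Sum>a\<in>I. \<Sum>b\<in>I. (x a * P a d) * (x b * P b d)) = r * r"
      unfolding r_def sum_product ..
    finally have *: "(\<Sum>a\<in>I. \<Sum>b\<in>I. x a * x b * S a b) =
      (\<Sum>a\<in>I. \<Sum>b\<in>I. x a * x b * P a b) - r * r / P d d" .
    \<comment> \<open>The multiple of direction \<open>d\<close> that minimises the form; the
      minimum is the form of \<open>S\<close>.\<close>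
    have "0 \<le> (- r / P d d) * (- r / P d d) * P d d + 2 * (- r / P d d) * r
      + (\<Sum>a\<in>I. \<Sum>b\<in>I. x a * x b * P a b)"
      using psd'[of "- r / P d d" x] by (simp add: r_def)
    then show ?thesis
      unfolding * using False by (simp add: field_simps)
  qed
  obtain z where z: "\<And>a b. a \<in> I \<Longrightarrow> b \<in> I \<Longrightarrow> (\<Sum>c\<in>I. z a c * z b c) = S a b"
    using insert.IH[of S, OF S_sym S_psd] by blast
  have zero: "P a d = 0" if "P d d = 0" "a \<in> I" for a
  proof (rule ccontr)
    assume neq: "P a d \<noteq> 0"
    \<comment> \<open>With pivot zero the form is affine in the coefficient of \<open>d\<close>;
      this coefficient makes it equal to -1.\<close>
    define y where "y = (- P a a - 1) / (2 * P a d)"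
    have "(\<Sum>i\<in>I. of_bool (i = a) * P i d) = P a d"
      "(\<Sum>i\<in>I. \<Sum>j\<in>I. of_bool (i = a) * of_bool (j = a) * P i j) = P a a"
      using insert.hyps that(2) by (simp_all add: mult.assoc flip: sum_distrib_left)
    with psd'[of y "\<lambda>i. of_bool (i = a)"] have "0 \<le> 2 * y * P a d + P a a"
      using that(1) by simp
    also have "2 * y * P a d = - P a a - 1"
      using neq by (simp add: y_def)
    finally show False by simp
  qed
  \<comment> \<open>One Cholesky step: row \<open>d\<close> lives on the new coordinate
    \<open>d\<close> alone, and every old row gains the entry there that restores what the Schur
    complement removed.\<close>
  define z' where "z' a c = (if a = d then (if c = d then sqrt (P d d) else 0)
     else if c = d then (if P d d = 0 then 0 else P a d / sqrt (P d d)) else z a c)" for a c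
  have z'I: "(\<Sum>c\<in>I. z' a c * z' b c) = (\<Sum>c\<in>I. z a c * z b c)" if "a \<in> I" "b \<in> I" for a b
    using insert.hyps that by (auto intro!: sum.cong simp: z'_def)
  have z'0: "(\<Sum>c\<in>I. z' a c * z' b c) = 0" if "a = d \<or> b = d" for a b
    using insert.hyps that by (intro sum.neutral) (auto simp: z'_def)
  show ?case
  proof (intro exI[of _ z'] ballI)
    fix a b assume ab: "a \<in> insert d I" "b \<in> insert d I"
    consider "a = d" "b = d" | "a = d" "b \<in> I" "b \<noteq> d" | "a \<in> I" "a \<noteq> d" "b = d"
      | "a \<in> I" "b \<in> I" "a \<noteq> d" "b \<noteq> d"
      using ab insert.hyps by auto
    then show "(\<Sum>c\<in>insert d I. z' a c * z' b c) = P a b"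
    proof cases
      case 1
      then show ?thesis using insert.hyps z'0[of a b] \<open>0 \<le> P d d\<close> by (simp add: z'_def)
    next
      case 2
      then show ?thesis
        using insert.hyps z'0[of a b] \<open>0 \<le> P d d\<close> zero[of b] insert.prems(1)[of d b]
        by (auto simp: z'_def)
    next
      case 3
      then show ?thesis
        using insert.hyps z'0[of a b] \<open>0 \<le> P d d\<close> zero[of a] insert.prems(1)[of d a]
        by (auto simp: z'_def)
    next
      case 4
      then show ?thesis
        using insert.hyps z'I[of a b] z[of a b] \<open>0 \<le> P d d\<close> zero[of a]
        by (auto simp: z'_def S_def real_sqrt_mult_self)
    qed
  qed
qed

section \<open>Finite linear combinations in Fock space\<close>

lemma set_integrable_sum:
  fixes f :: "'i \<Rightarrow> 'a \<Rightarrow> 'b::{banach, second_countable_topology}"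
  assumes "\<And>i. i \<in> S \<Longrightarrow> set_integrable M A (f i)"
  shows "set_integrable M A (\<lambda>x. \<Sum>i\<in>S. f i x)"
  using assms unfolding set_integrable_def scaleR_sum_right by (intro Bochner_Integration.integrable_sum)

lemma set_integral_sum:
  fixes f :: "'i \<Rightarrow> 'a \<Rightarrow> 'b::{banach, second_countable_topology}"
  assumes "\<And>i. i \<in> S \<Longrightarrow> set_integrable M A (f i)"
  shows "(LINT x:A|M. (\<Sum>i\<in>S. f i x)) = (\<Sum>i\<in>S. (LINT x:A|M. f i x))"
  using assms unfolding set_integrable_def set_lebesgue_integral_def scaleR_sum_right
  by (intro Bochner_Integration.integral_sum)

lemma finite_tidx [simp]: "finite (tidx k :: ('k::finite \<times> 'n::finite list) set)"
  unfolding tidx_def nlists_def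
  using finite_lists_length_eq[of "UNIV :: 'n set" k] by simp

text \<open>What makes \<open>fock_inner\<close> additive in its second argument. The asymmetry is
  deliberate: the first argument may be an image under the Hankel operator with components of every
  degree, the second is a test function with finitely many, so the series over the degrees is a
  finite sum.\<close>

definition pairable :: "('k::finite, 'n::finite) fock \<Rightarrow> ('k, 'n) fock \<Rightarrow> bool" where
  "pairable f g \<longleftrightarrow>
     (\<forall>k. set_integrable (tmeas k) (tdom k) (\<lambda>s. \<Sum>jns\<in>tidx k. f k s jns * g k s jns)) \<and>
     (\<exists>K. \<forall>k\<ge>K. \<forall>s jns. g k s jns = 0)"

definition fock_comb :: "('b \<Rightarrow> ('k, 'n) fock) \<Rightarrow> ('b \<Rightarrow> real) \<Rightarrow> 'b set \<Rightarrow> ('k, 'n) fock" where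
  "fock_comb g r S = (\<lambda>k s jns. \<Sum>b\<in>S. r b * g b k s jns)"

lemma fock_inner_commute: "fock_inner f g = fock_inner g f"
  by (simp add: fock_inner_def mult.commute)

lemma pairable_comb_integrand:
  "(\<Sum>jns\<in>tidx k. f k s jns * fock_comb g r S k s jns)
     = (\<Sum>b\<in>S. r b * (\<Sum>jns\<in>tidx k. f k s jns * g b k s jns))"
  unfolding fock_comb_def sum_distrib_left
  by (subst sum.swap) (simp add: ac_simps)

lemma pairable_comb:
  assumes "\<And>b. b \<in> S \<Longrightarrow> pairable f (g b)" "finite S"
  shows "pairable f (fock_comb g r S)"
proof -
  have "\<exists>K. \<forall>k\<ge>K. \<forall>s jns. \<forall>b\<in>S. g b k s jns = 0"
  proof -
    have "\<forall>b\<in>S. eventually (\<lambda>k. \<forall>s jns. g b k s jns = 0) sequentially"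
      using assms(1) by (auto simp: pairable_def eventually_sequentially)
    then have "eventually (\<lambda>k. \<forall>b\<in>S. \<forall>s jns. g b k s jns = 0) sequentially"
      using assms(2) by (simp add: eventually_ball_finite)
    then show ?thesis
      unfolding eventually_sequentially by blast
  qed
  then have "\<exists>K. \<forall>k\<ge>K. \<forall>s jns. fock_comb g r S k s jns = 0"
    unfolding fock_comb_def by (metis (no_types, lifting) mult_zero_right sum.neutral)
  moreover have "set_integrable (tmeas k) (tdom k)
      (\<lambda>s. \<Sum>jns\<in>tidx k. f k s jns * fock_comb g r S k s jns)" for k
    unfolding pairable_comb_integrand
    by (rule set_integrable_sum) (use assms(1) in \<open>simp add: pairable_def\<close>)
  ultimately show ?thesis
    by (simp add: pairable_def)
qed

lemma pairable_commute:
  assumes "pairable f g" "\<exists>K. \<forall>k\<ge>K. \<forall>s jns. f k s jns = 0"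
  shows "pairable g f"
  using assms by (simp add: pairable_def mult.commute)

lemma fock_inner_comb:
  assumes "\<And>b. b \<in> S \<Longrightarrow> pairable f (g b)" "finite S"
  shows "fock_inner f (fock_comb g r S) = (\<Sum>b\<in>S. r b * fock_inner f (g b))"
proof -
  define h where "h b k = (LINT s:tdom k|tmeas k. (\<Sum>jns\<in>tidx k. f k s jns * g b k s jns))" for b k
  have sm: "summable (h b)" if "b \<in> S" for b
  proof -
    from assms(1)[OF that] obtain K where "\<And>k s jns. k \<ge> K \<Longrightarrow> g b k s jns = 0"
      unfolding pairable_def by blast
    then have "\<And>k. k \<notin> {..<K} \<Longrightarrow> h b k = 0"
      by (simp add: h_def)
    then show ?thesis
      by (rule summable_finite[OF finite_lessThan])
  qed
  have "(LINT s:tdom k|tmeas k. (\<Sum>jns\<in>tidx k. f k s jns * fock_comb g r S k s jns))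
      = (\<Sum>b\<in>S. r b * h b k)" for k
    unfolding pairable_comb_integrand h_def
    using assms
    by (subst set_integral_sum) (auto intro!: set_integrable_mult_right sum.cong simp: pairable_def)
  then have "fock_inner f (fock_comb g r S) = (\<Sum>k. \<Sum>b\<in>S. r b * h b k)"
    by (simp add: fock_inner_def)
  also have "\<dots> = (\<Sum>b\<in>S. \<Sum>k. r b * h b k)"
    by (rule suminf_sum) (auto intro!: summable_mult sm)
  also have "\<dots> = (\<Sum>b\<in>S. r b * fock_inner f (g b))"
    by (intro sum.cong refl) (simp add: suminf_mult[OF sm] fock_inner_def flip: h_def)
  finally show ?thesis .
qed

lemma fock_comb_measurable:
  assumes "\<And>b. b \<in> S \<Longrightarrow> in_fock (g b)" "jns \<in> tidx k"
  shows "(\<lambda>s. fock_comb g r S k s jns) \<in> borel_measurable (tmeas k)"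
  unfolding fock_comb_def
  using assms by (intro borel_measurable_sum borel_measurable_times borel_measurable_const) (auto simp: in_fock_def)

lemma in_fock_comb:
  assumes g: "\<And>b. b \<in> S \<Longrightarrow> in_fock (g b)" and "finite S"
    and p: "\<And>b b'. b \<in> S \<Longrightarrow> b' \<in> S \<Longrightarrow> pairable (g b) (g b')"
  shows "in_fock (fock_comb g r S)"
proof -
  let ?h = "fock_comb g r S"
  have p1: "pairable (g b) ?h" if "b \<in> S" for b
    using pairable_comb[of S "g b"] p that \<open>finite S\<close> by blast
  have "pairable ?h (g b)" if "b \<in> S" for b
  proof (rule pairable_commute[OF p1[OF that]])
    show "\<exists>K. \<forall>k\<ge>K. \<forall>s jns. g b k s jns = 0"
      using p[OF that that] unfolding pairable_def by blast
  qed
  then have hh: "pairable ?h ?h"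
    using pairable_comb[of S ?h g r] \<open>finite S\<close> by blast
  then obtain K where K: "\<And>k s jns. k \<ge> K \<Longrightarrow> ?h k s jns = 0"
    unfolding pairable_def by blast
  have "summable (\<lambda>k. LINT s:tdom k|tmeas k. (\<Sum>jns\<in>tidx k. (?h k s jns)\<^sup>2))"
    by (rule summable_finite[of "{..<K}"]) (auto simp: K not_less)
  then show ?thesis
    using hh g by (auto simp: in_fock_def power2_eq_square pairable_def intro: fock_comb_measurable)
qed

lemma fock_inner_comb_comb:
  assumes "\<And>b b'. pairable (g b) (g b')" "finite S" "finite S'"
  shows "fock_inner (fock_comb g r S) (fock_comb g r' S')
     = (\<Sum>b\<in>S. \<Sum>b'\<in>S'. r b * r' b' * fock_inner (g b) (g b'))"
proof -
  have "pairable (fock_comb g r S) (g b)" for b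
  proof (rule pairable_commute)
    show "pairable (g b) (fock_comb g r S)"
      using assms by (intro pairable_comb)
    show "\<exists>K. \<forall>k\<ge>K. \<forall>s jns. g b k s jns = 0"
      using assms(1)[of b b] unfolding pairable_def by blast
  qed
  then have "fock_inner (fock_comb g r S) (fock_comb g r' S')
     = (\<Sum>b'\<in>S'. r' b' * fock_inner (g b') (fock_comb g r S))"
    using assms by (subst fock_inner_comb) (auto simp: fock_inner_commute)
  also have "\<dots> = (\<Sum>b'\<in>S'. r' b' * (\<Sum>b\<in>S. r b * fock_inner (g b) (g b')))"
    using assms by (subst fock_inner_comb) (auto simp: fock_inner_commute)
  finally show ?thesis
    by (subst sum.swap) (simp add: sum_distrib_left ac_simps)
qed

lemma sum_lessThan_add:
  fixes f :: "nat \<Rightarrow> 'a::comm_monoid_add"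
  shows "(\<Sum>j<K + K'. f j) = (\<Sum>j<K. f j) + (\<Sum>j<K'. f (K + j))"
  by (induction K') (auto simp: add.assoc)

text \<open>A contraction matrix \<open>y\<close> is completed to an isometry by a matrix \<open>z\<close> with
  \<open>z z\<^sup>T = 1 - y y\<^sup>T\<close> acting into spare basis vectors; the contribution of \<open>z\<close> cancels on
  averaging over its sign.\<close>
lemma contraction_le_trace_norm:
  fixes L :: "('a::finite, 'n::finite) fock \<Rightarrow> ('b::finite, 'n) fock"
    and e :: "nat \<Rightarrow> ('a, 'n) fock" and g :: "nat \<Rightarrow> ('b, 'n) fock"
  assumes e: "fock_orthonormal e" and g: "fock_orthonormal g"
    and gp: "\<And>b b'. pairable (g b) (g b')" and Lp: "\<And>a b. pairable (L (e a)) (g b)"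
    and "finite I" "finite J"
    and contr: "\<And>x. (\<Sum>b\<in>J. (\<Sum>a\<in>I. x a * y a b)\<^sup>2) \<le> (\<Sum>a\<in>I. (x a)\<^sup>2)"
  shows "ereal (\<Sum>a\<in>I. \<Sum>b\<in>J. y a b * fock_inner (L (e a)) (g b)) \<le> trace_norm L"
proof -
  obtain K where K: "I \<subseteq> {..<K}" "J \<subseteq> {..<K}"
    using finite_nat_iff_bounded[of "I \<union> J"] \<open>finite I\<close> \<open>finite J\<close> by auto
  define P where "P a b = of_bool (a = b) - (\<Sum>c\<in>J. y a c * y b c)" for a b
  have psd: "0 \<le> (\<Sum>a\<in>I. \<Sum>b\<in>I. x a * x b * P a b)" for x
  proof -
    have "(\<Sum>a\<in>I. \<Sum>b\<in>I. x a * x b * P a b) =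
      (\<Sum>a\<in>I. \<Sum>b\<in>I. x a * x b * of_bool (a = b)) - (\<Sum>a\<in>I. \<Sum>b\<in>I. \<Sum>c\<in>J. (x a * y a c) * (x b * y b c))"
      unfolding P_def by (simp add: sum_subtractf[symmetric] algebra_simps sum_distrib_left)
    also have "(\<Sum>a\<in>I. \<Sum>b\<in>I. x a * x b * of_bool (a = b)) = (\<Sum>a\<in>I. (x a)\<^sup>2)"
      using \<open>finite I\<close> by (intro sum.cong) (auto simp: power2_eq_square mult.assoc simp flip: sum_distrib_left)
    also have "(\<Sum>a\<in>I. \<Sum>b\<in>I. \<Sum>c\<in>J. (x a * y a c) * (x b * y b c))
      = (\<Sum>a\<in>I. \<Sum>c\<in>J. \<Sum>b\<in>I. (x a * y a c) * (x b * y b c))"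
      by (intro sum.cong refl sum.swap)
    also have "\<dots> = (\<Sum>c\<in>J. \<Sum>a\<in>I. \<Sum>b\<in>I. (x a * y a c) * (x b * y b c))"
      by (rule sum.swap)
    also have "\<dots> = (\<Sum>c\<in>J. (\<Sum>a\<in>I. x a * y a c)\<^sup>2)"
      by (simp add: power2_eq_square sum_product)
    finally show ?thesis using contr[of x] by simp
  qed
  have Psym: "P a b = P b a" for a b
    by (auto simp: P_def mult.commute)
  obtain z where z: "\<And>a b. a \<in> I \<Longrightarrow> b \<in> I \<Longrightarrow> (\<Sum>c\<in>I. z a c * z b c) = P a b"
    using gram_vectors_exist[OF \<open>finite I\<close> Psym psd] by blast
  \<comment> \<open>Coordinates below \<open>K\<close> carry \<open>y\<close> and those from
    \<open>K\<close> to \<open>2 K - 1\<close> carry \<open>z\<close>. Indices outside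
    \<open>I\<close> are sent to vectors from \<open>2 K\<close> on, so that \<open>f\<close> is a
    full orthonormal sequence.\<close>
  define r where "r \<sigma> i j = (if j < K then (if j \<in> J then y i j else 0)
      else if j - K \<in> I then \<sigma> * z i (j - K) else 0)" for \<sigma> :: real and i j
  define f where "f \<sigma> i = (if i \<in> I then fock_comb g (r \<sigma> i) {..<K + K} else g (K + K + i))" for \<sigma> i
  have sumr: "(\<Sum>j<K + K. r \<sigma> i j * h j) = (\<Sum>b\<in>J. y i b * h b) + \<sigma> * (\<Sum>c\<in>I. z i c * h (K + c))" for \<sigma> i h
  proof -
    have "(\<Sum>j<K. r \<sigma> i j * h j) = (\<Sum>b\<in>J. y i b * h b)"
      using K by (intro sum.mono_neutral_cong_right) (auto simp: r_def)
    moreover have "(\<Sum>j<K. r \<sigma> i (K + j) * h (K + j)) = (\<Sum>c\<in>I. \<sigma> * z i c * h (K + c))"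
      using K by (intro sum.mono_neutral_cong_right) (auto simp: r_def)
    ultimately show ?thesis
      by (simp add: sum_lessThan_add sum_distrib_left mult.assoc)
  qed
  have gg: "fock_inner (g b) (g b') = of_bool (b = b')" for b b'
    using g by (simp add: fock_orthonormal_def)
  have ortho: "fock_orthonormal (f \<sigma>)" if \<sigma>: "\<sigma> * \<sigma> = 1" for \<sigma>
    unfolding fock_orthonormal_def
  proof (intro conjI allI)
    fix i show "in_fock (f \<sigma> i)"
      using g gp by (auto simp: f_def fock_orthonormal_def intro!: in_fock_comb)
  next
    fix i i'
    have II: "fock_inner (f \<sigma> i) (f \<sigma> i') = of_bool (i = i')" if "i \<in> I" "i' \<in> I"
    proof -
      have "fock_inner (f \<sigma> i) (f \<sigma> i') = (\<Sum>b<K + K. \<Sum>b'<K + K. r \<sigma> i b * r \<sigma> i' b' * of_bool (b = b'))"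
        using that gp by (simp add: f_def fock_inner_comb_comb gg)
      also have "\<dots> = (\<Sum>b<K + K. r \<sigma> i b * r \<sigma> i' b)"
        by (intro sum.cong refl) (auto simp: mult.assoc simp flip: sum_distrib_left)
      also have "\<dots> = (\<Sum>b\<in>J. y i b * r \<sigma> i' b) + \<sigma> * (\<Sum>c\<in>I. z i c * r \<sigma> i' (K + c))"
        by (rule sumr)
      also have "(\<Sum>b\<in>J. y i b * r \<sigma> i' b) = (\<Sum>b\<in>J. y i b * y i' b)"
        using K by (intro sum.cong) (auto simp: r_def)
      also have "(\<Sum>c\<in>I. z i c * r \<sigma> i' (K + c)) = \<sigma> * (\<Sum>c\<in>I. z i c * z i' c)"
        unfolding sum_distrib_left by (intro sum.cong) (auto simp: r_def)
      finally show ?thesis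
        using that z \<sigma> by (simp add: P_def mult.assoc[symmetric])
    qed
    have IN: "fock_inner (g (K + K + i')) (f \<sigma> i) = 0" if "i \<in> I" for i i'
      using that gp by (simp add: f_def fock_inner_comb gg)
    show "fock_inner (f \<sigma> i) (f \<sigma> i') = (if i = i' then 1 else 0)"
    proof (cases "i \<in> I"; cases "i' \<in> I")
      assume "i \<in> I" "i' \<notin> I"
      then show ?thesis using IN[of i i'] by (auto simp: f_def fock_inner_commute)
    next
      assume "i \<notin> I" "i' \<in> I"
      then show ?thesis using IN[of i' i] by (auto simp: f_def)
    qed (use II in \<open>auto simp: f_def gg\<close>)
  qed
  define Y where "Y = (\<Sum>a\<in>I. \<Sum>b\<in>J. y a b * fock_inner (L (e a)) (g b))"
  define Z where "Z = (\<Sum>a\<in>I. \<Sum>c\<in>I. z a c * fock_inner (L (e a)) (g (K + c)))"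
  have bound: "ereal (Y + \<sigma> * Z) \<le> trace_norm L" if \<sigma>: "\<sigma> * \<sigma> = 1" for \<sigma>
  proof -
    have "fock_inner (L (e a)) (f \<sigma> a)
        = (\<Sum>b\<in>J. y a b * fock_inner (L (e a)) (g b)) + \<sigma> * (\<Sum>c\<in>I. z a c * fock_inner (L (e a)) (g (K + c)))"
      if "a \<in> I" for a
      using that Lp by (simp add: f_def fock_inner_comb sumr)
    then have "Y + \<sigma> * Z = (\<Sum>a\<in>I. fock_inner (L (e a)) (f \<sigma> a))"
      by (simp add: Y_def Z_def sum.distrib sum_distrib_left)
    also have "\<dots> \<le> (\<Sum>a\<in>I. \<bar>fock_inner (L (e a)) (f \<sigma> a)\<bar>)"
      by (intro sum_mono) simp
    finally have "ereal (Y + \<sigma> * Z) \<le> (\<Sum>a\<in>I. ereal \<bar>fock_inner (L (e a)) (f \<sigma> a)\<bar>)"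
      by simp
    also have "\<dots> \<le> (\<Sum>a<K. ereal \<bar>fock_inner (L (e a)) (f \<sigma> a)\<bar>)"
      using K by (intro sum_mono2) auto
    also have "\<dots> \<le> (\<Sum>a. ereal \<bar>fock_inner (L (e a)) (f \<sigma> a)\<bar>)"
      by (rule sum_le_suminf) (auto intro: summable_ereal_pos)
    also have "\<dots> \<le> trace_norm L"
      unfolding trace_norm_def using e ortho[OF \<sigma>] by (intro Sup_upper) blast
    finally show ?thesis .
  qed
  \<comment> \<open>The sign \<open>\<sigma>\<close> for which \<open>\<sigma> * Z\<close> is the
    absolute value of \<open>Z\<close> already dominates \<open>Y\<close>.\<close>
  have "Y \<le> Y + \<bar>Z\<bar>" by simp
  then have "ereal Y \<le> ereal (Y + \<bar>Z\<bar>)" by (simp only: ereal_less_eq)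
  also have "\<dots> \<le> trace_norm L"
    using bound[of 1] bound[of "-1"] by (cases "Z \<ge> 0") auto
  finally show ?thesis unfolding Y_def .
qed

text \<open>A block diagonal matrix is a contraction as soon as its blocks are, and by
  Cauchy-Schwarz each block is bounded by its Hilbert-Schmidt norm. The index types are countable
  and infinite, so bijections with the naturals turn the two families into the sequences over which
  the trace norm is a supremum.\<close>

lemma block_sum_le_trace_norm:
  fixes L :: "('a::finite, 'n::finite) fock \<Rightarrow> ('b::finite, 'n) fock"
    and e :: "'i::countable \<Rightarrow> ('a, 'n) fock" and g :: "'j::countable \<Rightarrow> ('b, 'n) fock"
    and blk :: "'i \<Rightarrow> 'z" and blk' :: "'j \<Rightarrow> 'z"
  assumes inf: "infinite (UNIV :: 'i set)" "infinite (UNIV :: 'j set)"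
    and ef: "\<And>a. in_fock (e a)" and ee: "\<And>a a'. fock_inner (e a) (e a') = (if a = a' then 1 else 0)"
    and gf: "\<And>b. in_fock (g b)" and gg: "\<And>b b'. fock_inner (g b) (g b') = (if b = b' then 1 else 0)"
    and gp: "\<And>b b'. pairable (g b) (g b')" and Lp: "\<And>a b. pairable (L (e a)) (g b)"
    and fin: "finite I" "finite J"
    and hs: "\<And>z. (\<Sum>a\<in>{a\<in>I. blk a = z}. \<Sum>b\<in>{b\<in>J. blk' b = z}. (y a b)\<^sup>2) \<le> 1"
  shows "ereal (\<Sum>a\<in>I. \<Sum>b\<in>{b\<in>J. blk' b = blk a}. y a b * fock_inner (L (e a)) (g b)) \<le> trace_norm L"
proof -
  define p where "p = (from_nat_into UNIV :: nat \<Rightarrow> 'i)"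
  define q where "q = (from_nat_into UNIV :: nat \<Rightarrow> 'j)"
  have p: "bij p" and q: "bij q"
    unfolding p_def q_def using bij_betw_from_nat_into[OF _ inf(1)] bij_betw_from_nat_into[OF _ inf(2)] by auto
  define y' where "y' a b = (if blk' b = blk a then y a b else 0)" for a b
  have y'_sum: "(\<Sum>a\<in>I. x a * y' a b) = (\<Sum>a\<in>{a\<in>I. blk a = blk' b}. x a * y a b)" for x b
    using fin by (intro sum.mono_neutral_cong_right) (auto simp: y'_def)
  have contr: "(\<Sum>b\<in>J. (\<Sum>a\<in>I. x a * y' a b)\<^sup>2) \<le> (\<Sum>a\<in>I. (x a)\<^sup>2)" for x
  proof -
    define X where "X z = (\<Sum>a\<in>{a\<in>I. blk a = z}. (x a)\<^sup>2)" for z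
    define Z where "Z = blk ` I \<union> blk' ` J"
    have "finite Z" using fin by (simp add: Z_def)
    have "(\<Sum>b\<in>J. (\<Sum>a\<in>I. x a * y' a b)\<^sup>2) \<le> (\<Sum>b\<in>J. X (blk' b) * (\<Sum>a\<in>{a\<in>I. blk a = blk' b}. (y a b)\<^sup>2))"
      unfolding y'_sum X_def by (intro sum_mono Cauchy_Schwarz_ineq_sum)
    also have "\<dots> = (\<Sum>z\<in>Z. \<Sum>b\<in>{b\<in>J. blk' b = z}. X (blk' b) * (\<Sum>a\<in>{a\<in>I. blk a = blk' b}. (y a b)\<^sup>2))"
      using fin \<open>finite Z\<close> by (intro sum.group[symmetric]) (auto simp: Z_def)
    also have "\<dots> = (\<Sum>z\<in>Z. X z * (\<Sum>b\<in>{b\<in>J. blk' b = z}. \<Sum>a\<in>{a\<in>I. blk a = z}. (y a b)\<^sup>2))"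
      by (simp add: sum_distrib_left)
    also have "\<dots> \<le> (\<Sum>z\<in>Z. X z * 1)"
      by (intro sum_mono mult_left_mono) (subst sum.swap, auto simp: hs X_def intro!: sum_nonneg)
    also have "\<dots> = (\<Sum>a\<in>I. (x a)\<^sup>2)"
      unfolding X_def mult_1_right using fin \<open>finite Z\<close> by (intro sum.group) (auto simp: Z_def)
    finally show ?thesis .
  qed
  have I': "(\<Sum>a\<in>p -` I. h (p a)) = (\<Sum>a\<in>I. h a)" for h :: "'i \<Rightarrow> real"
    by (rule sum.reindex_bij_betw) (use p in \<open>auto simp: bij_betw_def inj_on_def surj_image_vimage_eq bij_is_surj\<close>)
  have J': "(\<Sum>b\<in>q -` J. h (q b)) = (\<Sum>b\<in>J. h b)" for h :: "'j \<Rightarrow> real"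
    by (rule sum.reindex_bij_betw) (use q in \<open>auto simp: bij_betw_def inj_on_def surj_image_vimage_eq bij_is_surj\<close>)
  have "ereal (\<Sum>a\<in>p -` I. \<Sum>b\<in>q -` J. y' (p a) (q b) * fock_inner (L (e (p a))) (g (q b))) \<le> trace_norm L"
  proof (rule contraction_le_trace_norm[where e = "e \<circ> p" and g = "g \<circ> q", unfolded o_def])
    show "fock_orthonormal (\<lambda>x. e (p x))" "fock_orthonormal (\<lambda>x. g (q x))"
      using p q ef ee gf gg by (auto simp: fock_orthonormal_def bij_def inj_eq)
    show "finite (p -` I)" "finite (q -` J)"
      using fin p q by (auto intro!: finite_vimageI simp: bij_def)
    fix x :: "nat \<Rightarrow> real"
    \<comment> \<open>Writes the coefficients as functions of \<open>p a\<close>, the form in which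
      the sums can be reindexed.\<close>
    have xp: "x a = x (inv p (p a))" for a
      using p by (simp add: bij_def)
    show "(\<Sum>b\<in>q -` J. (\<Sum>a\<in>p -` I. x a * y' (p a) (q b))\<^sup>2) \<le> (\<Sum>a\<in>p -` I. (x a)\<^sup>2)"
      apply (subst (1 2) xp)
      apply (subst J'[where h = "\<lambda>b. (\<Sum>a\<in>p -` I. x (inv p (p a)) * y' (p a) b)\<^sup>2"])
      apply (subst I'[where h = "\<lambda>a. x (inv p a) * y' a _"])
      apply (subst I'[where h = "\<lambda>a. (x (inv p a))\<^sup>2"])
      by (rule contr)
  qed (use gp Lp in auto)
  also have "(\<Sum>a\<in>p -` I. \<Sum>b\<in>q -` J. y' (p a) (q b) * fock_inner (L (e (p a))) (g (q b)))
     = (\<Sum>a\<in>I. \<Sum>b\<in>J. y' a b * fock_inner (L (e a)) (g b))"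
    by (subst J'[where h = "\<lambda>b. y' (p _) b * fock_inner (L (e (p _))) (g b)"])
       (rule I'[where h = "\<lambda>a. \<Sum>b\<in>J. y' a b * fock_inner (L (e a)) (g b)"])
  also have "\<dots> = (\<Sum>a\<in>I. \<Sum>b\<in>{b\<in>J. blk' b = blk a}. y a b * fock_inner (L (e a)) (g b))"
    using fin by (intro sum.cong refl sum.mono_neutral_cong_right) (auto simp: y'_def)
  finally show ?thesis .
qed

section \<open>Indicator functions of cubes in Fock space\<close>

text \<open>Open edges keep the cell with index 0 inside the positive times of
  \<open>tdom\<close>.\<close>

definition cube :: "real \<Rightarrow> nat list \<Rightarrow> (nat \<Rightarrow> real) set" where
  "cube \<delta> c = PiE {..<length c} (\<lambda>i. {\<delta> * real (c ! i)<..<\<delta> * real (c ! i) + \<delta>})"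

text \<open>Elementary tensor of the L2-normalised indicator of a cube with \<open>w\<close> and the
  basis tensor of the labels \<open>ns\<close>. A component of degree k depends on k + 1 times, so
  \<open>c\<close> always has one entry more than \<open>ns\<close>.\<close>

definition box_fun :: "real \<Rightarrow> nat list \<Rightarrow> 'n list \<Rightarrow> real^'k \<Rightarrow> ('k, 'n) fock" where
  "box_fun \<delta> c ns w = (\<lambda>k s (j, ns'). if k = length ns \<and> ns' = ns
     then w $ j * indicator (cube \<delta> c) s / sqrt (\<delta> ^ length c) else 0)"

lemma sets_cube:
  assumes "length c = Suc k"
  shows "cube \<delta> c \<in> sets (tmeas k)"
  unfolding cube_def tmeas_def assms lessThan_Suc_atMost
  by (intro sets_PiM_I_finite) auto

lemma emeasure_cube:
  assumes "length c = Suc k" "0 \<le> \<delta>"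
  shows "emeasure (tmeas k) (cube \<delta> c) = ennreal (\<delta> ^ length c)"
proof -
  interpret product_sigma_finite "\<lambda>_::nat. lborel :: real measure" ..
  have "emeasure (tmeas k) (cube \<delta> c) = (\<Prod>i\<in>{..k}. emeasure lborel {\<delta> * real (c ! i)<..<\<delta> * real (c ! i) + \<delta>})"
    unfolding cube_def tmeas_def assms lessThan_Suc_atMost by (rule emeasure_PiM) auto
  also have "\<dots> = ennreal (\<delta> ^ length c)"
    using assms by (simp add: ennreal_power power_Suc[symmetric] del: power_Suc)
  finally show ?thesis .
qed

lemma measure_cube:
  assumes "length c = Suc k" "0 \<le> \<delta>"
  shows "measure (tmeas k) (cube \<delta> c) = \<delta> ^ length c"
  using emeasure_cube[OF assms] assms by (simp add: measure_def)

lemma cube_subset_tdom: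
  assumes "length c = Suc k" "0 \<le> \<delta>"
  shows "cube \<delta> c \<subseteq> tdom k"
proof -
  have "0 \<le> \<delta> * real (c ! i)" for i
    using assms by simp
  then show ?thesis
    unfolding cube_def tdom_def assms lessThan_Suc_atMost
    by (intro PiE_mono subsetI) (metis greaterThanLessThan_iff greaterThan_iff le_less_trans)
qed

lemma cube_bounds:
  assumes "s \<in> cube \<delta> c" "i < length c"
  shows "\<delta> * real (c ! i) < s i" "s i < \<delta> * real (c ! i) + \<delta>"
  using assms by (auto simp: cube_def dest!: PiE_mem[where x = i])

lemma cube_disjoint:
  assumes "length c = length c'" "c \<noteq> c'" "0 \<le> \<delta>"
  shows "cube \<delta> c \<inter> cube \<delta> c' = {}"
proof (rule ccontr)
  assume "cube \<delta> c \<inter> cube \<delta> c' \<noteq> {}"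
  then obtain s where s: "s \<in> cube \<delta> c" "s \<in> cube \<delta> c'" by auto
  obtain i where i: "i < length c" "c ! i \<noteq> c' ! i"
    using assms by (auto simp: list_eq_iff_nth_eq)
  have "\<delta> * real (c ! i) < \<delta> * (real (c' ! i) + 1)" "\<delta> * real (c' ! i) < \<delta> * (real (c ! i) + 1)"
    using cube_bounds[OF s(1), of i] cube_bounds[OF s(2), of i] i assms(1) by (auto simp: algebra_simps)
  then have "real (c ! i) < real (c' ! i) + 1" "real (c' ! i) < real (c ! i) + 1"
    using assms(3) by (auto dest: mult_left_less_imp_less)
  then show False using i by linarith
qed

lemma box_fun_integrand:
  fixes G :: "('k::finite, 'n::finite) fock"
  assumes "length c = Suc (length ns)"
  shows "(\<Sum>jns\<in>tidx k. G k s jns * box_fun \<delta> c ns w k s jns) =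
    (if k = length ns then indicator (cube \<delta> c) s * (\<Sum>j\<in>UNIV. G k s (j, ns) * w $ j) / sqrt (\<delta> ^ length c) else 0)"
proof (cases "k = length ns")
  case True
  have "(\<Sum>jns\<in>tidx k. G k s jns * box_fun \<delta> c ns w k s jns)
     = (\<Sum>jns\<in>(\<lambda>j. (j, ns)) ` UNIV. G k s jns * box_fun \<delta> c ns w k s jns)"
    using True by (intro sum.mono_neutral_right) (auto simp: tidx_def nlists_def box_fun_def image_iff intro: finite_tidx[unfolded tidx_def nlists_def])
  also have "\<dots> = (\<Sum>j\<in>UNIV. G k s (j, ns) * box_fun \<delta> c ns w k s (j, ns))"
    by (subst sum.reindex) (auto simp: inj_on_def)
  also have "\<dots> = indicator (cube \<delta> c) s * (\<Sum>j\<in>UNIV. G k s (j, ns) * w $ j) / sqrt (\<delta> ^ length c)"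
    using True by (simp add: box_fun_def sum_distrib_left sum_divide_distrib ac_simps)
  finally show ?thesis using True by simp
qed (auto simp: box_fun_def intro!: sum.neutral)

lemma fock_inner_box_fun:
  assumes c: "length c = Suc (length ns)" and "0 \<le> \<delta>"
  shows "fock_inner G (box_fun \<delta> c ns w)
    = (LINT s:cube \<delta> c|tmeas (length ns). (\<Sum>j\<in>UNIV. G (length ns) s (j, ns) * w $ j)) / sqrt (\<delta> ^ length c)"
proof -
  define h where "h k = (LINT s:tdom k|tmeas k. (\<Sum>jns\<in>tidx k. G k s jns * box_fun \<delta> c ns w k s jns))" for k
  have "h k = 0" if "k \<notin> {length ns}" for k
    using that by (simp add: h_def box_fun_integrand[OF c])
  then have "(\<Sum>k. h k) = h (length ns)"
    using suminf_finite[of "{length ns}" h] by simp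
  moreover have "h (length ns) = (LINT s:cube \<delta> c|tmeas (length ns). (\<Sum>j\<in>UNIV. G (length ns) s (j, ns) * w $ j)) / sqrt (\<delta> ^ length c)"
    unfolding h_def box_fun_integrand[OF c] set_lebesgue_integral_def
    using cube_subset_tdom[OF c \<open>0 \<le> \<delta>\<close>]
    by (subst integral_divide_zero[symmetric])
       (auto intro!: Bochner_Integration.integral_cong simp: indicator_def)
  ultimately show ?thesis
    by (simp add: fock_inner_def h_def)
qed

lemma pairable_box_fun:
  assumes c: "length c = Suc (length ns)" and "0 \<le> \<delta>"
    and G: "\<And>j. set_integrable (tmeas (length ns)) (cube \<delta> c) (\<lambda>s. G (length ns) s (j, ns))"
  shows "pairable G (box_fun \<delta> c ns w)"
  unfolding pairable_def
proof (intro conjI allI)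
  fix k
  show "set_integrable (tmeas k) (tdom k) (\<lambda>s. \<Sum>jns\<in>tidx k. G k s jns * box_fun \<delta> c ns w k s jns)"
  proof (cases "k = length ns")
    case True
    have "set_integrable (tmeas k) (cube \<delta> c) (\<lambda>s. \<Sum>j\<in>UNIV. G k s (j, ns) * w $ j)"
      using G unfolding True by (intro set_integrable_sum set_integrable_mult_left)
    then have "integrable (tmeas k) (\<lambda>s. (indicator (cube \<delta> c) s * (\<Sum>j\<in>UNIV. G k s (j, ns) * w $ j)) / sqrt (\<delta> ^ length c))"
      unfolding set_integrable_def by (intro integrable_divide_zero) simp
    also have "(\<lambda>s. (indicator (cube \<delta> c) s * (\<Sum>j\<in>UNIV. G k s (j, ns) * w $ j)) / sqrt (\<delta> ^ length c))
      = (\<lambda>s. indicator (tdom k) s *\<^sub>R (\<Sum>jns\<in>tidx k. G k s jns * box_fun \<delta> c ns w k s jns))"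
      using cube_subset_tdom[OF c \<open>0 \<le> \<delta>\<close>] True
      by (auto simp: box_fun_integrand[OF c] indicator_def fun_eq_iff)
    finally show ?thesis
      unfolding set_integrable_def .
  qed (simp add: box_fun_integrand[OF c] set_integrable_def)
  show "\<exists>K. \<forall>k\<ge>K. \<forall>s jns. box_fun \<delta> c ns w k s jns = 0"
    by (rule exI[of _ "Suc (length ns)"]) (auto simp: box_fun_def)
qed

lemma finite_emeasure_cube: "length c = Suc k \<Longrightarrow> 0 \<le> \<delta> \<Longrightarrow> emeasure (tmeas k) (cube \<delta> c) < \<infinity>"
  by (simp add: emeasure_cube)

lemma set_integrable_cube_box_fun:
  assumes "length c = Suc (length ns)" "length c' = Suc k" "0 \<le> \<delta>"
  shows "set_integrable (tmeas k) (cube \<delta> c') (\<lambda>s. box_fun \<delta> c ns w k s (j, ns'))"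
proof (cases "k = length ns \<and> ns' = ns")
  case True
  have "integrable (tmeas k) (\<lambda>s. (w $ j / sqrt (\<delta> ^ length c)) * indicat_real (cube \<delta> c' \<inter> cube \<delta> c) s)"
    using True assms sets_cube[of c' k \<delta>] sets_cube[of c k \<delta>] finite_emeasure_cube[of c k \<delta>]
    by (intro integrable_mult_right integrable_real_indicator)
       (auto intro: le_less_trans[OF emeasure_mono])
  then show ?thesis
    using True by (simp add: set_integrable_def box_fun_def indicator_inter_arith ac_simps)
qed (auto simp: box_fun_def set_integrable_def)

lemma pairable_box_fun_box_fun:
  assumes "length c = Suc (length ns)" "length c' = Suc (length ns')" "0 \<le> \<delta>"
  shows "pairable (box_fun \<delta> c ns w) (box_fun \<delta> c' ns' w')"
  using assms by (intro pairable_box_fun set_integrable_cube_box_fun) auto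

lemma in_fock_box_fun:
  assumes c: "length c = Suc (length ns)" and "0 \<le> \<delta>"
  shows "in_fock (box_fun \<delta> c ns w)"
proof -
  have p: "pairable (box_fun \<delta> c ns w) (box_fun \<delta> c ns w)"
    using assms by (intro pairable_box_fun_box_fun)
  have "(\<lambda>s. box_fun \<delta> c ns w k s (j, ns')) \<in> borel_measurable (tmeas k)" for k j ns'
    using sets_cube[of c k \<delta>] c
    by (cases "k = length ns \<and> ns' = ns") (auto simp: box_fun_def)
  moreover have "summable (\<lambda>k. LINT s:tdom k|tmeas k. (\<Sum>jns\<in>tidx k. (box_fun \<delta> c ns w k s jns)\<^sup>2))"
    by (rule summable_finite[of "{length ns}"]) (auto simp: power2_eq_square box_fun_integrand[OF c])
  ultimately show ?thesis
    using p by (auto simp: in_fock_def pairable_def power2_eq_square)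
qed

lemma fock_inner_box_fun_box_fun:
  assumes c: "length c = Suc (length ns)" "length c' = Suc (length ns')" and \<delta>: "0 < \<delta>"
  shows "fock_inner (box_fun \<delta> c ns w) (box_fun \<delta> c' ns' w') = (if c = c' \<and> ns = ns' then w \<bullet> w' else 0)"
proof -
  have eq: "fock_inner (box_fun \<delta> c ns w) (box_fun \<delta> c' ns' w')
    = (LINT s:cube \<delta> c'|tmeas (length ns'). (\<Sum>j\<in>UNIV. box_fun \<delta> c ns w (length ns') s (j, ns') * w' $ j)) / sqrt (\<delta> ^ length c')"
    using c \<delta> by (intro fock_inner_box_fun) auto
  show ?thesis
  proof (cases "c = c' \<and> ns = ns'")
    case True
    have "(LINT s:cube \<delta> c'|tmeas (length ns'). (\<Sum>j\<in>UNIV. box_fun \<delta> c ns w (length ns') s (j, ns') * w' $ j))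
       = (LINT s:cube \<delta> c|tmeas (length ns). (w \<bullet> w') / sqrt (\<delta> ^ length c))"
      using sets_cube[OF c(1)] unfolding True[THEN conjunct1, symmetric] True[THEN conjunct2, symmetric]
      by (intro set_lebesgue_integral_cong) (auto simp: box_fun_def inner_vec_def sum_divide_distrib)
    also have "\<dots> = \<delta> ^ length c * ((w \<bullet> w') / sqrt (\<delta> ^ length c))"
      using sets_cube[OF c(1)] finite_emeasure_cube[OF c(1), of \<delta>] measure_cube[OF c(1), of \<delta>] \<delta>
      by (subst set_integral_const) auto
    also have "\<delta> ^ length c = sqrt (\<delta> ^ length c) * sqrt (\<delta> ^ length c)"
      using \<delta> by simp
    finally show ?thesis
      using True \<delta> unfolding eq by (simp del: real_sqrt_mult_self)
  next
    case False
    have "(\<Sum>j\<in>UNIV. box_fun \<delta> c ns w (length ns') s (j, ns') * w' $ j) = 0" if "s \<in> cube \<delta> c'" for s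
      using that False c \<delta> cube_disjoint[of c c' \<delta>] by (intro sum.neutral) (auto simp: box_fun_def indicator_def)
    then have "(LINT s:cube \<delta> c'|tmeas (length ns'). (\<Sum>j\<in>UNIV. box_fun \<delta> c ns w (length ns') s (j, ns') * w' $ j))
       = (LINT s:cube \<delta> c'|tmeas (length ns'). 0)"
      using sets_cube[OF c(2)] by (intro set_lebesgue_integral_cong) auto
    then show ?thesis
      using False unfolding eq by auto
  qed
qed

section \<open>Adjoints on Hilbert space and the reachability operator\<close>

text \<open>The representing vector is the minimiser of half the squared norm minus
  \<open>f\<close>. The parallelogram law makes every minimising sequence Cauchy, and the
  first-order condition at the limit is the claim.\<close>

lemma riesz_representation:
  fixes f :: "'x::{real_inner,banach} \<Rightarrow> real"
  assumes "bounded_linear f"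
  shows "\<exists>z. \<forall>x. f x = x \<bullet> z"
proof -
  interpret bounded_linear f by fact
  obtain K where K: "\<And>x. \<bar>f x\<bar> \<le> norm x * K" and "K > 0"
    using pos_bounded by auto
  define q where "q x = (norm x)\<^sup>2 / 2 - f x" for x
  have lower: "- K\<^sup>2 / 2 \<le> q x" for x
  proof -
    have "0 \<le> (norm x - K)\<^sup>2 / 2" by simp
    also have "\<dots> = (norm x)\<^sup>2 / 2 - norm x * K + K\<^sup>2 / 2"
      by (simp add: power2_eq_square field_simps)
    finally show ?thesis using K[of x] by (simp add: q_def abs_le_iff)
  qed
  define d where "d = Inf (range q)"
  have bdd: "bdd_below (range q)"
    using lower by (auto intro!: bdd_belowI)
  have d: "d \<le> q x" for x
    unfolding d_def by (intro cInf_lower bdd) auto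
  have "\<exists>x. q x < d + 1 / real (Suc n)" for n
    using cInf_less_iff[OF _ bdd, of "d + 1 / real (Suc n)"] unfolding d_def[symmetric] by auto
  then obtain s where s: "\<And>n. q (s n) < d + 1 / real (Suc n)" by metis
  have par: "(norm (x - y))\<^sup>2 / 4 = q x + q y - 2 * q ((1/2) *\<^sub>R (x + y))" for x y
  proof -
    have "f ((1/2) *\<^sub>R (x + y)) = (f x + f y) / 2" by (simp add: scale add)
    moreover have "(norm ((1/2) *\<^sub>R (x + y)))\<^sup>2 = (norm (x + y))\<^sup>2 / 4"
      by (simp add: power_mult_distrib power2_eq_square)
    ultimately show ?thesis
      by (simp add: q_def power2_norm_eq_inner inner_diff_left inner_diff_right inner_add_left
          inner_add_right inner_commute field_simps)
  qed
  have "Cauchy s"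
  proof (rule CauchyI)
    fix e :: real assume "e > 0"
    obtain N where N: "1 / real (Suc N) < e\<^sup>2 / 8"
      using reals_Archimedean[of "e\<^sup>2 / 8"] \<open>e > 0\<close> by (auto simp: inverse_eq_divide)
    have "norm (s m - s n) < e" if "m \<ge> N" "n \<ge> N" for m n
    proof -
      have "1 / real (Suc m) \<le> 1 / real (Suc N)" "1 / real (Suc n) \<le> 1 / real (Suc N)"
        using that by (auto intro!: divide_left_mono)
      then have "(norm (s m - s n))\<^sup>2 / 4 < e\<^sup>2 / 4"
        using s[of m] s[of n] d[of "(1/2) *\<^sub>R (s m + s n)"] N unfolding par by linarith
      then have "(norm (s m - s n))\<^sup>2 < e\<^sup>2"
        by linarith
      then show ?thesis
        using power_mono[of e "norm (s m - s n)" 2] \<open>e > 0\<close> by linarith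
    qed
    then show "\<exists>M. \<forall>m\<ge>M. \<forall>n\<ge>M. norm (s m - s n) < e" by blast
  qed
  then obtain z where z: "s \<longlonglongrightarrow> z"
    using Cauchy_convergent convergent_def by blast
  have "(\<lambda>n. q (s n)) \<longlonglongrightarrow> q z"
    unfolding q_def by (intro tendsto_intros z tendsto) simp
  moreover have "(\<lambda>n. d + 1 / real (Suc n)) \<longlonglongrightarrow> d + 0"
    by (intro tendsto_intros LIMSEQ_Suc[OF lim_1_over_n])
  ultimately have "q z \<le> d"
    using s by (intro LIMSEQ_le[of "\<lambda>n. q (s n)" "q z" _ d]) (auto intro!: exI[of _ 0] less_imp_le)
  have "f x = x \<bullet> z" for x
  proof -
    define a where "a = z \<bullet> x - f x"
    have "0 \<le> r * a + r\<^sup>2 * (norm x)\<^sup>2 / 2" for r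
    proof -
      have "q z \<le> q (z + r *\<^sub>R x)"
        using \<open>q z \<le> d\<close> d order_trans by blast
      also have "\<dots> = q z + r * a + r\<^sup>2 * (norm x)\<^sup>2 / 2"
      proof -
        have "(norm (z + r *\<^sub>R x))\<^sup>2 = (norm z)\<^sup>2 + 2 * r * (z \<bullet> x) + r\<^sup>2 * (norm x)\<^sup>2"
          unfolding power2_norm_eq_inner
          by (simp add: inner_add_left inner_add_right inner_commute power2_eq_square algebra_simps)
        then show ?thesis
          by (simp add: q_def a_def add scale field_simps)
      qed
      finally show ?thesis by simp
    qed
    \<comment> \<open>With \<open>r = - a / D\<close> the linear term beats the quadratic one unless
      \<open>a = 0\<close>; the summand 1 keeps \<open>D\<close> positive for
      \<open>x = 0\<close>.\<close>
    moreover define D where "D = 1 + (norm x)\<^sup>2"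
    ultimately have "0 \<le> (- a / D) * a + (- a / D)\<^sup>2 * (norm x)\<^sup>2 / 2"
      by blast
    also have "\<dots> = - (a\<^sup>2 / D) + a\<^sup>2 / D * ((norm x)\<^sup>2 / D / 2)"
      by (simp add: power2_eq_square)
    finally have 1: "a\<^sup>2 / D \<le> a\<^sup>2 / D * ((norm x)\<^sup>2 / D / 2)"
      by simp
    have "0 < D" unfolding D_def by (simp add: add_pos_nonneg)
    then have "(norm x)\<^sup>2 / D / 2 \<le> 1 / 2" "0 \<le> a\<^sup>2 / D"
      by (auto simp: D_def)
    then have "a\<^sup>2 / D * ((norm x)\<^sup>2 / D / 2) \<le> a\<^sup>2 / D * (1 / 2)"
      by (intro mult_left_mono)
    with 1 have "a\<^sup>2 / D \<le> 0" by simp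
    then have "a\<^sup>2 \<le> 0" using \<open>0 < D\<close> by (simp add: divide_le_0_iff)
    then show ?thesis by (simp add: a_def inner_commute)
  qed
  then show ?thesis by blast
qed

text \<open>\<open>adjoint\<close> is a choice among the maps satisfying the adjoint identity; Riesz
  representation at each \<open>y\<close> shows that there is one.\<close>

lemma adjoint_inner:
  fixes f :: "'x::{real_inner,banach} \<Rightarrow> 'y::real_inner"
  assumes "bounded_linear f"
  shows "x \<bullet> adjoint f y = f x \<bullet> y"
proof -
  have "\<exists>z. \<forall>x. f x \<bullet> y = x \<bullet> z" for y
    by (rule riesz_representation)
       (rule bounded_linear_compose[OF bounded_linear_inner_left assms])
  then have "\<exists>f'. \<forall>x y. f x \<bullet> y = x \<bullet> f' y" by metis
  then have "\<forall>x y. f x \<bullet> y = x \<bullet> adjoint f y"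
    unfolding adjoint_def by (rule someI_ex)
  then show ?thesis by simp
qed

section \<open>Strong continuity and measurability of the semigroup\<close>

locale bounded_semigroup_system =
  fixes T :: "real \<Rightarrow> 'x::{real_inner,banach,second_countable_topology} \<Rightarrow> 'x"
    and N :: "'n::finite \<Rightarrow> 'x \<Rightarrow> 'x" and psi :: "'n \<Rightarrow> 'x"
    and C :: "'x \<Rightarrow> real^'m::finite" and M :: real
  assumes T_linear: "0 \<le> t \<Longrightarrow> bounded_linear (T t)"
    and T_0: "T 0 = id"
    and T_add: "0 \<le> t \<Longrightarrow> 0 \<le> s \<Longrightarrow> T (t + s) x = T t (T s x)"
    and T_right: "((\<lambda>t. T t x) \<longlongrightarrow> x) (at_right 0)"
    and T_bound: "0 \<le> t \<Longrightarrow> norm (T t x) \<le> M * norm x"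
    and N_linear: "bounded_linear (N i)"
    and C_linear: "bounded_linear C"
begin

lemma T_diff: "0 \<le> t \<Longrightarrow> T t (x - y) = T t x - T t y"
  using T_linear by (simp add: linear_diff bounded_linear.linear)

lemma T_zero [simp]: "0 \<le> t \<Longrightarrow> T t 0 = 0"
  using T_linear by (simp add: linear_0 bounded_linear.linear)

text \<open>The operator at the smaller time factors out of the difference and is bounded by
  \<open>M\<close>; continuity everywhere thus reduces to continuity at 0.\<close>

lemma T_orbit_diff:
  assumes "0 \<le> s" "0 \<le> t"
  shows "norm (T s x - T t x) \<le> M * norm (T \<bar>s - t\<bar> x - x)"
proof -
  have *: "norm (T s x - T t x) \<le> M * norm (T \<bar>s - t\<bar> x - x)" if "0 \<le> t" "t \<le> s" for s t
  proof -
    have "T s x - T t x = T t (T (s - t) x - x)"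
      using T_add[of t "s - t" x] that by (simp add: T_diff)
    then show ?thesis using T_bound[of t] that by simp
  qed
  show ?thesis
    using *[of t s] *[of s t] assms by (cases "t \<le> s") (auto simp: norm_minus_commute abs_minus_commute)
qed

text \<open>\<open>T\<close> is unspecified at negative times, hence the truncation \<open>max 0\<close>.\<close>
lemma T_tendsto_0: "((\<lambda>t. T (max 0 t) x) \<longlongrightarrow> x) (at 0)"
proof -
  have "((\<lambda>t. T (max 0 t) x) \<longlongrightarrow> x) (at_right 0)"
    by (rule Lim_transform_eventually[OF T_right])
       (auto simp: eventually_at_filter max_def intro!: always_eventually)
  moreover have "((\<lambda>t. T (max 0 t) x) \<longlongrightarrow> x) (at_left 0)"
    by (rule tendsto_eventually)
       (auto simp: eventually_at_filter max_def T_0 intro!: always_eventually)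
  ultimately show ?thesis
    by (simp add: filterlim_split_at_real)
qed

lemma T_orbit_continuous: "continuous_on UNIV (\<lambda>t. T (max 0 t) x)"
proof -
  have "((\<lambda>t. T (max 0 t) x) \<longlongrightarrow> T (max 0 t0) x) (at t0)" for t0
  proof -
    have 1: "((\<lambda>t. \<bar>max 0 t - max 0 t0\<bar>) \<longlongrightarrow> \<bar>max 0 t0 - max 0 t0\<bar>) (at t0)"
      by (intro tendsto_intros)
    have iso: "isCont (\<lambda>t. T (max 0 t) x) 0"
      using T_tendsto_0 by (simp add: isCont_def T_0)
    have "((\<lambda>t. T (max 0 \<bar>max 0 t - max 0 t0\<bar>) x) \<longlongrightarrow> T (max 0 \<bar>max 0 t0 - max 0 t0\<bar>) x) (at t0)"
      using isCont_tendsto_compose[OF _ 1, of "\<lambda>t. T (max 0 t) x"] iso by simp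
    then have "((\<lambda>t. T \<bar>max 0 t - max 0 t0\<bar> x) \<longlongrightarrow> x) (at t0)"
      by (simp add: T_0)
    then have "((\<lambda>t. M * norm (T \<bar>max 0 t - max 0 t0\<bar> x - x)) \<longlongrightarrow> M * norm (x - x)) (at t0)"
      by (intro tendsto_intros)
    then have 2: "((\<lambda>t. M * norm (T \<bar>max 0 t - max 0 t0\<bar> x - x)) \<longlongrightarrow> 0) (at t0)" by simp
    have "((\<lambda>t. T (max 0 t) x - T (max 0 t0) x) \<longlongrightarrow> 0) (at t0)"
      by (rule Lim_null_comparison[OF _ 2]) (auto intro!: always_eventually T_orbit_diff)
    then show ?thesis by (simp add: LIM_zero_iff)
  qed
  then show ?thesis
    by (simp add: continuous_on_def)
qed

text \<open>Strong continuity suffices because the bound \<open>M\<close> is uniform in time: a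
  change of the vector is passed on with factor at most \<open>M\<close>, whatever the time.\<close>

lemma T_joint_continuous: "continuous_on UNIV (\<lambda>(t, x). T (max 0 t) x)"
proof -
  have "((\<lambda>z. T (max 0 (fst z)) (snd z)) \<longlongrightarrow> T (max 0 t0) x0) (at (t0, x0))" for t0 x0
  proof -
    let ?F = "at (t0, x0)"
    have f: "(fst \<longlongrightarrow> t0) ?F" and s: "(snd \<longlongrightarrow> x0) ?F"
      by (auto intro: tendsto_eq_intros)
    have c: "isCont (\<lambda>t. T (max 0 t) x0) t0"
      using T_orbit_continuous by (simp add: continuous_on_eq_continuous_at)
    have 1: "((\<lambda>z. T (max 0 (fst z)) x0) \<longlongrightarrow> T (max 0 t0) x0) ?F"
      by (rule isCont_tendsto_compose[OF c f])
    have "((\<lambda>z. M * norm (snd z - x0)) \<longlongrightarrow> M * norm (x0 - x0)) ?F"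
      by (intro tendsto_intros s)
    then have 2: "((\<lambda>z. M * norm (snd z - x0)) \<longlongrightarrow> 0) ?F" by simp
    have "((\<lambda>z. T (max 0 (fst z)) (snd z) - T (max 0 (fst z)) x0) \<longlongrightarrow> 0) ?F"
      by (rule Lim_null_comparison[OF _ 2])
         (auto intro!: always_eventually T_bound simp flip: T_diff)
    from tendsto_add[OF this 1] show ?thesis by simp
  qed
  then show ?thesis
    by (auto simp: continuous_on_def case_prod_beta)
qed

lemma T_continuous_compose:
  assumes "continuous_on S g" "continuous_on S f" "\<And>z. z \<in> S \<Longrightarrow> 0 \<le> f z"
  shows "continuous_on S (\<lambda>z. T (f z) (g z))"
proof -
  have "continuous_on S (\<lambda>z. (\<lambda>(t, x). T (max 0 t) x) (f z, g z))"
    by (rule continuous_on_compose2[OF T_joint_continuous]) (auto intro!: continuous_intros assms)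
  then show ?thesis
    by (rule continuous_on_cong[THEN iffD1, rotated -1]) (use assms(3) in \<open>auto simp: max_def\<close>)
qed

lemma T_measurable_compose:
  assumes [measurable]: "f \<in> borel_measurable Q" "g \<in> borel_measurable Q"
  shows "(\<lambda>z. T (max 0 (f z)) (g z)) \<in> borel_measurable Q"
proof -
  have "(\<lambda>(t, x). T (max 0 t) x) \<in> borel_measurable borel"
    using T_joint_continuous by (rule borel_measurable_continuous_onI)
  moreover have "(\<lambda>z. (f z, g z)) \<in> Q \<rightarrow>\<^sub>M borel"
    unfolding borel_prod[symmetric] by measurable
  ultimately have "(\<lambda>z. (\<lambda>(t, x). T (max 0 t) x) (f z, g z)) \<in> borel_measurable Q"
    by (rule measurable_compose[rotated])
  then show ?thesis by simp
qed

lemma N_measurable [measurable (raw)]: "f \<in> borel_measurable Q \<Longrightarrow> (\<lambda>z. N i (f z)) \<in> borel_measurable Q"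
  by (rule borel_measurable_continuous_onI[THEN measurable_compose[rotated]])
     (auto intro: linear_continuous_on N_linear)

text \<open>The adjoint of \<open>Pchain\<close> for a fixed list of labels: the time
  \<open>s i\<close> acts first and the last time is outermost. The vector argument is an
  accumulator.\<close>

fun Rchain :: "(nat \<Rightarrow> real) \<Rightarrow> nat \<Rightarrow> 'n list \<Rightarrow> 'x \<Rightarrow> 'x" where
  "Rchain s i [] y = T (s i) y"
| "Rchain s i (n # ns) y = Rchain s (Suc i) ns (N n (T (s i) y))"

lemma Pchain_adjoint:
  assumes "\<And>j. i \<le> j \<Longrightarrow> j \<le> i + length ns \<Longrightarrow> 0 \<le> s j"
  shows "Pchain T N s i ns y \<bullet> z = y \<bullet> Rchain s i ns z"
  using assms
proof (induction ns arbitrary: i y z)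
  case Nil
  then show ?case
    using adjoint_inner[OF T_linear[of "s i"], of z y] by (simp add: inner_commute)
next
  case (Cons n ns)
  have "Pchain T N s i (n # ns) y \<bullet> z = Pchain T N s (Suc i) ns y \<bullet> N n (T (s i) z)"
    using adjoint_inner[OF T_linear[of "s i"]] adjoint_inner[OF N_linear] Cons.prems
    by (simp add: inner_commute)
  also have "\<dots> = y \<bullet> Rchain s i (n # ns) z"
    using Cons.prems by (subst Cons.IH) auto
  finally show ?case .
qed

text \<open>The adjoint is given by choice, but inner products with all \<open>y\<close> determine
  its value, so exhibiting one candidate fixes it. Nonnegative times are required because
  \<open>T\<close> is unspecified elsewhere.\<close>

lemma tensor_adjoint_Pk:
  assumes "\<And>i. i \<le> k \<Longrightarrow> 0 \<le> s i"
  shows "tensor_adjoint k (Pk T N k s) z = (\<Sum>ns\<in>nlists k. Rchain s 0 ns (z ns))"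
proof -
  define Q where "Q L' \<longleftrightarrow> (\<forall>y z. (\<Sum>ns\<in>nlists k. Pk T N k s y ns \<bullet> z ns) = y \<bullet> L' z)" for L' :: "('n list \<Rightarrow> 'x) \<Rightarrow> 'x"
  have *: "(\<Sum>ns\<in>nlists k. Pk T N k s y ns \<bullet> z ns) = y \<bullet> (\<Sum>ns\<in>nlists k. Rchain s 0 ns (z ns))" for y z
    unfolding inner_sum_right
    using assms by (intro sum.cong refl) (auto simp: Pk_def nlists_def intro!: Pchain_adjoint)
  then have "Q (\<lambda>z. \<Sum>ns\<in>nlists k. Rchain s 0 ns (z ns))"
    by (simp add: Q_def)
  then have "Q (tensor_adjoint k (Pk T N k s))"
    unfolding tensor_adjoint_def Q_def[symmetric] by (rule someI[of Q])
  then have "y \<bullet> tensor_adjoint k (Pk T N k s) z = y \<bullet> (\<Sum>ns\<in>nlists k. Rchain s 0 ns (z ns))" for y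
    unfolding Q_def * by simp
  then show ?thesis
    using vector_eq_ldot by blast
qed

lemma Rchain_scaleR:
  assumes "\<And>j. i \<le> j \<Longrightarrow> j \<le> i + length ns \<Longrightarrow> 0 \<le> s j"
  shows "Rchain s i ns (r *\<^sub>R y) = r *\<^sub>R Rchain s i ns y"
  using assms
proof (induction ns arbitrary: i y)
  case Nil
  then show ?case using T_linear[of "s i"] by (simp add: linear_scale bounded_linear.linear)
next
  case (Cons n ns)
  then show ?case
    using T_linear[of "s i"] N_linear[of n] by (simp add: linear_scale bounded_linear.linear)
qed

text \<open>The input operator sends the basis vector \<open>axis i 1\<close> to
  \<open>psi i\<close>, so a single chain survives from the tensor, integrated over one
  cube.\<close>

lemma Rop_box_fun:
  assumes c: "length d = Suc (length ms)" and "0 \<le> \<delta>"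
  shows "Rop T N psi (box_fun \<delta> d ms (axis i 1))
    = (1 / sqrt (\<delta> ^ length d)) *\<^sub>R (LINT s:cube \<delta> d|tmeas (length ms). Rchain s 0 ms (psi i))"
proof -
  define h where "h k = (LINT s:tdom k|tmeas k. tensor_adjoint k (Pk T N k s)
     (\<lambda>ns. \<Sum>i'\<in>UNIV. box_fun \<delta> d ms (axis i 1) k s (i', ns) *\<^sub>R psi i'))" for k
  have int: "indicator (tdom k) s *\<^sub>R tensor_adjoint k (Pk T N k s)
     (\<lambda>ns. \<Sum>i'\<in>UNIV. box_fun \<delta> d ms (axis i 1) k s (i', ns) *\<^sub>R psi i')
   = (if k = length ms then (1 / sqrt (\<delta> ^ length d)) *\<^sub>R (indicator (cube \<delta> d) s *\<^sub>R Rchain s 0 ms (psi i)) else 0)" for k s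
  proof (cases "s \<in> tdom k")
    case True
    then have pos: "\<And>j. j \<le> k \<Longrightarrow> 0 \<le> s j"
      unfolding tdom_def by (auto dest!: PiE_mem intro: less_imp_le)
    define \<kappa> where "\<kappa> = (if k = length ms then indicator (cube \<delta> d) s / sqrt (\<delta> ^ length d) else 0)"
    have "(\<Sum>i'\<in>UNIV. box_fun \<delta> d ms (axis i 1) k s (i', ns) *\<^sub>R psi i')
       = (\<Sum>i'\<in>UNIV. if i' = i then (if ns = ms then \<kappa> else 0) *\<^sub>R psi i else 0)" for ns
      by (intro sum.cong) (auto simp: box_fun_def \<kappa>_def axis_def)
    then have "(\<Sum>i'\<in>UNIV. box_fun \<delta> d ms (axis i 1) k s (i', ns) *\<^sub>R psi i') = (if ns = ms then \<kappa> else 0) *\<^sub>R psi i" for ns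
      by simp
    moreover have "tensor_adjoint k (Pk T N k s) z = (\<Sum>ns\<in>nlists k. Rchain s 0 ns (z ns))" for z
      by (rule tensor_adjoint_Pk) (rule pos)
    moreover have "Rchain s 0 ns ((if ns = ms then \<kappa> else 0) *\<^sub>R psi i) = (if ns = ms then \<kappa> else 0) *\<^sub>R Rchain s 0 ns (psi i)"
      if "ns \<in> nlists k" for ns
      using that by (intro Rchain_scaleR pos) (auto simp: nlists_def)
    ultimately have "tensor_adjoint k (Pk T N k s)
     (\<lambda>ns. \<Sum>i'\<in>UNIV. box_fun \<delta> d ms (axis i 1) k s (i', ns) *\<^sub>R psi i')
      = (\<Sum>ns\<in>nlists k. (if ns = ms then \<kappa> else 0) *\<^sub>R Rchain s 0 ns (psi i))"
      by simp
    also have "\<dots> = (\<Sum>ns\<in>{ms}. (if ns = ms then \<kappa> else 0) *\<^sub>R Rchain s 0 ns (psi i))"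
      using finite_lists_length_eq[of "UNIV :: 'n set" k]
      by (intro sum.mono_neutral_cong) (auto simp: nlists_def \<kappa>_def)
    finally show ?thesis
      using True by (simp add: \<kappa>_def)
  next
    case False
    then show ?thesis
      using cube_subset_tdom[OF c \<open>0 \<le> \<delta>\<close>] by (auto simp: indicator_def)
  qed
  have "h k = 0" if "k \<notin> {length ms}" for k
    using that by (simp add: h_def set_lebesgue_integral_def int)
  then have "(\<Sum>k. h k) = h (length ms)"
    using suminf_finite[of "{length ms}" h] by simp
  also have "\<dots> = (1 / sqrt (\<delta> ^ length d)) *\<^sub>R (LINT s:cube \<delta> d|tmeas (length ms). Rchain s 0 ms (psi i))"
    by (simp add: h_def set_lebesgue_integral_def int del: scaleR_scaleR)
  finally show ?thesis
    by (simp add: Rop_def h_def)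
qed

end

section \<open>Pairing of the Hankel operator with cubes\<close>

definition chain_dom :: "nat \<Rightarrow> real \<Rightarrow> (nat \<Rightarrow> real) \<Rightarrow> bool" where
  "chain_dom k R s \<longleftrightarrow> (\<forall>i\<le>k. 0 \<le> s i \<and> s i \<le> R)"

text \<open>Continuity in the times, uniform over the parameters in \<open>P\<close>, together with
  a compact set containing all values. As \<open>T\<close> is only strongly continuous, it is
  uniformly continuous in time on compact sets of vectors only; carrying the compact range along
  makes the property stable under further factors.\<close>

definition chain_uc :: "nat \<Rightarrow> real \<Rightarrow> 'p set \<Rightarrow> ((nat \<Rightarrow> real) \<Rightarrow> 'p \<Rightarrow> 'x::metric_space) \<Rightarrow> bool" where
  "chain_uc k R P F \<longleftrightarrow>
     (\<exists>K. compact K \<and> (\<forall>s p. chain_dom k R s \<longrightarrow> p \<in> P \<longrightarrow> F s p \<in> K)) \<and>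
     (\<forall>\<epsilon>>0. \<exists>d>0. \<forall>s s' p. chain_dom k R s \<longrightarrow> chain_dom k R s' \<longrightarrow>
        (\<forall>i\<le>k. \<bar>s i - s' i\<bar> < d) \<longrightarrow> p \<in> P \<longrightarrow> dist (F s p) (F s' p) < \<epsilon>)"

lemma chain_uc_const: "compact P \<Longrightarrow> chain_uc k R P (\<lambda>s p. p)"
  by (auto simp: chain_uc_def intro: exI[of _ P] exI[of _ 1])

lemma chain_uc_compose:
  fixes g :: "real \<times> 'x::metric_space \<Rightarrow> 'y::metric_space"
  assumes F: "chain_uc k R P F" and i: "i \<le> k" and g: "continuous_on UNIV g"
  shows "chain_uc k R P (\<lambda>s p. g (s i, F s p))"
proof -
  obtain K where K: "compact K" "\<And>s p. chain_dom k R s \<Longrightarrow> p \<in> P \<Longrightarrow> F s p \<in> K"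
    using F unfolding chain_uc_def by blast
  have cmp: "compact ({0..R} \<times> K)"
    by (intro compact_Times K compact_Icc)
  have mem: "(s i, F s p) \<in> {0..R} \<times> K" if "chain_dom k R s" "p \<in> P" for s p
    using that i K by (auto simp: chain_dom_def)
  have g': "continuous_on ({0..R} \<times> K) g"
    using g by (rule continuous_on_subset) auto
  have "\<exists>K. compact K \<and> (\<forall>s p. chain_dom k R s \<longrightarrow> p \<in> P \<longrightarrow> g (s i, F s p) \<in> K)"
    using compact_continuous_image[OF g' cmp] mem by blast
  moreover have "\<exists>d>0. \<forall>s s' p. chain_dom k R s \<longrightarrow> chain_dom k R s' \<longrightarrow>
        (\<forall>i\<le>k. \<bar>s i - s' i\<bar> < d) \<longrightarrow> p \<in> P \<longrightarrow> dist (g (s i, F s p)) (g (s' i, F s' p)) < \<epsilon>"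
    if \<epsilon>: "\<epsilon> > 0" for \<epsilon>
  proof -
    obtain d where d: "d > 0" "\<And>z z'. z \<in> {0..R} \<times> K \<Longrightarrow> z' \<in> {0..R} \<times> K \<Longrightarrow> dist z' z < d \<Longrightarrow> dist (g z') (g z) < \<epsilon>"
      using compact_uniformly_continuous[OF g' cmp] \<epsilon> unfolding uniformly_continuous_on_def by metis
    obtain d' where d': "d' > 0" "\<And>s s' p. chain_dom k R s \<Longrightarrow> chain_dom k R s' \<Longrightarrow>
        (\<And>i. i \<le> k \<Longrightarrow> \<bar>s i - s' i\<bar> < d') \<Longrightarrow> p \<in> P \<Longrightarrow> dist (F s p) (F s' p) < d / 2"
      using F half_gt_zero[OF d(1)] unfolding chain_uc_def by meson
    show ?thesis
    proof (intro exI[of _ "min d' (d / 2)"] conjI allI impI)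
      show "0 < min d' (d / 2)" using d d' by simp
      fix s s' p
      assume *: "chain_dom k R s" "chain_dom k R s'" "\<forall>i\<le>k. \<bar>s i - s' i\<bar> < min d' (d / 2)" "p \<in> P"
      have "dist (s i, F s p) (s' i, F s' p) \<le> \<bar>s i - s' i\<bar> + dist (F s p) (F s' p)"
        using sqrt_sum_squares_le_sum[of "dist (s i) (s' i)" "dist (F s p) (F s' p)"]
        by (simp add: dist_Pair_Pair dist_real_def)
      also have "\<dots> < d / 2 + d / 2"
        using * i by (intro add_strict_mono d') auto
      finally show "dist (g (s i, F s p)) (g (s' i, F s' p)) < \<epsilon>"
        using * mem by (intro d) auto
    qed
  qed
  ultimately show ?thesis
    unfolding chain_uc_def by blast
qed

lemma measurable_tmeas_component:
  "i \<le> k \<Longrightarrow> (\<lambda>s. s i) \<in> borel_measurable (tmeas k)"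
  unfolding tmeas_def using measurable_component_singleton[of i "{..k}" "\<lambda>_. lborel :: real measure"] by simp

text \<open>\<open>G\<close> stands for \<open>F\<close> with its times truncated at 0. The two
  agree on the cube, while only the truncated version is known to be measurable on the whole
  space.\<close>

lemma set_integrable_cube_bounded:
  fixes F :: "(nat \<Rightarrow> real) \<Rightarrow> 'b::{banach, second_countable_topology}"
  assumes c: "length c = Suc k" and "0 \<le> \<delta>"
    and F: "G \<in> borel_measurable (tmeas k)" "\<And>s. s \<in> cube \<delta> c \<Longrightarrow> F s = G s"
    and B: "\<And>s. s \<in> cube \<delta> c \<Longrightarrow> norm (F s) \<le> B"
  shows "set_integrable (tmeas k) (cube \<delta> c) F"
proof -
  have eq: "(\<lambda>s. indicator (cube \<delta> c) s *\<^sub>R F s) = (\<lambda>s. indicator (cube \<delta> c) s *\<^sub>R G s)"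
    using F(2) by (auto simp: indicator_def fun_eq_iff)
  have "integrable (tmeas k) (\<lambda>s. indicator (cube \<delta> c) s * B)"
    using sets_cube[OF c] finite_emeasure_cube[OF c \<open>0 \<le> \<delta>\<close>] by (intro integrable_mult_left) auto
  then show ?thesis
    unfolding set_integrable_def
  proof (rule Bochner_Integration.integrable_bound)
    show "(\<lambda>s. indicator (cube \<delta> c) s *\<^sub>R F s) \<in> borel_measurable (tmeas k)"
      unfolding eq using sets_cube[OF c] F(1) by measurable
    show "AE s in tmeas k. norm (indicator (cube \<delta> c) s *\<^sub>R F s) \<le> norm (indicator (cube \<delta> c) s * B)"
    proof (intro always_eventually allI)
      fix s show "norm (indicator (cube \<delta> c) s *\<^sub>R F s) \<le> norm (indicator (cube \<delta> c) s * B)"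
        using B[of s] by (auto simp: indicator_def)
    qed
  qed
qed

lemma cube_integral_approx:
  fixes F :: "(nat \<Rightarrow> real) \<Rightarrow> 'b::{banach, second_countable_topology}"
  assumes c: "length c = Suc k" and "0 \<le> \<delta>"
    and F: "G \<in> borel_measurable (tmeas k)" "\<And>s. s \<in> cube \<delta> c \<Longrightarrow> F s = G s"
    and B: "\<And>s. s \<in> cube \<delta> c \<Longrightarrow> norm (F s - F0) \<le> \<epsilon>"
  shows "norm ((LINT s:cube \<delta> c|tmeas k. F s) - \<delta> ^ length c *\<^sub>R F0) \<le> \<delta> ^ length c * \<epsilon>"
proof -
  have fin: "cube \<delta> c \<in> sets (tmeas k)" "emeasure (tmeas k) (cube \<delta> c) \<noteq> \<infinity>"
    using sets_cube[OF c] emeasure_cube[OF c \<open>0 \<le> \<delta>\<close>] by auto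
  have "norm (F s) \<le> \<epsilon> + norm F0" if "s \<in> cube \<delta> c" for s
    using B[OF that] norm_triangle_ineq[of "F s - F0" F0] by simp
  then have 1: "set_integrable (tmeas k) (cube \<delta> c) F"
    using assms by (intro set_integrable_cube_bounded[of c k \<delta> G]) auto
  have 2: "set_integrable (tmeas k) (cube \<delta> c) (\<lambda>_. F0)" "set_integrable (tmeas k) (cube \<delta> c) (\<lambda>_. \<epsilon>)"
    using \<open>0 \<le> \<delta>\<close> c by (auto intro!: set_integrable_cube_bounded[where B = "norm _"])
  have "(LINT s:cube \<delta> c|tmeas k. F s) - \<delta> ^ length c *\<^sub>R F0 = (LINT s:cube \<delta> c|tmeas k. F s - F0)"
    using set_integral_const[OF fin, of F0] measure_cube[OF c \<open>0 \<le> \<delta>\<close>] 1 2 by simp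
  also have "norm \<dots> \<le> (LINT s:cube \<delta> c|tmeas k. norm (F s - F0))"
    using 1 2 by (intro set_integral_norm_bound) auto
  also have "\<dots> \<le> (LINT s:cube \<delta> c|tmeas k. \<epsilon>)"
    using 1 2 B by (intro set_integral_mono set_integrable_norm) auto
  also have "\<dots> = \<delta> ^ length c * \<epsilon>"
    using set_integral_const[OF fin, of \<epsilon>] measure_cube[OF c \<open>0 \<le> \<delta>\<close>] by simp
  finally show ?thesis .
qed

lemma Ochain_cong:
  assumes "\<And>j. i \<le> j \<Longrightarrow> j \<le> i + length ns \<Longrightarrow> s j = s' j"
  shows "Ochain T N s i ns y = Ochain T N s' i ns y"
  using assms
proof (induction ns arbitrary: i)
  case (Cons n ns)
  then show ?case using Cons.IH[of "Suc i"] by simp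
qed simp

context bounded_semigroup_system
begin

lemma Rchain_cong:
  assumes "\<And>j. i \<le> j \<Longrightarrow> j \<le> i + length ns \<Longrightarrow> s j = s' j"
  shows "Rchain s i ns y = Rchain s' i ns y"
  using assms
proof (induction ns arbitrary: i y)
  case (Cons n ns)
  then show ?case using Cons.IH[of "Suc i"] by simp
qed simp

lemma chain_uc_T:
  assumes "chain_uc k R P F" "i \<le> k"
  shows "chain_uc k R P (\<lambda>s p. T (max 0 (s i)) (F s p))"
  using chain_uc_compose[OF assms T_joint_continuous] by simp

lemma chain_uc_N:
  assumes "chain_uc k R P F"
  shows "chain_uc k R P (\<lambda>s p. N n (F s p))"
proof -
  have "continuous_on UNIV (\<lambda>z. N n (snd z))"
    by (intro bounded_linear.continuous_on[OF N_linear] continuous_intros)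
  then show ?thesis
    using chain_uc_compose[OF assms, of 0 "\<lambda>z. N n (snd z)"] by simp
qed

abbreviation pos_part :: "(nat \<Rightarrow> real) \<Rightarrow> nat \<Rightarrow> real" where
  "pos_part s \<equiv> (\<lambda>j. max 0 (s j))"

lemma chain_uc_Rchain:
  "chain_uc k R P F \<Longrightarrow> i + length ns \<le> k \<Longrightarrow> chain_uc k R P (\<lambda>s p. Rchain (pos_part s) i ns (F s p))"
proof (induction ns arbitrary: i F)
  case (Cons n ns)
  have "chain_uc k R P (\<lambda>s p. N n (T (max 0 (s i)) (F s p)))"
    using Cons.prems by (intro chain_uc_T chain_uc_N) auto
  from Cons.IH[OF this, of "Suc i"] show ?case
    using Cons.prems by simp
qed (auto intro: chain_uc_T)

lemma chain_uc_Ochain: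
  "chain_uc k R P F \<Longrightarrow> i + length ns \<le> k \<Longrightarrow> chain_uc k R P (\<lambda>s p. Ochain T N (pos_part s) i ns (F s p))"
  by (induction ns arbitrary: i) (auto intro!: chain_uc_T chain_uc_N)

lemma measurable_Rchain:
  "F \<in> borel_measurable (tmeas k) \<Longrightarrow> i + length ns \<le> k \<Longrightarrow>
    (\<lambda>s. Rchain (pos_part s) i ns (F s)) \<in> borel_measurable (tmeas k)"
proof (induction ns arbitrary: i F)
  case (Cons n ns)
  have "(\<lambda>s. N n (T (max 0 (s i)) (F s))) \<in> borel_measurable (tmeas k)"
    using Cons.prems by (intro T_measurable_compose N_measurable measurable_tmeas_component) auto
  from Cons.IH[OF this, of "Suc i"] show ?case
    using Cons.prems by simp
qed (auto intro: T_measurable_compose measurable_tmeas_component)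

lemma measurable_Ochain:
  "F \<in> borel_measurable (tmeas k) \<Longrightarrow> i + length ns \<le> k \<Longrightarrow>
    (\<lambda>s. Ochain T N (pos_part s) i ns (F s)) \<in> borel_measurable (tmeas k)"
  by (induction ns arbitrary: i) (auto intro!: T_measurable_compose N_measurable measurable_tmeas_component)

lemma Ochain_bound:
  "\<exists>B\<ge>0. \<forall>s i y. (\<forall>j. i \<le> j \<longrightarrow> j \<le> i + length ns \<longrightarrow> 0 \<le> s j) \<longrightarrow> norm (Ochain T N s i ns y) \<le> B * norm y"
proof (induction ns)
  case Nil
  have "M * norm y \<le> max 0 M * norm y" for y :: 'x
    by (intro mult_right_mono) auto
  then show ?case
    by (intro exI[of _ "max 0 M"]) (auto intro: order_trans[OF T_bound])
next
  case (Cons n ns)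
  then obtain B where B: "B \<ge> 0" "\<And>s i y. (\<forall>j. i \<le> j \<longrightarrow> j \<le> i + length ns \<longrightarrow> 0 \<le> s j) \<Longrightarrow>
      norm (Ochain T N s i ns y) \<le> B * norm y" by blast
  obtain K where K: "K > 0" "\<And>x. norm (N n x) \<le> norm x * K"
    using bounded_linear.pos_bounded[OF N_linear] by blast
  show ?case
  proof (intro exI[of _ "max 0 M * (B * K)"] conjI allI impI)
    show "0 \<le> max 0 M * (B * K)" using B K by simp
    fix s :: "nat \<Rightarrow> real" and i y assume s: "\<forall>j. i \<le> j \<longrightarrow> j \<le> i + length (n # ns) \<longrightarrow> 0 \<le> s j"
    let ?z = "Ochain T N s (Suc i) ns y"
    have "norm (Ochain T N s i (n # ns) y) \<le> M * norm (N n ?z)"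
      using s by (simp add: T_bound)
    also have "\<dots> \<le> max 0 M * norm (N n ?z)"
      by (intro mult_right_mono) auto
    also have "\<dots> \<le> max 0 M * (norm ?z * K)"
      by (intro mult_left_mono K) auto
    also have "\<dots> \<le> max 0 M * (B * norm y * K)"
      using s B K by (intro mult_left_mono mult_right_mono B) auto
    finally show "norm (Ochain T N s i (n # ns) y) \<le> max 0 M * (B * K) * norm y"
      by (simp add: ac_simps)
  qed
qed

lemma Ochain_linear:
  assumes "\<And>j. i \<le> j \<Longrightarrow> j \<le> i + length ns \<Longrightarrow> 0 \<le> s j"
  shows "linear (Ochain T N s i ns)"
  using assms
proof (induction ns arbitrary: i)
  case Nil
  then have "linear (T (s i))"
    using T_linear by (simp add: bounded_linear.linear)
  moreover have "Ochain T N s i [] = T (s i)" by auto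
  ultimately show ?case by simp
next
  case (Cons n ns)
  have "linear (T (s i) \<circ> (N n \<circ> Ochain T N s (Suc i) ns))"
    using Cons.prems by (intro linear_compose Cons.IH bounded_linear.linear[OF T_linear]
        bounded_linear.linear[OF N_linear]) auto
  moreover have "T (s i) \<circ> (N n \<circ> Ochain T N s (Suc i) ns) = Ochain T N s i (n # ns)" by auto
  ultimately show ?case by (simp only:)
qed

lemma cube_pos_part:
  assumes "s \<in> cube \<delta> c" "0 \<le> \<delta>" "i < length c"
  shows "0 \<le> s i"
proof -
  have "0 \<le> \<delta> * real (c ! i)" using assms(2) by simp
  then show ?thesis using cube_bounds[OF assms(1,3)] by linarith
qed

lemma set_integrable_Wop:
  assumes c: "length c = Suc (length ns)" and "0 \<le> \<delta>"
  shows "set_integrable (tmeas (length ns)) (cube \<delta> c) (\<lambda>s. Wop T N C y (length ns) s (j, ns))"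
proof -
  obtain B where B: "B \<ge> 0" "\<And>s i y. (\<forall>j. i \<le> j \<longrightarrow> j \<le> i + length ns \<longrightarrow> 0 \<le> s j) \<Longrightarrow>
      norm (Ochain T N s i ns y) \<le> B * norm y"
    using Ochain_bound by meson
  obtain K where K: "K > 0" "\<And>x. norm (C x) \<le> norm x * K"
    using bounded_linear.pos_bounded[OF C_linear] by blast
  have C_meas: "(\<lambda>x. C x $ j) \<in> borel_measurable borel"
    by (intro borel_measurable_continuous_onI continuous_on_component linear_continuous_on C_linear)
  have O_meas: "(\<lambda>s. Ochain T N (pos_part s) 0 ns y) \<in> borel_measurable (tmeas (length ns))"
    by (rule measurable_Ochain) auto
  show ?thesis
  proof (rule set_integrable_cube_bounded[OF c \<open>0 \<le> \<delta>\<close>, where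
        G = "\<lambda>s. C (Ochain T N (pos_part s) 0 ns y) $ j" and B = "B * norm y * K"])
    show "(\<lambda>s. C (Ochain T N (pos_part s) 0 ns y) $ j) \<in> borel_measurable (tmeas (length ns))"
      by (rule measurable_compose[OF O_meas C_meas])
    fix s assume s: "s \<in> cube \<delta> c"
    have pos: "0 \<le> s i" if "i \<le> length ns" for i
      using cube_pos_part[OF s \<open>0 \<le> \<delta>\<close>, of i] c that by simp
    show "Wop T N C y (length ns) s (j, ns) = C (Ochain T N (pos_part s) 0 ns y) $ j"
      using pos Ochain_cong[of 0 ns s "pos_part s" T N y] by (simp add: Wop_def max_def)
    have "\<bar>C (Ochain T N s 0 ns y) $ j\<bar> \<le> norm (Ochain T N s 0 ns y) * K"
      using component_le_norm_cart K(2) by (rule order_trans)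
    also have "\<dots> \<le> B * norm y * K"
      using K pos by (intro mult_right_mono B) auto
    finally show "norm (Wop T N C y (length ns) s (j, ns)) \<le> B * norm y * K"
      by (simp add: Wop_def)
  qed
qed

text \<open>On a small cube the kernel is nearly constant, so each of the two integrals equals its
  volume times the corner value up to a small error, and dividing by the normalisation leaves the
  square root of that volume. The threshold \<open>d\<close> depends on the labels and the horizon
  \<open>R\<close> but not on the cells, which is what makes sums over many cells
  controllable.\<close>

lemma pairing_approx:
  assumes "\<epsilon> > 0"
  shows "\<exists>d>0. \<forall>\<delta> c c'. 0 < \<delta> \<longrightarrow> \<delta> < d \<longrightarrow> length c = Suc (length ns) \<longrightarrow> length c' = Suc (length ms) \<longrightarrow>
    (\<forall>i\<in>set c \<union> set c'. \<delta> * real i + \<delta> \<le> R) \<longrightarrow>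
    \<bar>fock_inner (Hankel T N psi C (box_fun \<delta> c' ms (axis i 1))) (box_fun \<delta> c ns w)
      - sqrt (\<delta> ^ length c) * sqrt (\<delta> ^ length c')
        * (C (Ochain T N (\<lambda>r. \<delta> * real (c ! r)) 0 ns (Rchain (\<lambda>r. \<delta> * real (c' ! r)) 0 ms (psi i))) \<bullet> w)\<bar>
    \<le> sqrt (\<delta> ^ length c) * sqrt (\<delta> ^ length c') * \<epsilon>"
proof -
  obtain B where B: "B \<ge> 0" "\<And>s i y. (\<forall>j. i \<le> j \<longrightarrow> j \<le> i + length ns \<longrightarrow> 0 \<le> s j) \<Longrightarrow>
      norm (Ochain T N s i ns y) \<le> B * norm y"
    using Ochain_bound by meson
  obtain KC where KC: "KC > 0" "\<And>x. norm (C x) \<le> norm x * KC"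
    using bounded_linear.pos_bounded[OF C_linear] by blast
  \<comment> \<open>The share for two errors: the input vector, passed through an output chain of
    norm at most \<open>B\<close>, and the output times. Both then pass through \<open>C\<close> and
    \<open>w\<close>; the summands 1 keep the denominator positive.\<close>
  define \<epsilon>1 where "\<epsilon>1 = \<epsilon> / (KC * (norm w + 1) * (B + 1))"
  have "norm w + 1 > 0" "B + 1 > 0"
    using B(1) by (auto intro: add_nonneg_pos)
  then have "\<epsilon>1 > 0"
    using KC \<open>\<epsilon> > 0\<close> by (auto simp: \<epsilon>1_def)
  have \<epsilon>1: "KC * (B * \<epsilon>1 + \<epsilon>1) * norm w \<le> \<epsilon>"
  proof -
    have "KC * (B * \<epsilon>1 + \<epsilon>1) * norm w \<le> KC * (B * \<epsilon>1 + \<epsilon>1) * (norm w + 1)"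
      using KC B \<open>\<epsilon>1 > 0\<close> by (intro mult_left_mono) auto
    also have "\<dots> = \<epsilon>1 * (KC * (norm w + 1) * (B + 1))" by (simp add: algebra_simps)
    also have "\<dots> = \<epsilon>"
      using KC \<open>norm w + 1 > 0\<close> \<open>B + 1 > 0\<close> by (simp add: \<epsilon>1_def)
    finally show ?thesis .
  qed
  have uR: "chain_uc (length ms) R {psi i} (\<lambda>s p. Rchain (pos_part s) 0 ms p)"
    by (rule chain_uc_Rchain) (auto intro: chain_uc_const)
  \<comment> \<open>The compact set swept out by the input chain; over it the output chain is
    uniformly continuous in its times.\<close>
  obtain K where K: "compact K" "\<And>s. chain_dom (length ms) R s \<Longrightarrow> Rchain (pos_part s) 0 ms (psi i) \<in> K"
    using uR unfolding chain_uc_def by auto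
  have uO: "chain_uc (length ns) R K (\<lambda>s p. Ochain T N (pos_part s) 0 ns p)"
    by (rule chain_uc_Ochain) (auto intro: chain_uc_const K)
  obtain d1 where d1: "d1 > 0" "\<And>s s'. chain_dom (length ms) R s \<Longrightarrow> chain_dom (length ms) R s' \<Longrightarrow>
        (\<And>i. i \<le> length ms \<Longrightarrow> \<bar>s i - s' i\<bar> < d1) \<Longrightarrow>
        dist (Rchain (pos_part s) 0 ms (psi i)) (Rchain (pos_part s') 0 ms (psi i)) < \<epsilon>1"
    using uR \<open>\<epsilon>1 > 0\<close> unfolding chain_uc_def by (metis singletonI)
  obtain d2 where d2: "d2 > 0" "\<And>s s' p. chain_dom (length ns) R s \<Longrightarrow> chain_dom (length ns) R s' \<Longrightarrow>
        (\<And>i. i \<le> length ns \<Longrightarrow> \<bar>s i - s' i\<bar> < d2) \<Longrightarrow> p \<in> K \<Longrightarrow>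
        dist (Ochain T N (pos_part s) 0 ns p) (Ochain T N (pos_part s') 0 ns p) < \<epsilon>1"
    using uO \<open>\<epsilon>1 > 0\<close> unfolding chain_uc_def by meson
  show ?thesis
  proof (intro exI[of _ "min d1 d2"] conjI allI impI)
    show "0 < min d1 d2" using d1 d2 by simp
    fix \<delta> c c' assume \<delta>: "0 < \<delta>" "\<delta> < min d1 d2"
      and c: "length c = Suc (length ns)" "length c' = Suc (length ms)"
      and R: "\<forall>i\<in>set c \<union> set c'. \<delta> * real i + \<delta> \<le> R"
    have "0 \<le> \<delta>" using \<delta> by simp
    have pp: "pos_part (\<lambda>r. \<delta> * real (a r)) = (\<lambda>r. \<delta> * real (a r))" for a
      using \<delta> by (auto simp: fun_eq_iff)
    have corner: "chain_dom k R (\<lambda>r. \<delta> * real (b ! r))"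
      if "length b = Suc k" "set b \<subseteq> set c \<union> set c'" for b k
    proof -
      have "0 \<le> \<delta> * real (b ! i)" "\<delta> * real (b ! i) \<le> R" if "i \<le> k" for i
        using that R \<open>length b = Suc k\<close> subsetD[OF \<open>set b \<subseteq> _\<close>, of "b ! i"] nth_mem[of i b] \<delta>(1)
        by (auto simp: less_Suc_eq_le simp del: Un_iff dest!: bspec[of _ _ "b ! i"])
      then show ?thesis by (simp add: chain_dom_def)
    qed
    have dom: "chain_dom k R s"
      and near: "\<And>i. i \<le> k \<Longrightarrow> \<bar>s i - \<delta> * real (b ! i)\<bar> < \<delta>"
      if "s \<in> cube \<delta> b" "length b = Suc k" "set b \<subseteq> set c \<union> set c'" for s b k
    proof -
      have b: "\<delta> * real (b ! i) < s i" "s i < \<delta> * real (b ! i) + \<delta>" "\<delta> * real (b ! i) + \<delta> \<le> R" if "i \<le> k" for i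
        using cube_bounds[OF \<open>s \<in> cube \<delta> b\<close>, of i] that R \<open>length b = Suc k\<close> subsetD[OF \<open>set b \<subseteq> _\<close>]
          nth_mem[of i b] by (auto simp del: Un_iff)
      show "\<And>i. i \<le> k \<Longrightarrow> \<bar>s i - \<delta> * real (b ! i)\<bar> < \<delta>"
        using b by (auto simp: abs_less_iff) (smt (verit))+
      show "chain_dom k R s"
        unfolding chain_dom_def using b \<delta> by (smt (verit) of_nat_0_le_iff mult_nonneg_nonneg)
    qed
    define Y where "Y = (LINT s:cube \<delta> c'|tmeas (length ms). Rchain s 0 ms (psi i))"
    define Y0 where "Y0 = Rchain (\<lambda>r. \<delta> * real (c' ! r)) 0 ms (psi i)"
    have RY: "Rchain s 0 ms (psi i) = Rchain (pos_part s) 0 ms (psi i)" if "s \<in> cube \<delta> c'" for s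
      using cube_pos_part[OF that \<open>0 \<le> \<delta>\<close>] c by (intro Rchain_cong) (auto simp: max_def)
    have "norm (Y - \<delta> ^ length c' *\<^sub>R Y0) \<le> \<delta> ^ length c' * \<epsilon>1"
      unfolding Y_def
    proof (rule cube_integral_approx[OF c(2) \<open>0 \<le> \<delta>\<close>, where G = "\<lambda>s. Rchain (pos_part s) 0 ms (psi i)"])
      show "(\<lambda>s. Rchain (pos_part s) 0 ms (psi i)) \<in> borel_measurable (tmeas (length ms))"
        by (rule measurable_Rchain) auto
      fix s assume s: "s \<in> cube \<delta> c'"
      then show "Rchain s 0 ms (psi i) = Rchain (pos_part s) 0 ms (psi i)" by (rule RY)
      have "dist (Rchain (pos_part s) 0 ms (psi i)) (Rchain (pos_part (\<lambda>r. \<delta> * real (c' ! r))) 0 ms (psi i)) < \<epsilon>1"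
      proof (intro d1 dom[OF s] corner)
        fix i assume "i \<le> length ms"
        from near[OF s c(2) _ this] show "\<bar>s i - \<delta> * real (c' ! i)\<bar> < d1"
          using \<delta> by auto
      qed (use s c in auto)
      then show "norm (Rchain s 0 ms (psi i) - Y0) \<le> \<epsilon>1"
        unfolding RY[OF s] pp Y0_def[symmetric] by (simp add: dist_norm)
    qed
    \<comment> \<open>The average of the input chain over its cube. The reachability operator yields
      \<open>q\<close> times it, with \<open>q\<close> the square root of the volume.\<close>
    moreover define y where "y = (1 / \<delta> ^ length c') *\<^sub>R Y"
    ultimately have y: "norm (y - Y0) \<le> \<epsilon>1"
    proof -
      assume a: "norm (Y - \<delta> ^ length c' *\<^sub>R Y0) \<le> \<delta> ^ length c' * \<epsilon>1"
      have "Y - \<delta> ^ length c' *\<^sub>R Y0 = \<delta> ^ length c' *\<^sub>R (y - Y0)"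
        using \<delta> by (simp add: y_def scaleR_diff_right)
      then show ?thesis using a \<delta> by simp
    qed
    define q where "q = sqrt (\<delta> ^ length c')"
    have q: "q > 0" "q * q = \<delta> ^ length c'" using \<delta> by (auto simp: q_def)
    have Rop: "Rop T N psi (box_fun \<delta> c' ms (axis i 1)) = q *\<^sub>R y"
      unfolding Rop_box_fun[OF c(2) \<open>0 \<le> \<delta>\<close>] q_def[symmetric] y_def q(2)[symmetric] Y_def[symmetric]
      using q(1) by (simp add: field_simps)
    define z0 where "z0 = C (Ochain T N (\<lambda>r. \<delta> * real (c ! r)) 0 ns Y0) \<bullet> w"
    define h where "h s = (\<Sum>j\<in>UNIV. Hankel T N psi C (box_fun \<delta> c' ms (axis i 1)) (length ns) s (j, ns) * w $ j)" for s
    have h: "h s = q * (C (Ochain T N (pos_part s) 0 ns y) \<bullet> w)" if s: "s \<in> cube \<delta> c" for s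
    proof -
      have pos: "\<And>j. 0 \<le> j \<Longrightarrow> j \<le> 0 + length ns \<Longrightarrow> 0 \<le> pos_part s j"
        by simp
      have "h s = C (Ochain T N s 0 ns (q *\<^sub>R y)) \<bullet> w"
        by (simp add: h_def Hankel_def Rop Wop_def inner_vec_def)
      also have "Ochain T N s 0 ns (q *\<^sub>R y) = Ochain T N (pos_part s) 0 ns (q *\<^sub>R y)"
        using cube_pos_part[OF s \<open>0 \<le> \<delta>\<close>] c by (intro Ochain_cong) (auto simp: max_def)
      also have "\<dots> = q *\<^sub>R Ochain T N (pos_part s) 0 ns y"
        by (rule linear_scale[OF Ochain_linear]) simp
      finally show ?thesis
        using C_linear by (simp add: linear_scale bounded_linear.linear)
    qed
    have "norm ((LINT s:cube \<delta> c|tmeas (length ns). h s) - \<delta> ^ length c *\<^sub>R (q * z0)) \<le> \<delta> ^ length c * (q * \<epsilon>)"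
    proof (rule cube_integral_approx[OF c(1) \<open>0 \<le> \<delta>\<close>, where G = "\<lambda>s. q * (C (Ochain T N (pos_part s) 0 ns y) \<bullet> w)"])
      have [measurable]: "C \<in> borel_measurable borel"
        using C_linear by (intro borel_measurable_continuous_onI linear_continuous_on)
      have [measurable]: "(\<lambda>s. Ochain T N (pos_part s) 0 ns y) \<in> borel_measurable (tmeas (length ns))"
        by (rule measurable_Ochain) auto
      show "(\<lambda>s. q * (C (Ochain T N (pos_part s) 0 ns y) \<bullet> w)) \<in> borel_measurable (tmeas (length ns))"
        by measurable
      fix s assume s: "s \<in> cube \<delta> c"
      then show hs: "h s = q * (C (Ochain T N (pos_part s) 0 ns y) \<bullet> w)" by (rule h)
      let ?O = "Ochain T N (pos_part s) 0 ns" and ?Oc = "Ochain T N (\<lambda>r. \<delta> * real (c ! r)) 0 ns"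
      have lin: "?O y - ?O Y0 = ?O (y - Y0)"
        using linear_diff[OF Ochain_linear[of 0 ns "pos_part s"], of y Y0] by simp
      have "norm (?O y - ?O Y0) \<le> B * norm (y - Y0)"
        unfolding lin by (rule B) simp
      also have "\<dots> \<le> B * \<epsilon>1" using y B(1) by (rule mult_left_mono)
      finally have 1: "norm (?O y - ?O Y0) \<le> B * \<epsilon>1" .
      have Y0K: "Y0 \<in> K"
      proof -
        have "chain_dom (length ms) R (\<lambda>r. \<delta> * real (c' ! r))"
          by (rule corner) (use c in auto)
        from K(2)[OF this] show ?thesis unfolding pp Y0_def .
      qed
      have "dist (?O Y0) (Ochain T N (pos_part (\<lambda>r. \<delta> * real (c ! r))) 0 ns Y0) < \<epsilon>1"
      proof (intro d2 dom[OF s] corner Y0K)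
        fix i assume "i \<le> length ns"
        from near[OF s c(1) _ this] show "\<bar>s i - \<delta> * real (c ! i)\<bar> < d2"
          using \<delta> by auto
      qed (use s c in auto)
      then have "norm (?O Y0 - ?Oc Y0) < \<epsilon>1"
        unfolding pp by (simp add: dist_norm)
      with 1 have 2: "norm (?O y - ?Oc Y0) \<le> B * \<epsilon>1 + \<epsilon>1"
        using norm_triangle_ineq[of "?O y - ?O Y0" "?O Y0 - ?Oc Y0"] by simp
      have "C (?O y) \<bullet> w - z0 = C (?O y - ?Oc Y0) \<bullet> w"
        using C_linear by (simp add: z0_def inner_diff_left linear_diff bounded_linear.linear)
      also have "\<bar>\<dots>\<bar> \<le> norm (C (?O y - ?Oc Y0)) * norm w"
        by (rule Cauchy_Schwarz_ineq2)
      also have "\<dots> \<le> norm (?O y - ?Oc Y0) * KC * norm w"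
        by (intro mult_right_mono KC) auto
      also have "\<dots> \<le> (B * \<epsilon>1 + \<epsilon>1) * KC * norm w"
        using KC by (intro mult_right_mono 2) auto
      also have "\<dots> \<le> \<epsilon>" using \<epsilon>1 by (simp add: ac_simps)
      finally have "\<bar>C (?O y) \<bullet> w - z0\<bar> \<le> \<epsilon>" .
      then have "q * \<bar>C (?O y) \<bullet> w - z0\<bar> \<le> q * \<epsilon>"
        using q by (intro mult_left_mono) auto
      then show "norm (h s - q * z0) \<le> q * \<epsilon>"
        using q(1) unfolding hs by (simp add: abs_mult flip: right_diff_distrib)
    qed
    then have *: "\<bar>(LINT s:cube \<delta> c|tmeas (length ns). h s) - \<delta> ^ length c * (q * z0)\<bar> \<le> \<delta> ^ length c * (q * \<epsilon>)"
      by simp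
    define r where "r = sqrt (\<delta> ^ length c)"
    have r: "r > 0" "r * r = \<delta> ^ length c" using \<delta> by (auto simp: r_def)
    have "fock_inner (Hankel T N psi C (box_fun \<delta> c' ms (axis i 1))) (box_fun \<delta> c ns w)
       = (LINT s:cube \<delta> c|tmeas (length ns). h s) / r"
      unfolding fock_inner_box_fun[OF c(1) \<open>0 \<le> \<delta>\<close>] h_def r_def ..
    moreover have "\<bar>(LINT s:cube \<delta> c|tmeas (length ns). h s) / r - r * q * z0\<bar> \<le> r * q * \<epsilon>"
    proof -
      have "(LINT s:cube \<delta> c|tmeas (length ns). h s) / r - r * q * z0
        = ((LINT s:cube \<delta> c|tmeas (length ns). h s) - \<delta> ^ length c * (q * z0)) / r"
        using r(1) unfolding r(2)[symmetric] by (simp add: field_simps)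
      also have "\<bar>\<dots>\<bar> \<le> \<delta> ^ length c * (q * \<epsilon>) / r"
        using * r(1) by (simp add: divide_right_mono)
      also have "\<dots> = r * q * \<epsilon>"
        using r(1) unfolding r(2)[symmetric] by simp
      finally show ?thesis .
    qed
    ultimately show "\<bar>fock_inner (Hankel T N psi C (box_fun \<delta> c' ms (axis i 1))) (box_fun \<delta> c ns w)
      - sqrt (\<delta> ^ length c) * sqrt (\<delta> ^ length c')
        * (C (Ochain T N (\<lambda>r. \<delta> * real (c ! r)) 0 ns (Rchain (\<lambda>r. \<delta> * real (c' ! r)) 0 ms (psi i))) \<bullet> w)\<bar>
      \<le> sqrt (\<delta> ^ length c) * sqrt (\<delta> ^ length c') * \<epsilon>"
      unfolding r_def q_def z0_def Y0_def by simp
  qed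
qed

end

section \<open>Riemann sums along a continuous control\<close>

lemma set_integrable_const:
  fixes z :: "'b::{banach, second_countable_topology}"
  assumes "A \<in> sets M" "emeasure M A < \<infinity>"
  shows "set_integrable M A (\<lambda>_. z)"
  unfolding set_integrable_def using assms by (intro integrable_scaleR_left integrable_real_indicator)

lemma riemann_sum_step:
  fixes g :: "real \<Rightarrow> 'b::{banach, second_countable_topology}"
  assumes "0 \<le> \<delta>" "continuous_on {0..\<delta> * real Q} g"
    and osc: "\<And>c \<sigma>. c < Q \<Longrightarrow> \<delta> * real c < \<sigma> \<Longrightarrow> \<sigma> \<le> \<delta> * real c + \<delta> \<Longrightarrow> norm (g (\<delta> * real c) - g \<sigma>) \<le> \<epsilon>"
  shows "norm ((\<Sum>c<Q. \<delta> *\<^sub>R g (\<delta> * real c)) - (LINT \<sigma>:{0..\<delta> * real Q}|lborel. g \<sigma>)) \<le> \<delta> * real Q * \<epsilon>"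
  using assms
proof (induction Q)
  case 0
  have "(LINT \<sigma>:{0..0}|lborel. g \<sigma>) = 0"
    unfolding set_lebesgue_integral_def
    by (rule integral_eq_zero_AE) (use AE_lborel_singleton[of 0] in \<open>auto elim!: eventually_mono\<close>)
  then show ?case by simp
next
  case (Suc Q)
  define a b where "a = \<delta> * real Q" and "b = a + \<delta>"
  have ab: "0 \<le> a" "a \<le> b" "\<delta> * real (Suc Q) = b"
    using Suc.prems(1) by (auto simp: a_def b_def algebra_simps)
  have int: "set_integrable lborel {0..b} g"
    using Suc.prems(2) unfolding ab by (rule borel_integrable_atLeastAtMost')
  have sub: "{0..a} \<subseteq> {0..b}" "{a<..b} \<subseteq> {0..b}" "{0..b} = {0..a} \<union> {a<..b}" "{0..a} \<inter> {a<..b} = {}"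
    using ab by auto
  have int1: "set_integrable lborel {0..a} g" and int2: "set_integrable lborel {a<..b} g"
    using sub by (auto intro!: set_integrable_subset[OF int])
  have fin: "{a<..b} \<in> sets lborel" "emeasure lborel {a<..b} < \<infinity>" "measure lborel {a<..b} = \<delta>"
    using ab by (auto simp: b_def)
  note c = set_integrable_const[OF fin(1,2)]
  have cval: "(LINT \<sigma>:{a<..b}|lborel. g a) = \<delta> *\<^sub>R g a" "(LINT \<sigma>:{a<..b}|lborel. \<epsilon>) = \<delta> *\<^sub>R \<epsilon>"
    using fin by (simp_all add: set_integral_const)
  have "(LINT \<sigma>:{0..b}|lborel. g \<sigma>) = (LINT \<sigma>:{0..a}|lborel. g \<sigma>) + (LINT \<sigma>:{a<..b}|lborel. g \<sigma>)"
    unfolding sub(3) by (rule set_integral_Un[OF sub(4) int1 int2])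
  then have eq: "(\<Sum>c<Suc Q. \<delta> *\<^sub>R g (\<delta> * real c)) - (LINT \<sigma>:{0..b}|lborel. g \<sigma>)
    = ((\<Sum>c<Q. \<delta> *\<^sub>R g (\<delta> * real c)) - (LINT \<sigma>:{0..a}|lborel. g \<sigma>)) + (LINT \<sigma>:{a<..b}|lborel. g a - g \<sigma>)"
    unfolding set_integral_diff(2)[OF c int2] cval by (simp add: a_def)
  have "norm (LINT \<sigma>:{a<..b}|lborel. g a - g \<sigma>) \<le> (LINT \<sigma>:{a<..b}|lborel. norm (g a - g \<sigma>))"
    by (rule set_integral_norm_bound[OF set_integral_diff(1)[OF c int2]])
  also have "\<dots> \<le> (LINT \<sigma>:{a<..b}|lborel. \<epsilon>)"
    by (intro set_integral_mono set_integrable_norm set_integral_diff(1)[OF c int2] c) (auto simp: a_def b_def intro!: Suc.prems(3))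
  finally have 1: "norm (LINT \<sigma>:{a<..b}|lborel. g a - g \<sigma>) \<le> \<delta> * \<epsilon>" by (simp add: cval)
  have "norm ((\<Sum>c<Q. \<delta> *\<^sub>R g (\<delta> * real c)) - (LINT \<sigma>:{0..a}|lborel. g \<sigma>)) \<le> a * \<epsilon>"
    unfolding a_def
  proof (rule Suc.IH[OF Suc.prems(1)])
    show "continuous_on {0..\<delta> * real Q} g"
      using Suc.prems(2) sub(1) unfolding ab(3) a_def[symmetric] by (rule continuous_on_subset)
  qed (use Suc.prems(3) in auto)
  with 1 show ?case
    unfolding ab(3) eq by (intro norm_triangle_le) (simp add: b_def algebra_simps)
qed

text \<open>Uniform continuity on the compact rectangle bounds the oscillation in a cell for all
  \<open>s\<close> at once. The mesh may overshoot \<open>t\<close>, up to \<open>R\<close>, because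
  the integrand vanishes once the gap reaches \<open>s\<close>.\<close>

lemma riemann_sum_uniform:
  fixes f :: "real \<times> real \<Rightarrow> 'b::{banach, second_countable_topology}"
  assumes "0 < t" "t \<le> R" and cont: "continuous_on ({0..R} \<times> {0..t}) f"
    and zero: "\<And>\<sigma> s. s \<in> {0..t} \<Longrightarrow> s \<le> \<sigma> \<Longrightarrow> f (\<sigma>, s) = 0" and "0 < \<epsilon>"
  shows "\<exists>d>0. \<forall>\<delta> Q. 0 < \<delta> \<longrightarrow> \<delta> < d \<longrightarrow> t \<le> \<delta> * real Q \<longrightarrow> \<delta> * real Q \<le> R \<longrightarrow> (\<forall>s\<in>{0..t}.
     norm ((\<Sum>c<Q. \<delta> *\<^sub>R f (\<delta> * real c, s)) - (LINT \<sigma>:{0..t}|lborel. f (\<sigma>, s))) \<le> \<epsilon>)"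
proof -
  have "0 < R" using assms by simp
  have "uniformly_continuous_on ({0..R} \<times> {0..t}) f"
    by (intro compact_uniformly_continuous cont compact_Times compact_Icc)
  then obtain d where d: "d > 0" "\<And>z z'. z \<in> {0..R} \<times> {0..t} \<Longrightarrow> z' \<in> {0..R} \<times> {0..t} \<Longrightarrow> dist z' z < d \<Longrightarrow> dist (f z') (f z) < \<epsilon> / R"
    using \<open>0 < \<epsilon>\<close> \<open>0 < R\<close> unfolding uniformly_continuous_on_def by (metis divide_pos_pos)
  show ?thesis
  proof (intro exI[of _ d] conjI allI impI ballI)
    fix \<delta> Q s assume *: "0 < \<delta>" "\<delta> < d" "t \<le> \<delta> * real Q" "\<delta> * real Q \<le> R" and s: "s \<in> {0..t}"
    have "norm ((\<Sum>c<Q. \<delta> *\<^sub>R f (\<delta> * real c, s)) - (LINT \<sigma>:{0..\<delta> * real Q}|lborel. f (\<sigma>, s))) \<le> \<delta> * real Q * (\<epsilon> / R)"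
    proof (rule riemann_sum_step)
      show "continuous_on {0..\<delta> * real Q} (\<lambda>\<sigma>. f (\<sigma>, s))"
        using * s by (intro continuous_on_compose2[OF cont] continuous_intros) auto
      fix c \<sigma> assume c: "c < Q" "\<delta> * real c < \<sigma>" "\<sigma> \<le> \<delta> * real c + \<delta>"
      have "\<delta> * real c + \<delta> \<le> \<delta> * real Q"
      proof -
        have "\<delta> * real (Suc c) \<le> \<delta> * real Q" using c * by (intro mult_left_mono) auto
        then show ?thesis by (simp add: algebra_simps)
      qed
      moreover have "0 \<le> \<delta> * real c" using * by simp
      moreover from this have "0 \<le> \<sigma>" using c by linarith
      ultimately have "dist (f (\<delta> * real c, s)) (f (\<sigma>, s)) < \<epsilon> / R"
        using c * s by (intro d) (auto simp: dist_Pair_Pair dist_real_def)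
      then show "norm (f (\<delta> * real c, s) - f (\<sigma>, s)) \<le> \<epsilon> / R" by (simp add: dist_norm)
    qed (use * in auto)
    also have "(LINT \<sigma>:{0..\<delta> * real Q}|lborel. f (\<sigma>, s)) = (LINT \<sigma>:{0..t}|lborel. f (\<sigma>, s))"
      unfolding set_lebesgue_integral_def
      using zero[OF s] s * by (intro Bochner_Integration.integral_cong) (auto simp: indicator_def)
    also have "\<delta> * real Q * (\<epsilon> / R) \<le> R * (\<epsilon> / R)"
      using * \<open>0 < \<epsilon>\<close> \<open>0 < R\<close> by (intro mult_right_mono) auto
    finally show "norm ((\<Sum>c<Q. \<delta> *\<^sub>R f (\<delta> * real c, s)) - (LINT \<sigma>:{0..t}|lborel. f (\<sigma>, s))) \<le> \<epsilon>"
      using \<open>0 < R\<close> by simp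
  qed (rule d)
qed

text \<open>The mesh \<open>a t / Q\<close> is needed with \<open>a = 2\<close> for the middle variable, where the
  output and input cells of the same index meet.\<close>
lemma riemann_sum_uniform_limit:
  fixes f :: "real \<times> real \<Rightarrow> 'b::{banach, second_countable_topology}"
  assumes "0 < t" "1 \<le> a" and cont: "continuous_on ({0..a * t} \<times> {0..t}) f"
    and zero: "\<And>\<sigma> s. s \<le> t \<Longrightarrow> 0 \<le> \<sigma> \<Longrightarrow> s \<le> \<sigma> \<Longrightarrow> f (\<sigma>, s) = 0"
  shows "uniform_limit {..t} (\<lambda>Q s. \<Sum>c<Q. (a * t / real Q) *\<^sub>R f (a * t / real Q * real c, s))
     (\<lambda>s. LINT \<sigma>:{0..t}|lborel. f (\<sigma>, s)) sequentially"
proof (rule uniform_limitI)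
  fix \<epsilon> :: real assume "\<epsilon> > 0"
  have "t \<le> a * t" using assms by simp
  obtain d where d: "d > 0" "\<And>\<delta> Q s. 0 < \<delta> \<Longrightarrow> \<delta> < d \<Longrightarrow> t \<le> \<delta> * real Q \<Longrightarrow> \<delta> * real Q \<le> a * t \<Longrightarrow> s \<in> {0..t} \<Longrightarrow>
     norm ((\<Sum>c<Q. \<delta> *\<^sub>R f (\<delta> * real c, s)) - (LINT \<sigma>:{0..t}|lborel. f (\<sigma>, s))) \<le> \<epsilon> / 2"
    using riemann_sum_uniform[OF \<open>0 < t\<close> \<open>t \<le> a * t\<close> cont, of "\<epsilon> / 2"] zero \<open>\<epsilon> > 0\<close>
    by (smt (verit, best) atLeastAtMost_iff half_gt_zero)
  have "(\<lambda>Q. a * t / real Q) \<longlonglongrightarrow> 0"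
    by (rule tendsto_divide_0[OF tendsto_const filterlim_at_top_imp_at_infinity[OF filterlim_real_sequentially]])
  then have "eventually (\<lambda>Q. a * t / real Q < d) sequentially"
    using d(1) by (rule order_tendstoD)
  then show "\<forall>\<^sub>F Q in sequentially. \<forall>s\<in>{..t}. dist (\<Sum>c<Q. (a * t / real Q) *\<^sub>R f (a * t / real Q * real c, s))
     (LINT \<sigma>:{0..t}|lborel. f (\<sigma>, s)) < \<epsilon>"
    using eventually_gt_at_top[of 0]
  proof eventually_elim
    case (elim Q)
    show ?case
    proof
      fix s assume s: "s \<in> {..t}"
      show "dist (\<Sum>c<Q. (a * t / real Q) *\<^sub>R f (a * t / real Q * real c, s)) (LINT \<sigma>:{0..t}|lborel. f (\<sigma>, s)) < \<epsilon>"
      proof (cases "0 \<le> s")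
        case True
        then have "norm ((\<Sum>c<Q. (a * t / real Q) *\<^sub>R f (a * t / real Q * real c, s)) - (LINT \<sigma>:{0..t}|lborel. f (\<sigma>, s))) \<le> \<epsilon> / 2"
          using elim s assms(1,2) by (intro d) auto
        then show ?thesis using \<open>\<epsilon> > 0\<close> by (simp add: dist_norm)
      next
        \<comment> \<open>Negative \<open>s\<close> do occur: discrete gaps may add up to more than
          \<open>t\<close>. Both sides vanish there.\<close>
        case False
        have "(LINT \<sigma>:{0..t}|lborel. f (\<sigma>, s)) = (LINT \<sigma>:{0..t}|lborel. 0)"
          using False s by (intro set_lebesgue_integral_cong) (auto intro!: zero)
        moreover have "f (a * t / real Q * real c, s) = 0" for c
          using False s assms(1,2) by (intro zero) (auto intro: order_trans[of s 0])
        ultimately show ?thesis using \<open>\<epsilon> > 0\<close> by simp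
      qed
    qed
  qed
qed

section \<open>Lists of labelled gap cells and the weights of the control\<close>

definition cell_lists :: "nat \<Rightarrow> nat \<Rightarrow> (nat \<times> 'n) list set" where
  "cell_lists Q l = {xs. length xs = l \<and> (\<forall>x\<in>set xs. fst x < Q)}"

lemma finite_cell_lists [simp]: "finite (cell_lists Q l :: (nat \<times> 'n::finite) list set)"
proof -
  have "cell_lists Q l \<subseteq> {xs. set xs \<subseteq> {..<Q} \<times> (UNIV :: 'n set) \<and> length xs = l}"
    by (force simp: cell_lists_def)
  then show ?thesis
    by (rule finite_subset) (rule finite_lists_length_eq, simp)
qed

lemma cell_lists_0 [simp]: "cell_lists Q 0 = {[]}"
  by (auto simp: cell_lists_def)

lemma sum_cell_lists_Suc:
  fixes F :: "(nat \<times> 'n::finite) list \<Rightarrow> 'b::comm_monoid_add"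
  shows "(\<Sum>xs\<in>cell_lists Q (Suc l). F xs) = (\<Sum>c<Q. \<Sum>m\<in>UNIV. \<Sum>xs\<in>cell_lists Q l. F ((c, m) # xs))"
proof -
  have "cell_lists Q (Suc l) = (\<lambda>((c, m), xs). (c, m :: 'n) # xs) ` (({..<Q} \<times> UNIV) \<times> cell_lists Q l)"
    by (auto simp: cell_lists_def length_Suc_conv image_iff)
  then have "(\<Sum>xs\<in>cell_lists Q (Suc l). F xs) = (\<Sum>((c, m), xs)\<in>({..<Q} \<times> UNIV) \<times> cell_lists Q l. F ((c, m) # xs))"
    by (simp only:) (subst sum.reindex, auto simp: inj_on_def intro!: sum.cong)
  also have "\<dots> = (\<Sum>p\<in>{..<Q} \<times> UNIV. \<Sum>xs\<in>cell_lists Q l. F (p # xs))"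
    unfolding sum.cartesian_product by (intro sum.cong) auto
  also have "\<dots> = (\<Sum>c<Q. \<Sum>m\<in>UNIV. \<Sum>xs\<in>cell_lists Q l. F ((c, m) # xs))"
    by (rule trans[OF _ sum.cartesian_product[symmetric]]) (auto intro: sum.cong)
  finally show ?thesis .
qed

text \<open>Vanishing at nonpositive times lets every gap range over the same interval: gap
  sequences that leave the simplex contribute 0, so no ordering constraint on the times has to be
  tracked.\<close>

locale continuous_control =
  fixes v :: "real \<Rightarrow> real^'n::finite" and t U :: real
  assumes t_pos: "0 < t" and v_cont: "continuous_on UNIV v" and v_zero: "s \<le> 0 \<Longrightarrow> v s = 0"
    and v_bound: "\<bar>v s $ m\<bar> \<le> U" and U_nonneg: "0 \<le> U"
begin

fun weight :: "real \<Rightarrow> real \<Rightarrow> (nat \<times> 'n) list \<Rightarrow> real" where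
  "weight \<delta> s [] = 1"
| "weight \<delta> s ((c, m) # xs) = v (s - \<delta> * real c) $ m * weight \<delta> (s - \<delta> * real c) xs"

fun end_time :: "real \<Rightarrow> real \<Rightarrow> (nat \<times> 'n) list \<Rightarrow> real" where
  "end_time \<delta> s [] = s"
| "end_time \<delta> s ((c, m) # xs) = end_time \<delta> (s - \<delta> * real c) xs"

lemma end_time_le: "0 \<le> \<delta> \<Longrightarrow> end_time \<delta> s xs \<le> s"
proof (induction xs arbitrary: s)
  case (Cons x xs)
  obtain c m where "x = (c, m)" by (cases x)
  then show ?case
    using Cons.IH[OF Cons.prems, of "s - \<delta> * real c"] mult_nonneg_nonneg[OF Cons.prems, of "real c"]
    by simp
qed simp

lemma abs_weight_le: "\<bar>weight \<delta> s xs\<bar> \<le> U ^ length xs"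
proof (induction xs arbitrary: s)
  case (Cons x xs)
  obtain c m where "x = (c, m)" by (cases x)
  then show ?case
    using Cons.IH v_bound U_nonneg by (auto simp: abs_mult intro!: mult_mono)
qed simp

text \<open>Moving the window so that it ends at some \<open>s\<close> below \<open>t\<close> only
  loses mass, since \<open>v\<close> vanishes at nonpositive times. The strict inequality leaves
  room for the Riemann error, which is uniform in \<open>s\<close>.\<close>

lemma square_sum_eventually:
  assumes "(LINT s:{0..t}|lborel. (\<Sum>m\<in>UNIV. (v s $ m)\<^sup>2)) < 1"
  shows "\<forall>\<^sub>F Q in sequentially. \<forall>s\<le>t. (\<Sum>c<Q. (t / real Q) * (\<Sum>m\<in>UNIV. (v (s - t / real Q * real c) $ m)\<^sup>2)) \<le> 1"
proof -
  define g where "g s = (\<Sum>m\<in>UNIV. (v s $ m)\<^sup>2)" for s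
  have g0: "g s = 0" if "s \<le> 0" for s using v_zero[OF that] by (simp add: g_def)
  have g_nonneg: "0 \<le> g s" for s by (simp add: g_def sum_nonneg)
  have g_cont: "continuous_on UNIV g"
    unfolding g_def by (intro continuous_intros v_cont)
  have cont: "continuous_on ({0..1 * t} \<times> {0..t}) (\<lambda>(\<sigma>, s). g (s - \<sigma>))"
    unfolding case_prod_beta by (intro continuous_on_compose2[OF g_cont] continuous_intros) auto
  have lim: "uniform_limit {..t} (\<lambda>Q s. \<Sum>c<Q. (1 * t / real Q) *\<^sub>R g (s - 1 * t / real Q * real c))
     (\<lambda>s. LINT \<sigma>:{0..t}|lborel. g (s - \<sigma>)) sequentially"
    using riemann_sum_uniform_limit[OF t_pos order_refl cont] g0 by simp
  have int_le: "(LINT \<sigma>:{0..t}|lborel. g (s - \<sigma>)) \<le> (LINT \<sigma>:{0..t}|lborel. g \<sigma>)" if "s \<le> t" for s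
  proof -
    have "(LINT \<sigma>:{0..t}|lborel. g (s - \<sigma>)) = (\<integral>x. indicator {0..t} (s - x) *\<^sub>R g x \<partial>lborel)"
      unfolding set_lebesgue_integral_def
      by (subst lborel_integral_real_affine[where c = "-1" and t = s]) (auto simp: algebra_simps)
    also have "\<dots> \<le> (LINT \<sigma>:{0..t}|lborel. g \<sigma>)"
      unfolding set_lebesgue_integral_def
    proof (rule integral_mono')
      show "integrable lborel (\<lambda>x. indicator {0..t} x *\<^sub>R g x)"
        by (intro borel_integrable_compact compact_Icc continuous_on_subset[OF g_cont]) auto
      show "indicator {0..t} (s - x) *\<^sub>R g x \<le> indicator {0..t} x *\<^sub>R g x" for x
        using that g0[of x] g_nonneg[of x] by (auto simp: indicator_def)
    qed (use g_nonneg in auto)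
    finally show ?thesis .
  qed
  have "0 < 1 - (LINT \<sigma>:{0..t}|lborel. g \<sigma>)" using assms by (simp add: g_def)
  from uniform_limitD[OF lim this] show ?thesis
  proof eventually_elim
    case (elim Q)
    show ?case
    proof (intro allI impI)
      fix s assume s: "s \<le> t"
      then have "\<bar>(\<Sum>c<Q. (t / real Q) * g (s - t / real Q * real c)) - (LINT \<sigma>:{0..t}|lborel. g (s - \<sigma>))\<bar>
         < 1 - (LINT \<sigma>:{0..t}|lborel. g \<sigma>)"
        using elim by (auto simp: dist_real_def)
      then show "(\<Sum>c<Q. (t / real Q) * (\<Sum>m\<in>UNIV. (v (s - t / real Q * real c) $ m)\<^sup>2)) \<le> 1"
        using int_le[OF s] unfolding g_def[symmetric] by linarith
    qed
  qed
qed

text \<open>Discrete form of the fact that the L2 norm of an iterated tensor product is a product of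
  norms: the sum over the later gaps is at most 1 for every starting time, so the first gap can be
  peeled off.\<close>

lemma weight_square_sum:
  assumes "0 \<le> \<delta>" and sq: "\<And>s. s \<le> t \<Longrightarrow> (\<Sum>c<Q. \<delta> * (\<Sum>m\<in>UNIV. (v (s - \<delta> * real c) $ m)\<^sup>2)) \<le> 1"
    and "s \<le> t"
  shows "(\<Sum>xs\<in>cell_lists Q l. \<delta> ^ l * (weight \<delta> s xs)\<^sup>2) \<le> 1"
  using \<open>s \<le> t\<close>
proof (induction l arbitrary: s)
  case (Suc l)
  have "(\<Sum>xs\<in>cell_lists Q (Suc l). \<delta> ^ Suc l * (weight \<delta> s xs)\<^sup>2)
     = (\<Sum>c<Q. \<Sum>m\<in>UNIV. \<delta> * (v (s - \<delta> * real c) $ m)\<^sup>2 *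
         (\<Sum>xs\<in>cell_lists Q l. \<delta> ^ l * (weight \<delta> (s - \<delta> * real c) xs)\<^sup>2))"
    by (simp add: sum_cell_lists_Suc power_mult_distrib sum_distrib_left ac_simps)
  also have "\<dots> \<le> (\<Sum>c<Q. \<Sum>m\<in>UNIV. \<delta> * (v (s - \<delta> * real c) $ m)\<^sup>2 * 1)"
  proof (intro sum_mono mult_left_mono Suc.IH)
    fix c show "s - \<delta> * real c \<le> t"
      using Suc.prems mult_nonneg_nonneg[OF \<open>0 \<le> \<delta>\<close>, of "real c"] by simp
  qed (use \<open>0 \<le> \<delta>\<close> in auto)
  also have "\<dots> \<le> 1"
    using sq[OF Suc.prems] by (simp add: sum_distrib_left)
  finally show ?case .
qed simp

end

section \<open>Discretised Volterra series\<close>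

locale driven_system = bounded_semigroup_system T N psi C M + continuous_control v t U
  for T :: "real \<Rightarrow> 'x::{real_inner,banach,second_countable_topology} \<Rightarrow> 'x"
    and N :: "'n::finite \<Rightarrow> 'x \<Rightarrow> 'x" and psi :: "'n \<Rightarrow> 'x"
    and C :: "'x \<Rightarrow> real^'m::finite" and M :: real and v :: "real \<Rightarrow> real^'n" and t U :: real
begin

text \<open>The integration variable is the gap. Its upper limit is \<open>t\<close> for every
  \<open>s\<close>, which for \<open>s\<close> between 0 and \<open>t\<close> agrees with the limit
  \<open>s\<close> because \<open>v\<close> vanishes at nonpositive times.\<close>

definition conv_int :: "('n \<Rightarrow> real \<Rightarrow> 'x) \<Rightarrow> real \<Rightarrow> 'x" where
  "conv_int D s = (LINT \<sigma>:{0..t}|lborel. T \<sigma> (\<Sum>m\<in>UNIV. v (s - \<sigma>) $ m *\<^sub>R D m (s - \<sigma>)))"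

definition conv_sum :: "real \<Rightarrow> nat \<Rightarrow> ('n \<Rightarrow> real \<Rightarrow> 'x) \<Rightarrow> real \<Rightarrow> 'x" where
  "conv_sum \<delta> Q D s = (\<Sum>c<Q. \<delta> *\<^sub>R T (\<delta> * real c)
     (\<Sum>m\<in>UNIV. v (s - \<delta> * real c) $ m *\<^sub>R D m (s - \<delta> * real c)))"

lemma conv_sum_uniform_limit_const:
  assumes "1 \<le> a" and D: "\<And>m. continuous_on {..t} (D m)"
  shows "uniform_limit {..t} (\<lambda>Q. conv_sum (a * t / real Q) Q D) (conv_int D) sequentially"
proof -
  define f where "f = (\<lambda>(\<sigma>, s). T \<sigma> (\<Sum>m\<in>UNIV. v (s - \<sigma>) $ m *\<^sub>R D m (s - \<sigma>)))"
  have cont: "continuous_on ({0..a * t} \<times> {0..t}) f"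
    unfolding f_def case_prod_beta
    by (intro T_continuous_compose continuous_intros continuous_on_compose2[OF v_cont]
        continuous_on_compose2[OF D]) auto
  have zero: "f (\<sigma>, s) = 0" if "s \<le> t" "0 \<le> \<sigma>" "s \<le> \<sigma>" for \<sigma> s
    using that by (simp add: f_def v_zero)
  show ?thesis
    using riemann_sum_uniform_limit[OF t_pos \<open>1 \<le> a\<close> cont zero]
    by (simp add: f_def conv_sum_def[abs_def] conv_int_def[abs_def])
qed

text \<open>The discrete sums are continuous in \<open>s\<close> and converge uniformly.\<close>

lemma conv_int_continuous:
  assumes D: "\<And>m. continuous_on {..t} (D m)"
  shows "continuous_on {..t} (conv_int D)"
proof (rule uniform_limit_theorem)
  show "uniform_limit {..t} (\<lambda>Q. conv_sum (1 * t / real Q) Q D) (conv_int D) sequentially"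
    by (rule conv_sum_uniform_limit_const[OF order_refl D])
  have "continuous_on {..t} (conv_sum \<delta> Q D)" if "0 \<le> \<delta>" for \<delta> Q
  proof -
    have le: "s - \<delta> * real c \<le> t" if "s \<le> t" for s c
      using that mult_nonneg_nonneg[OF \<open>0 \<le> \<delta>\<close>, of "real c"] by simp
    show ?thesis
      unfolding conv_sum_def[abs_def] using \<open>0 \<le> \<delta>\<close>
      by (intro continuous_intros T_continuous_compose continuous_on_compose2[OF v_cont]
        continuous_on_compose2[OF D]) (auto simp: le)
  qed
  then show "\<forall>\<^sub>F Q in sequentially. continuous_on {..t} (conv_sum (1 * t / real Q) Q D)"
    using t_pos by (intro always_eventually allI) simp
qed simp

lemma conv_sum_diff_bound:
  assumes "0 \<le> \<delta>" "s \<le> t" and e: "\<And>m s. s \<le> t \<Longrightarrow> norm (D m s - D' m s) \<le> e"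
  shows "norm (conv_sum \<delta> Q D s - conv_sum \<delta> Q D' s) \<le> \<delta> * real Q * (max 0 M * (real CARD('n) * (U * e)))"
proof -
  define G where "G D s = (\<Sum>m\<in>UNIV. v s $ m *\<^sub>R D m s)" for D :: "'n \<Rightarrow> real \<Rightarrow> 'x" and s
  have G: "norm (G D s - G D' s) \<le> real CARD('n) * (U * e)" if "s \<le> t" for s
  proof -
    have "norm (G D s - G D' s) \<le> (\<Sum>m\<in>(UNIV :: 'n set). U * e)"
      unfolding G_def sum_subtractf[symmetric] scaleR_diff_right[symmetric]
      by (intro sum_norm_le) (auto intro!: mult_mono v_bound U_nonneg e[OF that])
    then show ?thesis by simp
  qed
  have "conv_sum \<delta> Q D s - conv_sum \<delta> Q D' s
     = (\<Sum>c<Q. \<delta> *\<^sub>R T (\<delta> * real c) (G D (s - \<delta> * real c) - G D' (s - \<delta> * real c)))"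
    unfolding conv_sum_def G_def[symmetric] using \<open>0 \<le> \<delta>\<close>
    by (simp add: T_diff scaleR_diff_right sum_subtractf)
  also have "norm \<dots> \<le> (\<Sum>c<Q. \<delta> * (max 0 M * (real CARD('n) * (U * e))))"
  proof (rule sum_norm_le)
    fix c
    have le: "s - \<delta> * real c \<le> t"
      using \<open>s \<le> t\<close> mult_nonneg_nonneg[OF \<open>0 \<le> \<delta>\<close>, of "real c"] by simp
    have "norm (T (\<delta> * real c) (G D (s - \<delta> * real c) - G D' (s - \<delta> * real c)))
       \<le> M * norm (G D (s - \<delta> * real c) - G D' (s - \<delta> * real c))"
      using \<open>0 \<le> \<delta>\<close> by (intro T_bound) simp
    also have "\<dots> \<le> max 0 M * norm (G D (s - \<delta> * real c) - G D' (s - \<delta> * real c))"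
      by (intro mult_right_mono) auto
    also have "\<dots> \<le> max 0 M * (real CARD('n) * (U * e))"
      by (intro mult_left_mono G le) auto
    finally show "norm (\<delta> *\<^sub>R T (\<delta> * real c) (G D (s - \<delta> * real c) - G D' (s - \<delta> * real c)))
      \<le> \<delta> * (max 0 M * (real CARD('n) * (U * e)))"
      using \<open>0 \<le> \<delta>\<close> by (simp add: mult_left_mono)
  qed
  finally show ?thesis by (simp add: ac_simps)
qed

text \<open>Discrete convolution is Lipschitz in its input with a constant independent of
  \<open>Q\<close>, since mesh size times number of cells is \<open>a * t\<close>. Hence the input
  may be replaced by its own approximation, and nested discretisations converge.\<close>

lemma conv_sum_uniform_limit:
  assumes "1 \<le> a" and D: "\<And>m. continuous_on {..t} (D m)"
    and lim: "\<And>m. uniform_limit {..t} (\<lambda>Q. D' Q m) (D m) sequentially"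
  shows "uniform_limit {..t} (\<lambda>Q. conv_sum (a * t / real Q) Q (D' Q)) (conv_int D) sequentially"
proof (rule uniform_limitI)
  fix \<epsilon> :: real assume "\<epsilon> > 0"
  define B where "B = a * t * (max 0 M * (real CARD('n) * U))"
  have "B \<ge> 0" using assms t_pos U_nonneg by (simp add: B_def)
  define e where "e = \<epsilon> / (2 * (B + 1))"
  have "e > 0" "B * e < \<epsilon> / 2"
    using \<open>B \<ge> 0\<close> \<open>\<epsilon> > 0\<close> by (auto simp: e_def field_simps)
  have "\<forall>\<^sub>F Q in sequentially. \<forall>m. \<forall>s\<in>{..t}. dist (D' Q m s) (D m s) < e"
    using uniform_limitD[OF lim \<open>e > 0\<close>] by (intro eventually_all_finite) auto
  moreover have "\<forall>\<^sub>F Q in sequentially. \<forall>s\<in>{..t}. dist (conv_sum (a * t / real Q) Q D s) (conv_int D s) < \<epsilon> / 2"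
    by (rule uniform_limitD[OF conv_sum_uniform_limit_const[OF \<open>1 \<le> a\<close> D]]) (use \<open>\<epsilon> > 0\<close> in simp)
  ultimately show "\<forall>\<^sub>F Q in sequentially. \<forall>s\<in>{..t}. dist (conv_sum (a * t / real Q) Q (D' Q) s) (conv_int D s) < \<epsilon>"
    using eventually_gt_at_top[of 0]
  proof eventually_elim
    case (elim Q)
    show ?case
    proof
      fix s assume s: "s \<in> {..t}"
      have "norm (conv_sum (a * t / real Q) Q (D' Q) s - conv_sum (a * t / real Q) Q D s)
         \<le> a * t / real Q * real Q * (max 0 M * (real CARD('n) * (U * e)))"
        using elim s assms(1) t_pos by (intro conv_sum_diff_bound) (auto simp: dist_norm less_imp_le)
      also have "\<dots> = B * e" using elim by (simp add: B_def)
      finally have "dist (conv_sum (a * t / real Q) Q (D' Q) s) (conv_sum (a * t / real Q) Q D s) < \<epsilon> / 2"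
        using \<open>B * e < \<epsilon> / 2\<close> by (simp add: dist_norm)
      moreover have "dist (conv_sum (a * t / real Q) Q D s) (conv_int D s) < \<epsilon> / 2" using elim s by blast
      ultimately show "dist (conv_sum (a * t / real Q) Q (D' Q) s) (conv_int D s) < \<epsilon>"
        by (metis dist_commute dist_triangle_half_l)
    qed
  qed
qed

text \<open>The vector by which component \<open>m\<close> of the control at time \<open>s\<close>
  is multiplied in the term of order \<open>l\<close>: \<open>psi m\<close> at order 0, and
  \<open>N m\<close> applied to the preceding Volterra term afterwards.\<close>

fun kernel_int :: "nat \<Rightarrow> 'n \<Rightarrow> real \<Rightarrow> 'x" where
  "kernel_int 0 = (\<lambda>m s. psi m)"
| "kernel_int (Suc l) = (\<lambda>m s. N m (conv_int (kernel_int l) s))"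

definition volterra :: "nat \<Rightarrow> real \<Rightarrow> 'x" where
  "volterra k = conv_int (kernel_int k)"

fun kernel_sum :: "real \<Rightarrow> nat \<Rightarrow> nat \<Rightarrow> 'n \<Rightarrow> real \<Rightarrow> 'x" where
  "kernel_sum \<delta> Q 0 = (\<lambda>m s. psi m)"
| "kernel_sum \<delta> Q (Suc l) = (\<lambda>m s. N m (conv_sum \<delta> Q (kernel_sum \<delta> Q l) s))"

fun outer_sum :: "real \<Rightarrow> nat \<Rightarrow> (real \<Rightarrow> 'x) \<Rightarrow> nat \<Rightarrow> real \<Rightarrow> 'x" where
  "outer_sum \<delta> Q g 0 = g"
| "outer_sum \<delta> Q g (Suc j) = conv_sum \<delta> Q (\<lambda>m s. N m (outer_sum \<delta> Q g j s))"

text \<open>Discretises the term of order \<open>j + l\<close> with \<open>j\<close> gaps on the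
  output side and \<open>l\<close> on the input side of the split gap. Only the latter has mesh
  \<open>2 * t / real Q\<close>, so that both its halves lie on the common mesh.\<close>

definition volterra_sum :: "nat \<Rightarrow> nat \<Rightarrow> nat \<Rightarrow> 'x" where
  "volterra_sum Q j l = outer_sum (t / real Q) Q (conv_sum (2 * t / real Q) Q (kernel_sum (t / real Q) Q l)) j t"

lemma kernel_int_continuous: "continuous_on {..t} (kernel_int l m)"
  by (induction l arbitrary: m)
     (auto intro!: bounded_linear.continuous_on[OF N_linear] conv_int_continuous)

lemma volterra_continuous: "continuous_on {..t} (volterra k)"
  unfolding volterra_def by (intro conv_int_continuous kernel_int_continuous)

lemma uniform_limit_N:
  "uniform_limit {..t} f g sequentially \<Longrightarrow> uniform_limit {..t} (\<lambda>Q s. N m (f Q s)) (\<lambda>s. N m (g s)) sequentially"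
  by (rule bounded_linear.uniform_limit[OF N_linear])

lemma kernel_sum_limit:
  "uniform_limit {..t} (\<lambda>Q. kernel_sum (t / real Q) Q l m) (kernel_int l m) sequentially"
proof (induction l arbitrary: m)
  case 0
  then show ?case by (simp add: uniform_limit_const)
next
  case (Suc l)
  have "uniform_limit {..t} (\<lambda>Q. conv_sum (1 * t / real Q) Q (kernel_sum (t / real Q) Q l)) (conv_int (kernel_int l)) sequentially"
    by (intro conv_sum_uniform_limit kernel_int_continuous Suc.IH) simp
  then show ?case
    using uniform_limit_N by simp
qed

lemma outer_sum_limit:
  assumes "uniform_limit {..t} g (volterra l) sequentially"
  shows "uniform_limit {..t} (\<lambda>Q. outer_sum (t / real Q) Q (g Q) j) (volterra (j + l)) sequentially"
proof (induction j)
  case 0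
  then show ?case using assms by simp
next
  case (Suc j)
  have "uniform_limit {..t} (\<lambda>Q. conv_sum (1 * t / real Q) Q (\<lambda>m s. N m (outer_sum (t / real Q) Q (g Q) j s)))
     (conv_int (\<lambda>m s. N m (volterra (j + l) s))) sequentially"
    by (intro conv_sum_uniform_limit uniform_limit_N Suc.IH bounded_linear.continuous_on[OF N_linear] volterra_continuous) simp
  then show ?case
    by (simp add: volterra_def)
qed

lemma volterra_sum_limit: "(\<lambda>Q. volterra_sum Q j l) \<longlonglongrightarrow> volterra (j + l) t"
proof -
  have "uniform_limit {..t} (\<lambda>Q. conv_sum (2 * t / real Q) Q (kernel_sum (t / real Q) Q l)) (volterra l) sequentially"
    unfolding volterra_def by (intro conv_sum_uniform_limit kernel_sum_limit kernel_int_continuous) simp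
  from tendsto_uniform_limitI[OF outer_sum_limit[OF this], of t j] show ?thesis
    by (simp add: volterra_sum_def)
qed

section \<open>Expansion of the discretised terms into chains\<close>

fun out_chain :: "real \<Rightarrow> (nat \<times> 'n) list \<Rightarrow> 'x \<Rightarrow> 'x" where
  "out_chain \<delta> [] y = y"
| "out_chain \<delta> ((c, m) # xs) y = T (\<delta> * real c) (N m (out_chain \<delta> xs y))"

text \<open>The label of the input next to the split gap is the separate argument \<open>m\<close>,
  as its time carries no gap of its own in the list. Labels are thereby shifted by one against the
  gaps, and the last of them selects \<open>psi\<close>.\<close>

fun in_chain :: "real \<Rightarrow> (nat \<times> 'n) list \<Rightarrow> 'n \<Rightarrow> 'x" where
  "in_chain \<delta> [] m = psi m"
| "in_chain \<delta> ((c, m') # xs) m = N m (T (\<delta> * real c) (in_chain \<delta> xs m'))"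

lemma T_sum: "0 \<le> s \<Longrightarrow> T s (sum f A) = (\<Sum>a\<in>A. T s (f a))"
  using T_linear by (simp add: linear_sum bounded_linear.linear)

lemma T_scaleR: "0 \<le> s \<Longrightarrow> T s (r *\<^sub>R x) = r *\<^sub>R T s x"
  using T_linear by (simp add: linear_scale bounded_linear.linear)

lemma N_sum: "N m (sum f A) = (\<Sum>a\<in>A. N m (f a))"
  using N_linear by (simp add: linear_sum bounded_linear.linear)

lemma N_scaleR: "N m (r *\<^sub>R x) = r *\<^sub>R N m x"
  using N_linear by (simp add: linear_scale bounded_linear.linear)

lemma kernel_sum_expand:
  assumes "0 \<le> \<delta>"
  shows "kernel_sum \<delta> Q l m s = (\<Sum>xs\<in>cell_lists Q l. (\<delta> ^ l * weight \<delta> s xs) *\<^sub>R in_chain \<delta> xs m)"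
proof (induction l arbitrary: m s)
  case (Suc l)
  have "kernel_sum \<delta> Q (Suc l) m s = N m (\<Sum>c<Q. \<delta> *\<^sub>R T (\<delta> * real c)
     (\<Sum>m'\<in>UNIV. v (s - \<delta> * real c) $ m' *\<^sub>R
       (\<Sum>xs\<in>cell_lists Q l. (\<delta> ^ l * weight \<delta> (s - \<delta> * real c) xs) *\<^sub>R in_chain \<delta> xs m')))"
    by (simp add: conv_sum_def Suc.IH)
  also have "\<dots> = (\<Sum>xs\<in>cell_lists Q (Suc l). (\<delta> ^ Suc l * weight \<delta> s xs) *\<^sub>R in_chain \<delta> xs m)"
    using assms
    by (simp add: sum_cell_lists_Suc T_sum T_scaleR N_sum N_scaleR scaleR_sum_right ac_simps)
  finally show ?case .
qed simp

lemma outer_sum_expand: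
  assumes "0 \<le> \<delta>"
  shows "outer_sum \<delta> Q g j s = (\<Sum>xs\<in>cell_lists Q j. (\<delta> ^ j * weight \<delta> s xs) *\<^sub>R out_chain \<delta> xs (g (end_time \<delta> s xs)))"
proof (induction j arbitrary: s)
  case (Suc j)
  have "outer_sum \<delta> Q g (Suc j) s = (\<Sum>c<Q. \<delta> *\<^sub>R T (\<delta> * real c)
     (\<Sum>m\<in>UNIV. v (s - \<delta> * real c) $ m *\<^sub>R N m
       (\<Sum>xs\<in>cell_lists Q j. (\<delta> ^ j * weight \<delta> (s - \<delta> * real c) xs) *\<^sub>R
          out_chain \<delta> xs (g (end_time \<delta> (s - \<delta> * real c) xs)))))"
    by (simp add: conv_sum_def Suc.IH)
  also have "\<dots> = (\<Sum>xs\<in>cell_lists Q (Suc j). (\<delta> ^ Suc j * weight \<delta> s xs) *\<^sub>R out_chain \<delta> xs (g (end_time \<delta> s xs)))"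
    using assms
    by (simp add: sum_cell_lists_Suc T_sum T_scaleR N_sum N_scaleR scaleR_sum_right ac_simps)
  finally show ?case .
qed simp

lemma out_chain_sum:
  assumes "0 \<le> \<delta>"
  shows "out_chain \<delta> xs (\<Sum>a\<in>A. r a *\<^sub>R f a) = (\<Sum>a\<in>A. r a *\<^sub>R out_chain \<delta> xs (f a))"
  using assms by (induction xs rule: list.induct) (auto simp: T_sum T_scaleR N_sum N_scaleR)

text \<open>The factor 2 is that of the middle mesh \<open>2 * \<delta>\<close>, the discrete form
  of d\<sigma> = 2 d\<tau>.\<close>

lemma volterra_sum_expand:
  "volterra_sum Q j l = (let \<delta> = t / real Q in
     \<Sum>xs\<in>cell_lists Q j. \<Sum>\<tau><Q. \<Sum>m\<in>UNIV. \<Sum>xs'\<in>cell_lists Q l.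
       (2 * \<delta> ^ (j + l + 1) * (weight \<delta> t xs * v (end_time \<delta> t xs - 2 * \<delta> * real \<tau>) $ m
          * weight \<delta> (end_time \<delta> t xs - 2 * \<delta> * real \<tau>) xs')) *\<^sub>R
       out_chain \<delta> xs (T (2 * \<delta> * real \<tau>) (in_chain \<delta> xs' m)))"
proof -
  define \<delta> where "\<delta> = t / real Q"
  have \<delta>: "0 \<le> \<delta>" "2 * t / real Q = 2 * \<delta>" using t_pos by (auto simp: \<delta>_def)
  define q where "q xs \<tau> = end_time \<delta> t xs - 2 * \<delta> * real \<tau>" for xs and \<tau> :: nat
  have mid: "conv_sum (2 * \<delta>) Q (kernel_sum \<delta> Q l) (end_time \<delta> t xs)
     = (\<Sum>\<tau><Q. 1 *\<^sub>R (\<Sum>m\<in>UNIV. 1 *\<^sub>R (\<Sum>xs'\<in>cell_lists Q l.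
         (2 * \<delta> * v (q xs \<tau>) $ m * \<delta> ^ l * weight \<delta> (q xs \<tau>) xs') *\<^sub>R T (2 * \<delta> * real \<tau>) (in_chain \<delta> xs' m))))" for xs
    unfolding conv_sum_def q_def[symmetric] kernel_sum_expand[OF \<delta>(1)] using \<delta>(1)
    by (simp add: T_sum T_scaleR scaleR_sum_right ac_simps)
  show ?thesis
    unfolding volterra_sum_def \<delta>_def[symmetric] \<delta>(2) outer_sum_expand[OF \<delta>(1)] mid out_chain_sum[OF \<delta>(1)] Let_def q_def[symmetric]
    by (simp add: scaleR_sum_right power_add ac_simps)
qed

lemma Ochain_out_chain:
  assumes "\<And>r. r \<le> length xs \<Longrightarrow> s (i + r) = \<delta> * real ((map fst xs @ [\<tau>]) ! r)"
  shows "Ochain T N s i (map snd xs) y = out_chain \<delta> xs (T (\<delta> * real \<tau>) y)"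
  using assms
proof (induction xs arbitrary: i)
  case Nil
  then show ?case using Nil[of 0] by simp
next
  case (Cons x xs)
  obtain c m where x: "x = (c, m)" by (cases x)
  have "s (Suc i + r) = \<delta> * real ((map fst xs @ [\<tau>]) ! r)" if "r \<le> length xs" for r
    using Cons.prems[of "Suc r"] that by simp
  from Cons.IH[OF this] show ?case
    using Cons.prems[of 0] by (simp add: x)
qed

lemma Rchain_snoc: "Rchain s i (ns @ [n]) y = T (s (Suc (i + length ns))) (N n (Rchain s i ns y))"
  by (induction ns arbitrary: i y) auto

text \<open>After reversal the innermost label comes first and selects \<open>psi\<close>. Adding a
  cell next to the gap appends at the end of the reversed list, where \<open>Rchain_snoc\<close>
  peels it off as the outermost factor.\<close>

lemma Rchain_in_chain:
  "Rchain (\<lambda>r. \<delta> * real (rev (\<tau> # map fst xs) ! r)) 0 (tl (rev (m # map snd xs))) (psi (hd (rev (m # map snd xs))))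
     = T (\<delta> * real \<tau>) (in_chain \<delta> xs m)"
proof (induction xs arbitrary: \<tau> m)
  case (Cons x xs)
  obtain c m' where x: "x = (c, m')" by (cases x)
  define L where "L = rev (m' # map snd xs)"
  have L: "L \<noteq> []" "length L = Suc (length xs)" by (auto simp: L_def)
  have "Rchain (\<lambda>r. \<delta> * real (rev (\<tau> # map fst (x # xs)) ! r)) 0 (tl L) (psi (hd L))
     = Rchain (\<lambda>r. \<delta> * real (rev (c # map fst xs) ! r)) 0 (tl L) (psi (hd L))"
    using L by (intro Rchain_cong) (auto simp: x nth_append)
  also have "\<dots> = T (\<delta> * real c) (in_chain \<delta> xs m')"
    unfolding L_def by (rule Cons.IH)
  finally have "Rchain (\<lambda>r. \<delta> * real (rev (\<tau> # map fst (x # xs)) ! r)) 0 (tl L @ [m]) (psi (hd L))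
     = T (\<delta> * real \<tau>) (N m (T (\<delta> * real c) (in_chain \<delta> xs m')))"
    unfolding Rchain_snoc using L by (simp add: x nth_append)
  moreover have "rev (m # map snd (x # xs)) = L @ [m]" by (simp add: L_def x)
  ultimately show ?case using L by (simp add: x)
qed simp

end

section \<open>Comparison of two systems\<close>

text \<open>Input cells are indexed by \<open>(\<tau>, m, xs)\<close>, read away from the split gap; since
  \<open>P\<^sub>k(s)\<^sup>*\<close> applies the time \<open>s 0\<close> first, the lists are reversed, and the label farthest from the
  gap becomes the index of the vector \<open>psi\<close>.\<close>
definition in_box :: "real \<Rightarrow> nat \<times> 'n \<times> (nat \<times> 'n) list \<Rightarrow> ('n::finite, 'n) fock" where
  "in_box \<delta> = (\<lambda>(\<tau>, m, xs). box_fun \<delta> (rev (\<tau> # map fst xs)) (tl (rev (m # map snd xs)))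
     (axis (hd (rev (m # map snd xs))) 1))"

definition out_box :: "real \<Rightarrow> real^'m \<Rightarrow> (nat \<times> 'n) list \<times> nat \<Rightarrow> ('m::finite, 'n::finite) fock" where
  "out_box \<delta> w = (\<lambda>(xs, \<tau>). box_fun \<delta> (map fst xs @ [\<tau>]) (map snd xs) w)"

lemma list_eq_map_fst_snd: "map fst xs = map fst ys \<Longrightarrow> map snd xs = map snd ys \<Longrightarrow> xs = ys"
  by (metis zip_map_fst_snd)

lemma in_box_lengths:
  "length (rev (\<tau> # map fst xs)) = Suc (length (tl (rev (m # map snd xs))))"
  by simp

lemma in_box_orthonormal:
  assumes "0 < \<delta>"
  shows "fock_inner (in_box \<delta> a) (in_box \<delta> a') = (if a = a' then 1 else 0)"
proof -
  obtain \<tau> m xs \<tau>' m' xs' where a: "a = (\<tau>, m, xs)" "a' = (\<tau>', m', xs')"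
    by (cases a; cases a')
  let ?r = "rev (m # map snd xs)" and ?r' = "rev (m' # map snd xs')"
  have "fock_inner (in_box \<delta> a) (in_box \<delta> a')
     = (if rev (\<tau> # map fst xs) = rev (\<tau>' # map fst xs') \<and> tl ?r = tl ?r' then axis (hd ?r) (1::real) \<bullet> axis (hd ?r') 1 else 0)"
    unfolding a in_box_def prod.case by (rule fock_inner_box_fun_box_fun[OF in_box_lengths in_box_lengths assms])
  also have "\<dots> = (if rev (\<tau> # map fst xs) = rev (\<tau>' # map fst xs') \<and> tl ?r = tl ?r' \<and> hd ?r = hd ?r' then 1 else 0)"
    by (simp add: inner_axis_axis)
  \<comment> \<open>The head of the reversed labels sits in the vector of the box and the tail in
    its tensor index; together they recover the list.\<close>
  also have "tl ?r = tl ?r' \<and> hd ?r = hd ?r' \<longleftrightarrow> ?r = ?r'"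
    by (metis list.expand rev_is_Nil_conv list.distinct(1))
  also have "(rev (\<tau> # map fst xs) = rev (\<tau>' # map fst xs') \<and> ?r = ?r') \<longleftrightarrow> a = a'"
    unfolding rev_is_rev_conv a by (auto intro: list_eq_map_fst_snd)
  finally show ?thesis .
qed

lemma out_box_orthonormal:
  assumes "0 < \<delta>" "norm w = 1"
  shows "fock_inner (out_box \<delta> w b) (out_box \<delta> w b') = (if b = b' then 1 else 0)"
proof -
  obtain xs \<tau> xs' \<tau>' where b: "b = (xs, \<tau>)" "b' = (xs', \<tau>')"
    by (cases b; cases b')
  have "fock_inner (out_box \<delta> w b) (out_box \<delta> w b')
     = (if map fst xs @ [\<tau>] = map fst xs' @ [\<tau>'] \<and> map snd xs = map snd xs' then w \<bullet> w else 0)"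
    unfolding b out_box_def prod.case using assms by (intro fock_inner_box_fun_box_fun) auto
  also have "(map fst xs @ [\<tau>] = map fst xs' @ [\<tau>'] \<and> map snd xs = map snd xs') \<longleftrightarrow> b = b'"
    unfolding b by (auto intro: list_eq_map_fst_snd)
  also have "w \<bullet> w = 1" using assms by (simp add: dot_square_norm)
  finally show ?thesis .
qed

lemma in_fock_in_box: "0 \<le> \<delta> \<Longrightarrow> in_fock (in_box \<delta> a)"
  by (cases a) (simp add: in_box_def in_fock_box_fun)

lemma in_fock_out_box: "0 \<le> \<delta> \<Longrightarrow> in_fock (out_box \<delta> w b)"
  by (cases b) (simp add: out_box_def in_fock_box_fun)

lemma pairable_out_box_out_box: "0 \<le> \<delta> \<Longrightarrow> pairable (out_box \<delta> w b) (out_box \<delta> w b')"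
  by (cases b; cases b') (simp add: out_box_def pairable_box_fun_box_fun)

lemma (in bounded_semigroup_system) set_integrable_Hankel:
  "length c = Suc (length ns) \<Longrightarrow> 0 \<le> \<delta> \<Longrightarrow>
    set_integrable (tmeas (length ns)) (cube \<delta> c) (\<lambda>s. Hankel T N psi C f (length ns) s (j, ns))"
  unfolding Hankel_def by (rule set_integrable_Wop)

context driven_system
begin

text \<open>The threshold in \<open>pairing_approx\<close> depends on the labels, of which there are
  finitely many lists, and not on the cells. Input and output box share the cell
  \<open>\<tau>\<close>, so the semigroup law produces the time \<open>2 * \<delta> * \<tau>\<close>
  across the gap.\<close>

lemma pairing_eventually:
  assumes "\<epsilon> > 0"
  shows "\<forall>\<^sub>F Q in sequentially. \<forall>xs\<in>cell_lists Q j. \<forall>\<tau><Q. \<forall>m. \<forall>xs'\<in>cell_lists Q l.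
    \<bar>fock_inner (Hankel T N psi C (in_box (t / real Q) (\<tau>, m, xs'))) (out_box (t / real Q) w (xs, \<tau>))
      - sqrt ((t / real Q) ^ Suc j) * sqrt ((t / real Q) ^ Suc l)
        * (C (out_chain (t / real Q) xs (T (2 * (t / real Q) * real \<tau>) (in_chain (t / real Q) xs' m))) \<bullet> w)\<bar>
    \<le> sqrt ((t / real Q) ^ Suc j) * sqrt ((t / real Q) ^ Suc l) * \<epsilon>"
proof -
  define good where "good d ns L \<longleftrightarrow> (\<forall>\<delta> c c'. 0 < \<delta> \<longrightarrow> \<delta> < d \<longrightarrow> length c = Suc (length ns) \<longrightarrow> length c' = Suc (length (tl L)) \<longrightarrow>
    (\<forall>i\<in>set c \<union> set c'. \<delta> * real i + \<delta> \<le> t) \<longrightarrow>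
    \<bar>fock_inner (Hankel T N psi C (box_fun \<delta> c' (tl L) (axis (hd L) 1))) (box_fun \<delta> c ns w)
      - sqrt (\<delta> ^ length c) * sqrt (\<delta> ^ length c')
        * (C (Ochain T N (\<lambda>r. \<delta> * real (c ! r)) 0 ns (Rchain (\<lambda>r. \<delta> * real (c' ! r)) 0 (tl L) (psi (hd L)))) \<bullet> w)\<bar>
    \<le> sqrt (\<delta> ^ length c) * sqrt (\<delta> ^ length c') * \<epsilon>)" for d and ns L :: "'n list"
  have mesh: "(\<lambda>Q. t / real Q) \<longlonglongrightarrow> 0"
    by (rule tendsto_divide_0[OF tendsto_const filterlim_at_top_imp_at_infinity[OF filterlim_real_sequentially]])
  have ev: "\<forall>\<^sub>F Q in sequentially. \<exists>d > t / real Q. good d ns L" for ns L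
  proof -
    obtain d where d: "d > 0" "good d ns L"
      using pairing_approx[OF assms, of ns "tl L" t "hd L" w] unfolding good_def by blast
    have "\<forall>\<^sub>F Q in sequentially. t / real Q < d"
      using order_tendstoD(2)[OF mesh d(1)] .
    then show ?thesis
      by eventually_elim (use d in blast)
  qed
  have fin: "finite {ns :: 'n list. length ns = k}" for k
    using finite_lists_length_eq[of "UNIV :: 'n set" k] by simp
  have "\<forall>\<^sub>F Q in sequentially. \<forall>ns\<in>{ns. length ns = j}. \<forall>L\<in>{L. length L = Suc l}. \<exists>d > t / real Q. good d ns L"
    by (intro eventually_ball_finite fin ballI ev)
  then show ?thesis
    using eventually_gt_at_top[of 0]
  proof eventually_elim
    case (elim Q)
    define \<delta> where "\<delta> = t / real Q"
    have \<delta>: "0 < \<delta>" "\<delta> * real Q = t" using elim t_pos by (auto simp: \<delta>_def)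
    show ?case
      unfolding \<delta>_def[symmetric]
    proof (intro ballI allI impI)
      fix xs xs' :: "(nat \<times> 'n) list" and \<tau> m assume xs: "xs \<in> cell_lists Q j" and \<tau>: "\<tau> < Q" and xs': "xs' \<in> cell_lists Q l"
      define L where "L = rev (m # map snd xs')"
      define c where "c = map fst xs @ [\<tau>]"
      define c' where "c' = rev (\<tau> # map fst xs')"
      have len: "length (map snd xs) = j" "length L = Suc l" "length c = Suc j" "length c' = Suc l"
        using xs xs' by (auto simp: cell_lists_def L_def c_def c'_def)
      obtain d where d: "\<delta> < d" "good d (map snd xs) L"
        using elim(1) len unfolding \<delta>_def by blast
      have cells: "\<delta> * real i + \<delta> \<le> t" if "i \<in> set c \<union> set c'" for i
      proof -
        have "i < Q" using that xs xs' \<tau> by (auto simp: cell_lists_def c_def c'_def)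
        then have "\<delta> * real (Suc i) \<le> \<delta> * real Q" using \<delta>(1) by (intro mult_left_mono) auto
        then show ?thesis using \<delta> by (simp add: algebra_simps)
      qed
      have R: "Rchain (\<lambda>r. \<delta> * real (c' ! r)) 0 (tl L) (psi (hd L)) = T (\<delta> * real \<tau>) (in_chain \<delta> xs' m)"
        unfolding c'_def L_def by (rule Rchain_in_chain)
      have O: "Ochain T N (\<lambda>r. \<delta> * real (c ! r)) 0 (map snd xs) y = out_chain \<delta> xs (T (\<delta> * real \<tau>) y)" for y
        by (rule Ochain_out_chain) (simp add: c_def)
      have TT: "T (\<delta> * real \<tau>) (T (\<delta> * real \<tau>) y) = T (2 * \<delta> * real \<tau>) y" for y
        using T_add[of "\<delta> * real \<tau>" "\<delta> * real \<tau>" y] \<delta>(1) by (simp add: algebra_simps)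
      have boxes: "in_box \<delta> (\<tau>, m, xs') = box_fun \<delta> c' (tl L) (axis (hd L) 1)" "out_box \<delta> w (xs, \<tau>) = box_fun \<delta> c (map snd xs) w"
        by (simp_all only: in_box_def out_box_def prod.case c'_def c_def L_def)
      have "length c = Suc (length (map snd xs))" "length c' = Suc (length (tl L))" using len by auto
      from d(2)[unfolded good_def, rule_format, OF \<delta>(1) d(1) this cells]
      show "\<bar>fock_inner (Hankel T N psi C (in_box \<delta> (\<tau>, m, xs'))) (out_box \<delta> w (xs, \<tau>))
        - sqrt (\<delta> ^ Suc j) * sqrt (\<delta> ^ Suc l) * (C (out_chain \<delta> xs (T (2 * \<delta> * real \<tau>) (in_chain \<delta> xs' m))) \<bullet> w)\<bar>
        \<le> sqrt (\<delta> ^ Suc j) * sqrt (\<delta> ^ Suc l) * \<epsilon>"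
        unfolding O R TT len boxes .
    qed
  qed
qed

end

section \<open>Hilbert-Schmidt norm of a block\<close>

context continuous_control
begin

definition mid_weight :: "real \<Rightarrow> (nat \<times> 'n) list \<Rightarrow> nat \<Rightarrow> 'n \<Rightarrow> (nat \<times> 'n) list \<Rightarrow> real" where
  "mid_weight \<delta> xs \<tau> m xs' = weight \<delta> t xs * v (end_time \<delta> t xs - 2 * \<delta> * real \<tau>) $ m
     * weight \<delta> (end_time \<delta> t xs - 2 * \<delta> * real \<tau>) xs'"

lemma abs_mid_weight_le: "\<bar>mid_weight \<delta> xs \<tau> m xs'\<bar> \<le> U ^ (length xs + length xs' + 1)"
proof -
  have "\<bar>mid_weight \<delta> xs \<tau> m xs'\<bar> \<le> U ^ length xs * U * U ^ length xs'"
    unfolding mid_weight_def abs_mult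
    by (intro mult_mono abs_weight_le v_bound) (auto simp: U_nonneg)
  then show ?thesis by (simp add: power_add ac_simps)
qed

text \<open>There is no power of \<open>\<delta>\<close> for the fixed cell \<open>\<tau>\<close>,
  so the control value right after the gap is estimated by \<open>U\<close>, once for each of the
  labels \<open>m\<close>. The remaining sums, over the inner list and then over the outer one, are
  at most 1.\<close>

lemma mid_weight_square_sum:
  assumes "0 \<le> \<delta>" and sq: "\<And>s. s \<le> t \<Longrightarrow> (\<Sum>c<Q. \<delta> * (\<Sum>m\<in>UNIV. (v (s - \<delta> * real c) $ m)\<^sup>2)) \<le> 1"
  shows "(\<Sum>m\<in>UNIV. \<Sum>xs'\<in>cell_lists Q l. \<Sum>xs\<in>cell_lists Q j. \<delta> ^ j * \<delta> ^ l * (mid_weight \<delta> xs \<tau> m xs')\<^sup>2)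
    \<le> real CARD('n) * U\<^sup>2"
proof -
  define q where "q xs = end_time \<delta> t xs - 2 * \<delta> * real \<tau>" for xs
  have q: "q xs \<le> t" for xs
    using end_time_le[OF \<open>0 \<le> \<delta>\<close>, of t xs] mult_nonneg_nonneg[OF \<open>0 \<le> \<delta>\<close>, of "real \<tau>"] by (simp add: q_def)
  have "(\<Sum>m\<in>UNIV. \<Sum>xs'\<in>cell_lists Q l. \<Sum>xs\<in>cell_lists Q j. \<delta> ^ j * \<delta> ^ l * (mid_weight \<delta> xs \<tau> m xs')\<^sup>2)
    = (\<Sum>m\<in>UNIV. \<Sum>xs\<in>cell_lists Q j. \<Sum>xs'\<in>cell_lists Q l. \<delta> ^ j * \<delta> ^ l * (mid_weight \<delta> xs \<tau> m xs')\<^sup>2)"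
    by (intro sum.cong refl sum.swap)
  also have "\<dots> = (\<Sum>m\<in>UNIV. \<Sum>xs\<in>cell_lists Q j. \<delta> ^ j * (weight \<delta> t xs)\<^sup>2 * (v (q xs) $ m)\<^sup>2 *
     (\<Sum>xs'\<in>cell_lists Q l. \<delta> ^ l * (weight \<delta> (q xs) xs')\<^sup>2))"
    unfolding mid_weight_def q_def[symmetric] by (simp add: sum_distrib_left power_mult_distrib ac_simps)
  also have "\<dots> \<le> (\<Sum>m\<in>(UNIV :: 'n set). \<Sum>xs\<in>cell_lists Q j. \<delta> ^ j * (weight \<delta> t xs)\<^sup>2 * U\<^sup>2 * 1)"
  proof (intro sum_mono mult_mono mult_left_mono)
    fix m xs
    show "(v (q xs) $ m)\<^sup>2 \<le> U\<^sup>2"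
      using v_bound[of "q xs" m] by (rule power2_le_iff_abs_le[THEN iffD2, OF U_nonneg])
    show "(\<Sum>xs'\<in>cell_lists Q l. \<delta> ^ l * (weight \<delta> (q xs) xs')\<^sup>2) \<le> 1"
      by (rule weight_square_sum[OF \<open>0 \<le> \<delta>\<close> sq q])
  qed (use \<open>0 \<le> \<delta>\<close> in \<open>auto intro!: sum_nonneg\<close>)
  also have "\<dots> = real CARD('n) * (U\<^sup>2 * (\<Sum>xs\<in>cell_lists Q j. \<delta> ^ j * (weight \<delta> t xs)\<^sup>2))"
    by (simp add: sum_distrib_left ac_simps)
  also have "\<dots> \<le> real CARD('n) * (U\<^sup>2 * 1)"
    using weight_square_sum[OF \<open>0 \<le> \<delta>\<close> sq order_refl] by (intro mult_left_mono) auto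
  finally show ?thesis by simp
qed

lemma card_cell_lists: "card (cell_lists Q l :: (nat \<times> 'n) list set) = (Q * CARD('n)) ^ l"
proof (induction l)
  case (Suc l)
  have "card (cell_lists Q (Suc l) :: (nat \<times> 'n) list set) = (\<Sum>xs\<in>(cell_lists Q (Suc l) :: (nat \<times> 'n) list set). 1)"
    by simp
  also have "\<dots> = (Q * CARD('n)) ^ Suc l"
    unfolding sum_cell_lists_Suc using Suc.IH by simp
  finally show ?case .
qed simp

end

section \<open>Difference of two systems tested against blocks\<close>

lemma sum_swap4:
  fixes f :: "'a \<Rightarrow> 'b \<Rightarrow> 'c \<Rightarrow> 'd \<Rightarrow> 'e::comm_monoid_add"
  shows "(\<Sum>\<tau>\<in>A. \<Sum>m\<in>B. \<Sum>x\<in>X. \<Sum>y\<in>Y. f y \<tau> m x) = (\<Sum>y\<in>Y. \<Sum>\<tau>\<in>A. \<Sum>m\<in>B. \<Sum>x\<in>X. f y \<tau> m x)"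
proof -
  have "(\<Sum>y\<in>Y. \<Sum>\<tau>\<in>A. \<Sum>m\<in>B. \<Sum>x\<in>X. f y \<tau> m x) = (\<Sum>\<tau>\<in>A. \<Sum>y\<in>Y. \<Sum>m\<in>B. \<Sum>x\<in>X. f y \<tau> m x)"
    by (rule sum.swap)
  also have "\<dots> = (\<Sum>\<tau>\<in>A. \<Sum>m\<in>B. \<Sum>y\<in>Y. \<Sum>x\<in>X. f y \<tau> m x)"
    by (rule sum.cong[OF refl], rule sum.swap)
  also have "\<dots> = (\<Sum>\<tau>\<in>A. \<Sum>m\<in>B. \<Sum>x\<in>X. \<Sum>y\<in>Y. f y \<tau> m x)"
    by (rule sum.cong[OF refl], rule sum.cong[OF refl], rule sum.swap)
  finally show ?thesis by simp
qed

lemma sum_over_blocks: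
  fixes h :: "nat \<times> 'n::finite \<times> (nat \<times> 'n) list \<Rightarrow> 'b::comm_monoid_add"
  shows "(\<Sum>a\<in>(\<Union>l<L0. {..<Q} \<times> UNIV \<times> cell_lists Q l). h a) = (\<Sum>l<L0. \<Sum>\<tau><Q. \<Sum>m\<in>UNIV. \<Sum>xs'\<in>cell_lists Q l. h (\<tau>, m, xs'))"
proof -
  have "(\<Sum>a\<in>(\<Union>l<L0. {..<Q} \<times> UNIV \<times> cell_lists Q l). h a)
      = (\<Sum>l<L0. \<Sum>a\<in>{..<Q} \<times> UNIV \<times> cell_lists Q l. h a)"
    by (rule sum.UNION_disjoint) (auto simp: cell_lists_def finite_cell_lists[unfolded cell_lists_def])
  also have "\<dots> = (\<Sum>l<L0. \<Sum>\<tau><Q. \<Sum>m\<in>UNIV. \<Sum>xs'\<in>cell_lists Q l. h (\<tau>, m, xs'))"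
    by (simp add: sum.cartesian_product case_prod_beta)
  finally show ?thesis .
qed

text \<open>One control drives both systems, so the weights coincide and only the kernels are
  subtracted. Pairing with \<open>w\<close> makes the outputs scalar; \<open>w\<close> will be a
  unit vector along the output difference.\<close>

locale system_pair =
  S: driven_system T N psi C M v t U + S': driven_system T' N' psi' C' M' v t U
  for T :: "real \<Rightarrow> 'x::{real_inner,banach,second_countable_topology} \<Rightarrow> 'x"
    and N :: "'n::finite \<Rightarrow> 'x \<Rightarrow> 'x" and psi :: "'n \<Rightarrow> 'x"
    and C :: "'x \<Rightarrow> real^'m::finite" and M :: real
    and T' :: "real \<Rightarrow> 'y::{real_inner,banach,second_countable_topology} \<Rightarrow> 'y"
    and N' :: "'n::finite \<Rightarrow> 'y \<Rightarrow> 'y" and psi' :: "'n \<Rightarrow> 'y"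
    and C' :: "'y \<Rightarrow> real^'m::finite" and M' :: real
    and v :: "real \<Rightarrow> real^'n" and t U :: real +
  fixes w :: "real^'m"
begin

definition diff_hankel :: "('n, 'n) fock \<Rightarrow> ('m, 'n) fock" where
  "diff_hankel = (\<lambda>f k s jns. Hankel T N psi C f k s jns - Hankel T' N' psi' C' f k s jns)"

definition diff_kernel :: "real \<Rightarrow> (nat \<times> 'n) list \<Rightarrow> nat \<Rightarrow> 'n \<Rightarrow> (nat \<times> 'n) list \<Rightarrow> real" where
  "diff_kernel \<delta> xs \<tau> m xs' = C (S.out_chain \<delta> xs (T (2 * \<delta> * real \<tau>) (S.in_chain \<delta> xs' m))) \<bullet> w
     - C' (S'.out_chain \<delta> xs (T' (2 * \<delta> * real \<tau>) (S'.in_chain \<delta> xs' m))) \<bullet> w"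

definition pair_entry :: "real \<Rightarrow> (nat \<times> 'n) list \<Rightarrow> nat \<Rightarrow> 'n \<Rightarrow> (nat \<times> 'n) list \<Rightarrow> real" where
  "pair_entry \<delta> xs \<tau> m xs' = fock_inner (diff_hankel (in_box \<delta> (\<tau>, m, xs'))) (out_box \<delta> w (xs, \<tau>))"

definition diff_volterra :: "nat \<Rightarrow> real" where
  "diff_volterra k = C (S.volterra k t) \<bullet> w - C' (S'.volterra k t) \<bullet> w"

lemma pairable_diff_hankel:
  assumes "0 \<le> \<delta>"
  shows "pairable (diff_hankel f) (out_box \<delta> w b)"
proof -
  obtain xs \<tau> where b: "b = (xs, \<tau>)" by (cases b)
  show ?thesis
    unfolding b out_box_def prod.case diff_hankel_def
    using assms by (intro pairable_box_fun set_integral_diff S.set_integrable_Hankel S'.set_integrable_Hankel) auto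
qed

lemma pair_entry_diff:
  assumes "0 \<le> \<delta>"
  shows "pair_entry \<delta> xs \<tau> m xs'
    = fock_inner (Hankel T N psi C (in_box \<delta> (\<tau>, m, xs'))) (out_box \<delta> w (xs, \<tau>))
    - fock_inner (Hankel T' N' psi' C' (in_box \<delta> (\<tau>, m, xs'))) (out_box \<delta> w (xs, \<tau>))"
proof -
  have len: "length (map fst xs @ [\<tau>]) = Suc (length (map snd xs))" by simp
  let ?H = "Hankel T N psi C (in_box \<delta> (\<tau>, m, xs'))" and ?H' = "Hankel T' N' psi' C' (in_box \<delta> (\<tau>, m, xs'))"
  let ?c = "cube \<delta> (map fst xs @ [\<tau>])" and ?ns = "map snd xs"
  have i: "set_integrable (tmeas (length ?ns)) ?c (\<lambda>s. \<Sum>j\<in>UNIV. ?H (length ?ns) s (j, ?ns) * w $ j)"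
    by (intro set_integrable_sum set_integrable_mult_left S.set_integrable_Hankel len assms)
  have i': "set_integrable (tmeas (length ?ns)) ?c (\<lambda>s. \<Sum>j\<in>UNIV. ?H' (length ?ns) s (j, ?ns) * w $ j)"
    by (intro set_integrable_sum set_integrable_mult_left S'.set_integrable_Hankel len assms)
  show ?thesis
    unfolding pair_entry_def out_box_def prod.case fock_inner_box_fun[OF len assms] diff_hankel_def
      left_diff_distrib sum_subtractf set_integral_diff(2)[OF i i'] diff_divide_distrib ..
qed

lemma pair_entry_eventually:
  assumes "\<epsilon> > 0"
  shows "\<forall>\<^sub>F Q in sequentially. \<forall>xs\<in>cell_lists Q j. \<forall>\<tau><Q. \<forall>m. \<forall>xs'\<in>cell_lists Q l.
    \<bar>pair_entry (t / real Q) xs \<tau> m xs'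
      - sqrt ((t / real Q) ^ Suc j) * sqrt ((t / real Q) ^ Suc l) * diff_kernel (t / real Q) xs \<tau> m xs'\<bar>
    \<le> sqrt ((t / real Q) ^ Suc j) * sqrt ((t / real Q) ^ Suc l) * \<epsilon>"
  using S.pairing_eventually[OF half_gt_zero[OF assms], of j l w] S'.pairing_eventually[OF half_gt_zero[OF assms], of j l w]
proof eventually_elim
  case (elim Q)
  have \<delta>: "0 \<le> t / real Q" using S.t_pos by simp
  show ?case
  proof (intro ballI allI impI)
    fix xs xs' :: "(nat \<times> 'n) list" and \<tau> m assume *: "xs \<in> cell_lists Q j" "\<tau> < Q" "xs' \<in> cell_lists Q l"
    have arith: "\<bar>(a - b) - r * (x - y)\<bar> \<le> r * \<epsilon>"
      if "\<bar>a - r * x\<bar> \<le> r * (\<epsilon> / 2)" "\<bar>b - r * y\<bar> \<le> r * (\<epsilon> / 2)" for a b r x y :: real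
    proof -
      have "(a - b) - r * (x - y) = (a - r * x) - (b - r * y)" by (simp add: algebra_simps)
      moreover have "r * (\<epsilon> / 2) + r * (\<epsilon> / 2) = r * \<epsilon>" by (simp add: algebra_simps)
      ultimately show ?thesis using that abs_triangle_ineq4[of "a - r * x" "b - r * y"] by linarith
    qed
    show "\<bar>pair_entry (t / real Q) xs \<tau> m xs'
      - sqrt ((t / real Q) ^ Suc j) * sqrt ((t / real Q) ^ Suc l) * diff_kernel (t / real Q) xs \<tau> m xs'\<bar>
      \<le> sqrt ((t / real Q) ^ Suc j) * sqrt ((t / real Q) ^ Suc l) * \<epsilon>"
      unfolding pair_entry_diff[OF \<delta>] diff_kernel_def
      by (rule arith) (use elim * in auto)
  qed
qed

text \<open>The trace of Y against the difference of the Hankel operators for one pair of degrees,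
  before Y is normalised.\<close>

definition block_sum :: "nat \<Rightarrow> nat \<Rightarrow> nat \<Rightarrow> real" where
  "block_sum Q j l = (let \<delta> = t / real Q in \<Sum>xs\<in>cell_lists Q j. \<Sum>\<tau><Q. \<Sum>m\<in>UNIV. \<Sum>xs'\<in>cell_lists Q l.
     sqrt (\<delta> ^ j) * sqrt (\<delta> ^ l) * S.mid_weight \<delta> xs \<tau> m xs' * pair_entry \<delta> xs \<tau> m xs')"

definition kernel_block_sum :: "nat \<Rightarrow> nat \<Rightarrow> nat \<Rightarrow> real" where
  "kernel_block_sum Q j l = (let \<delta> = t / real Q in \<Sum>xs\<in>cell_lists Q j. \<Sum>\<tau><Q. \<Sum>m\<in>UNIV. \<Sum>xs'\<in>cell_lists Q l.
     \<delta> ^ (j + l + 1) * S.mid_weight \<delta> xs \<tau> m xs' * diff_kernel \<delta> xs \<tau> m xs')"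

text \<open>The half cancels the factor 2 in \<open>volterra_sum_expand\<close>.\<close>

lemma kernel_block_sum_limit: "(\<lambda>Q. kernel_block_sum Q j l) \<longlonglongrightarrow> diff_volterra (j + l) / 2"
proof -
  have C: "C (S.volterra_sum Q j l) \<bullet> w = (let \<delta> = t / real Q in
     \<Sum>xs\<in>cell_lists Q j. \<Sum>\<tau><Q. \<Sum>m\<in>UNIV. \<Sum>xs'\<in>cell_lists Q l.
       (2 * \<delta> ^ (j + l + 1) * S.mid_weight \<delta> xs \<tau> m xs') *
        (C (S.out_chain \<delta> xs (T (2 * \<delta> * real \<tau>) (S.in_chain \<delta> xs' m))) \<bullet> w))" for Q
    unfolding S.volterra_sum_expand Let_def S.mid_weight_def
    by (simp add: linear_sum[OF bounded_linear.linear[OF S.C_linear]] linear_scale[OF bounded_linear.linear[OF S.C_linear]] inner_sum_left)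
  have C': "C' (S'.volterra_sum Q j l) \<bullet> w = (let \<delta> = t / real Q in
     \<Sum>xs\<in>cell_lists Q j. \<Sum>\<tau><Q. \<Sum>m\<in>UNIV. \<Sum>xs'\<in>cell_lists Q l.
       (2 * \<delta> ^ (j + l + 1) * S.mid_weight \<delta> xs \<tau> m xs') *
        (C' (S'.out_chain \<delta> xs (T' (2 * \<delta> * real \<tau>) (S'.in_chain \<delta> xs' m))) \<bullet> w))" for Q
    unfolding S'.volterra_sum_expand Let_def S.mid_weight_def
    by (simp add: linear_sum[OF bounded_linear.linear[OF S'.C_linear]] linear_scale[OF bounded_linear.linear[OF S'.C_linear]] inner_sum_left)
  have eq: "kernel_block_sum Q j l = (C (S.volterra_sum Q j l) \<bullet> w - C' (S'.volterra_sum Q j l) \<bullet> w) / 2" for Q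
    unfolding C C' kernel_block_sum_def Let_def
    unfolding sum_subtractf[symmetric] sum_divide_distrib
    by (intro sum.cong refl) (simp add: diff_kernel_def algebra_simps)
  show ?thesis
    unfolding eq[abs_def] diff_volterra_def
    by (intro tendsto_intros bounded_linear.tendsto[OF S.C_linear] bounded_linear.tendsto[OF S'.C_linear]
        S.volterra_sum_limit S'.volterra_sum_limit) simp
qed

text \<open>Replacing a pairing by its kernel value costs at most \<epsilon> times the (j+l+1)-st
  power of \<open>\<delta> * U\<close> in each term. There are as many terms as the same power of Q
  n, and \<open>\<delta> * Q = t\<close>, so the total error is a constant times \<epsilon>.\<close>

lemma block_sum_limit: "(\<lambda>Q. block_sum Q j l) \<longlonglongrightarrow> diff_volterra (j + l) / 2"
proof -
  define K where "K = (real CARD('n) * t * U) ^ (j + l + 1)"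
  have "K \<ge> 0" using S.t_pos S.U_nonneg by (simp add: K_def)
  have "(\<lambda>Q. block_sum Q j l - kernel_block_sum Q j l) \<longlonglongrightarrow> 0"
  proof (rule LIMSEQ_I)
    fix r :: real assume "r > 0"
    define \<epsilon> where "\<epsilon> = (r / 2) / (K + 1)"
    have "K + 1 > 0" using \<open>K \<ge> 0\<close> by simp
    then have "\<epsilon> > 0"
      using \<open>r > 0\<close> by (simp add: \<epsilon>_def)
    moreover have "(K + 1) * \<epsilon> = r / 2"
      using \<open>K + 1 > 0\<close> by (metis \<epsilon>_def less_irrefl mult.commute nonzero_eq_divide_eq)
    ultimately have "K * \<epsilon> < r" using \<open>r > 0\<close> by (simp add: algebra_simps)
    have "\<forall>\<^sub>F Q in sequentially. norm (block_sum Q j l - kernel_block_sum Q j l - 0) < r"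
      using pair_entry_eventually[OF \<open>\<epsilon> > 0\<close>, of j l] eventually_gt_at_top[of 0]
    proof eventually_elim
      case (elim Q)
      define \<delta> where "\<delta> = t / real Q"
      have \<delta>: "0 < \<delta>" "\<delta> * real Q = t" using elim S.t_pos by (auto simp: \<delta>_def)
      define P where "P xs \<tau> m xs' = sqrt (\<delta> ^ j) * sqrt (\<delta> ^ l) * S.mid_weight \<delta> xs \<tau> m xs' * pair_entry \<delta> xs \<tau> m xs'
          - \<delta> ^ (j + l + 1) * S.mid_weight \<delta> xs \<tau> m xs' * diff_kernel \<delta> xs \<tau> m xs'" for xs \<tau> m xs'
      \<comment> \<open>The square roots from Y and those from the normalised boxes; the latter
        include the middle cell on both sides, and the product is the full Riemann weight.\<close>
      define a b where "a = sqrt (\<delta> ^ j) * sqrt (\<delta> ^ l)" and "b = sqrt (\<delta> ^ Suc j) * sqrt (\<delta> ^ Suc l)"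
      have a: "0 \<le> a" using \<delta>(1) unfolding a_def by (intro mult_nonneg_nonneg real_sqrt_ge_zero zero_le_power) auto
      have root: "a * b = \<delta> ^ (j + l + 1)"
      proof -
        have "a * b = sqrt (\<delta> ^ j * \<delta> ^ l * (\<delta> ^ Suc j * \<delta> ^ Suc l))"
          unfolding a_def b_def by (simp only: real_sqrt_mult)
        also have "\<delta> ^ j * \<delta> ^ l * (\<delta> ^ Suc j * \<delta> ^ Suc l) = (\<delta> ^ (j + l + 1))\<^sup>2"
          by (simp add: power_add power2_eq_square)
        also have "sqrt \<dots> = \<delta> ^ (j + l + 1)"
          using \<delta>(1) by (simp add: real_sqrt_unique)
        finally show ?thesis .
      qed
      have P: "\<bar>P xs \<tau> m xs'\<bar> \<le> \<delta> ^ (j + l + 1) * U ^ (j + l + 1) * \<epsilon>"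
        if xs: "xs \<in> cell_lists Q j" "\<tau> < Q" "xs' \<in> cell_lists Q l" for xs \<tau> m xs'
      proof -
        have W: "\<bar>S.mid_weight \<delta> xs \<tau> m xs'\<bar> \<le> U ^ (j + l + 1)"
          using S.abs_mid_weight_le[of \<delta> xs \<tau> m xs'] xs by (simp add: cell_lists_def)
        have D: "\<bar>pair_entry \<delta> xs \<tau> m xs' - b * diff_kernel \<delta> xs \<tau> m xs'\<bar> \<le> b * \<epsilon>"
          unfolding b_def by (rule elim(1)[folded \<delta>_def, rule_format, OF xs])
        have eq: "P xs \<tau> m xs' = a * (S.mid_weight \<delta> xs \<tau> m xs' * (pair_entry \<delta> xs \<tau> m xs' - b * diff_kernel \<delta> xs \<tau> m xs'))"
          unfolding P_def root[symmetric] a_def[symmetric] by (simp only: right_diff_distrib ac_simps)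
        have "\<bar>P xs \<tau> m xs'\<bar> = a * (\<bar>S.mid_weight \<delta> xs \<tau> m xs'\<bar> * \<bar>pair_entry \<delta> xs \<tau> m xs' - b * diff_kernel \<delta> xs \<tau> m xs'\<bar>)"
          using a unfolding eq by (simp only: abs_mult abs_of_nonneg)
        also have "\<dots> \<le> a * (U ^ (j + l + 1) * (b * \<epsilon>))"
          by (rule mult_left_mono[OF mult_mono[OF W D] a]) (use S.U_nonneg in simp_all)
        also have "\<dots> = (a * b) * U ^ (j + l + 1) * \<epsilon>" by (simp only: ac_simps)
        finally show ?thesis unfolding root .
      qed
      have "block_sum Q j l - kernel_block_sum Q j l
        = (\<Sum>xs\<in>cell_lists Q j. \<Sum>\<tau><Q. \<Sum>m\<in>UNIV. \<Sum>xs'\<in>cell_lists Q l. P xs \<tau> m xs')"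
        unfolding block_sum_def kernel_block_sum_def Let_def \<delta>_def[symmetric] P_def sum_subtractf ..
      also have "\<bar>\<dots>\<bar> \<le> (\<Sum>xs\<in>(cell_lists Q j :: (nat \<times> 'n) list set). \<Sum>\<tau><Q. \<Sum>m\<in>(UNIV :: 'n set).
          \<Sum>xs'\<in>(cell_lists Q l :: (nat \<times> 'n) list set). \<delta> ^ (j + l + 1) * U ^ (j + l + 1) * \<epsilon>)"
        by (intro order_trans[OF sum_abs] sum_mono P) auto
      also have "\<dots> = ((\<delta> * real Q) * real CARD('n) * U) ^ (j + l + 1) * \<epsilon>"
        by (simp add: S.card_cell_lists power_mult_distrib power_add)
      also have "\<dots> = K * \<epsilon>" by (simp add: \<delta>(2) K_def ac_simps)
      finally show ?case using \<open>K * \<epsilon> < r\<close> by simp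
    qed
    then show "\<exists>no. \<forall>n\<ge>no. norm (block_sum n j l - kernel_block_sum n j l - 0) < r"
      by (simp add: eventually_sequentially)
  qed
  from tendsto_add[OF this kernel_block_sum_limit[of j l]] show ?thesis by simp
qed

text \<open>Input degree \<open>l\<close> is paired with output degree \<open>l + p\<close> only, so
  \<open>p = 0\<close> collects the even orders and \<open>p = 1\<close> the odd ones. Dividing by
  sqrt n times \<open>U\<close> brings every block to Hilbert-Schmidt norm at most 1.\<close>

lemma block_sum_le_trace:
  assumes w: "norm w = 1" and "U > 0" "0 < Q"
    and sq: "\<And>s. s \<le> t \<Longrightarrow> (\<Sum>c<Q. (t / real Q) * (\<Sum>m\<in>UNIV. (v (s - t / real Q * real c) $ m)\<^sup>2)) \<le> 1"
  shows "ereal ((\<Sum>l<L0. block_sum Q (l + p) l) / (sqrt (real CARD('n)) * U)) \<le> trace_norm diff_hankel"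
proof -
  define \<delta> where "\<delta> = t / real Q"
  have \<delta>: "0 < \<delta>" using \<open>0 < Q\<close> S.t_pos by (auto simp: \<delta>_def)
  define \<kappa> where "\<kappa> = sqrt (real CARD('n)) * U"
  have \<kappa>: "\<kappa> > 0" "\<kappa>\<^sup>2 = real CARD('n) * U\<^sup>2" using \<open>U > 0\<close> by (auto simp: \<kappa>_def power_mult_distrib)
  define I where "I = (\<Union>l<L0. {..<Q} \<times> (UNIV :: 'n set) \<times> (cell_lists Q l :: (nat \<times> 'n) list set))"
  define J where "J = (\<Union>l<L0. (cell_lists Q (l + p) :: (nat \<times> 'n) list set) \<times> {..<Q})"
  \<comment> \<open>A block is labelled by the middle cell and the output degree. The shift by
    \<open>p\<close> lets input cells use the same label, and since \<open>p\<close> is fixed the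
    label determines the input degree.\<close>
  define blk where "blk = (\<lambda>(\<tau> :: nat, m :: 'n, xs' :: (nat \<times> 'n) list). (\<tau>, length xs' + p))"
  define blk' where "blk' = (\<lambda>(xs :: (nat \<times> 'n) list, \<tau> :: nat). (\<tau>, length xs))"
  define y where "y = (\<lambda>(\<tau>, m, xs') (xs, \<tau>' :: nat). sqrt (\<delta> ^ length xs) * sqrt (\<delta> ^ length xs') * S.mid_weight \<delta> xs \<tau> m xs' / \<kappa>)"
  have fin: "finite I" "finite J" by (auto simp: I_def J_def)
  have Jblk: "{b\<in>J. blk' b = (\<tau>, l + p)} = (\<lambda>xs. (xs, \<tau>)) ` cell_lists Q (l + p)" if "l < L0" "\<tau> < Q" for l \<tau>
    using that by (auto simp: J_def blk'_def cell_lists_def)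
  have Jsum: "(\<Sum>b\<in>{b\<in>J. blk' b = (\<tau>, l + p)}. h b) = (\<Sum>xs\<in>cell_lists Q (l + p). h (xs, \<tau>))"
    if "l < L0" "\<tau> < Q" for l \<tau> and h :: "_ \<Rightarrow> real"
    unfolding Jblk[OF that] by (subst sum.reindex) (auto simp: inj_on_def)
  have "ereal (\<Sum>a\<in>I. \<Sum>b\<in>{b\<in>J. blk' b = blk a}. y a b * fock_inner (diff_hankel (in_box \<delta> a)) (out_box \<delta> w b))
      \<le> trace_norm diff_hankel"
  proof (rule block_sum_le_trace_norm[where L = diff_hankel and e = "in_box \<delta>" and g = "out_box \<delta> w"
        and blk = blk and blk' = blk' and y = y and I = I and J = J])
    show "in_fock (in_box \<delta> a)" "in_fock (out_box \<delta> w b)" "pairable (out_box \<delta> w b) (out_box \<delta> w b')"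
      "pairable (diff_hankel (in_box \<delta> a)) (out_box \<delta> w b)" for a b b'
      using \<delta> by (simp_all add: in_fock_in_box in_fock_out_box pairable_out_box_out_box pairable_diff_hankel)
    show "fock_inner (in_box \<delta> a) (in_box \<delta> a') = (if a = a' then 1 else 0)"
      "fock_inner (out_box \<delta> w b) (out_box \<delta> w b') = (if b = b' then 1 else 0)" for a a' b b'
      using \<delta> w by (simp_all add: in_box_orthonormal out_box_orthonormal)
    show "finite I" "finite J" by (fact fin)+
    show "infinite (UNIV :: (nat \<times> 'n \<times> (nat \<times> 'n) list) set)" "infinite (UNIV :: ((nat \<times> 'n) list \<times> nat) set)"
      by (auto simp: finite_prod)
    fix z :: "nat \<times> nat"
    show "(\<Sum>a\<in>{a\<in>I. blk a = z}. \<Sum>b\<in>{b\<in>J. blk' b = z}. (y a b)\<^sup>2) \<le> 1"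
    proof (cases "\<exists>\<tau><Q. \<exists>l<L0. z = (\<tau>, l + p)")
      case False
      then have "{a\<in>I. blk a = z} = {}"
        by (auto simp: I_def blk_def cell_lists_def)
      then show ?thesis by (simp only: sum.empty zero_le_one)
    next
      case True
      then obtain \<tau> l where z: "\<tau> < Q" "l < L0" "z = (\<tau>, l + p)" by blast
      have "{a\<in>I. blk a = z} = (\<lambda>(m, xs'). (\<tau>, m, xs')) ` (UNIV \<times> cell_lists Q l)"
        using z by (auto simp: I_def blk_def cell_lists_def)
      then have "(\<Sum>a\<in>{a\<in>I. blk a = z}. \<Sum>b\<in>{b\<in>J. blk' b = z}. (y a b)\<^sup>2)
        = (\<Sum>(m, xs')\<in>UNIV \<times> cell_lists Q l. \<Sum>b\<in>{b\<in>J. blk' b = z}. (y (\<tau>, m, xs') b)\<^sup>2)"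
        by (simp only:) (subst sum.reindex, auto simp: inj_on_def intro!: sum.cong)
      also have "\<dots> = (\<Sum>m\<in>UNIV. \<Sum>xs'\<in>cell_lists Q l. \<Sum>xs\<in>cell_lists Q (l + p). (y (\<tau>, m, xs') (xs, \<tau>))\<^sup>2)"
        unfolding z(3) Jsum[OF z(2,1)] by (rule sum.cartesian_product[symmetric])
      also have "\<dots> = (\<Sum>m\<in>UNIV. \<Sum>xs'\<in>cell_lists Q l. \<Sum>xs\<in>cell_lists Q (l + p).
           \<delta> ^ (l + p) * \<delta> ^ l * (S.mid_weight \<delta> xs \<tau> m xs')\<^sup>2) / \<kappa>\<^sup>2"
        unfolding sum_divide_distrib
        by (intro sum.cong refl) (use \<delta> in \<open>auto simp: y_def power_mult_distrib power_divide cell_lists_def\<close>)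
      also have "\<dots> \<le> (real CARD('n) * U\<^sup>2) / \<kappa>\<^sup>2"
        using \<delta> sq unfolding \<delta>_def[symmetric] by (intro divide_right_mono S.mid_weight_square_sum) auto
      also have "\<dots> = 1" using \<kappa> by (metis divide_self_if less_numeral_extra(3) zero_less_power)
      finally show ?thesis .
    qed
  qed
  also have "(\<Sum>a\<in>I. \<Sum>b\<in>{b\<in>J. blk' b = blk a}. y a b * fock_inner (diff_hankel (in_box \<delta> a)) (out_box \<delta> w b))
    = (\<Sum>l<L0. \<Sum>\<tau><Q. \<Sum>m\<in>UNIV. \<Sum>xs'\<in>cell_lists Q l. \<Sum>xs\<in>cell_lists Q (l + p).
        sqrt (\<delta> ^ (l + p)) * sqrt (\<delta> ^ l) * S.mid_weight \<delta> xs \<tau> m xs' * pair_entry \<delta> xs \<tau> m xs' / \<kappa>)"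
    unfolding I_def sum_over_blocks
  proof (intro sum.cong refl)
    fix l \<tau> :: nat and m and xs' :: "(nat \<times> 'n) list" assume *: "l \<in> {..<L0}" "\<tau> \<in> {..<Q}" "xs' \<in> cell_lists Q l"
    then have "blk (\<tau>, m, xs') = (\<tau>, l + p)" by (simp add: blk_def cell_lists_def)
    then show "(\<Sum>b\<in>{b\<in>J. blk' b = blk (\<tau>, m, xs')}. y (\<tau>, m, xs') b * fock_inner (diff_hankel (in_box \<delta> (\<tau>, m, xs'))) (out_box \<delta> w b))
      = (\<Sum>xs\<in>cell_lists Q (l + p). sqrt (\<delta> ^ (l + p)) * sqrt (\<delta> ^ l) * S.mid_weight \<delta> xs \<tau> m xs' * pair_entry \<delta> xs \<tau> m xs' / \<kappa>)"
      using * by (simp add: Jsum) (intro sum.cong refl, auto simp: y_def pair_entry_def cell_lists_def)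
  qed
  also have "\<dots> = (\<Sum>l<L0. block_sum Q (l + p) l) / \<kappa>"
    unfolding block_sum_def Let_def \<delta>_def[symmetric] sum_divide_distrib
    by (intro sum.cong refl sum_swap4)
  finally show ?thesis by (simp add: \<kappa>_def)
qed

text \<open>The bound does not grow with \<open>L0\<close>, because further orders only add further
  blocks. The mesh is refined while the number of orders stays fixed.\<close>

lemma diff_volterra_half_sum:
  assumes "norm w = 1" "U > 0"
    and "(LINT s:{0..t}|lborel. (\<Sum>m\<in>UNIV. (v s $ m)\<^sup>2)) < 1"
  shows "ereal ((\<Sum>l<L0. diff_volterra (2 * l + p)) / (2 * sqrt (real CARD('n)) * U)) \<le> trace_norm diff_hankel"
proof -
  have "(\<lambda>Q. (\<Sum>l<L0. block_sum Q (l + p) l) / (sqrt (real CARD('n)) * U))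
    \<longlonglongrightarrow> (\<Sum>l<L0. diff_volterra ((l + p) + l) / 2) / (sqrt (real CARD('n)) * U)"
    using \<open>U > 0\<close> by (intro tendsto_intros block_sum_limit) auto
  then have lim: "(\<lambda>Q. ereal ((\<Sum>l<L0. block_sum Q (l + p) l) / (sqrt (real CARD('n)) * U)))
    \<longlonglongrightarrow> ereal ((\<Sum>l<L0. diff_volterra ((l + p) + l) / 2) / (sqrt (real CARD('n)) * U))"
    by (rule tendsto_ereal)
  have "ereal ((\<Sum>l<L0. diff_volterra ((l + p) + l) / 2) / (sqrt (real CARD('n)) * U)) \<le> trace_norm diff_hankel"
  proof (rule tendsto_upperbound[OF lim])
    show "\<forall>\<^sub>F Q in sequentially. ereal ((\<Sum>l<L0. block_sum Q (l + p) l) / (sqrt (real CARD('n)) * U)) \<le> trace_norm diff_hankel"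
      using S.square_sum_eventually[OF assms(3)] eventually_gt_at_top[of 0]
    proof eventually_elim
      case (elim Q)
      show ?case by (rule block_sum_le_trace[OF assms(1,2) elim(2) elim(1)[rule_format]])
    qed
  qed simp
  moreover have "(\<Sum>l<L0. diff_volterra ((l + p) + l) / 2) / (sqrt (real CARD('n)) * U)
    = (\<Sum>l<L0. diff_volterra (2 * l + p)) / (2 * sqrt (real CARD('n)) * U)"
  proof -
    have "(l + p) + l = 2 * l + p" for l :: nat by simp
    then have "(\<Sum>l<L0. diff_volterra ((l + p) + l) / 2) = (\<Sum>l<L0. diff_volterra (2 * l + p)) / 2"
      by (simp only: sum_divide_distrib)
    then show ?thesis
      by (simp only: divide_divide_eq_left mult.assoc)
  qed
  ultimately show ?thesis by (simp only:)
qed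

lemma diff_volterra_sum:
  assumes "norm w = 1" "U > 0"
    and "(LINT s:{0..t}|lborel. (\<Sum>m\<in>UNIV. (v s $ m)\<^sup>2)) < 1"
    and tr: "trace_norm diff_hankel = ereal r"
  shows "(\<Sum>k<2 * L0. diff_volterra k) \<le> 4 * sqrt (real CARD('n)) * r * U"
proof -
  have half: "(\<Sum>l<L0. diff_volterra (2 * l + p)) \<le> 2 * sqrt (real CARD('n)) * U * r" for p
    using diff_volterra_half_sum[OF assms(1-3), of p L0] \<open>U > 0\<close> unfolding tr
    by (simp add: divide_le_eq ac_simps)
  have "(\<Sum>k<2 * L0. diff_volterra k) = (\<Sum>l<L0. diff_volterra (2 * l + 0)) + (\<Sum>l<L0. diff_volterra (2 * l + 1))"
    by (induction L0) (auto simp: numeral_2_eq_2)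
  moreover have "4 * sqrt (real CARD('n)) * r * U = 2 * sqrt (real CARD('n)) * U * r + 2 * sqrt (real CARD('n)) * U * r"
    by (simp add: algebra_simps)
  ultimately show ?thesis using half[of 0] half[of 1] by linarith
qed

end

section \<open>Convergence of the Volterra series\<close>

lemma set_integral_lebesgue_Icc:
  fixes g :: "real \<Rightarrow> 'b::{banach, second_countable_topology}"
  assumes "continuous_on {a..b} g"
  shows "set_integrable lebesgue {a..b} g"
    and "(LINT r:{a..b}|lebesgue. g r) = (LINT r:{a..b}|lborel. g r)"
proof -
  have meas: "(\<lambda>r. indicator {a..b} r *\<^sub>R g r) \<in> lborel \<rightarrow>\<^sub>M borel"
    using borel_measurable_continuous_on_indicator[OF _ assms] by simp
  show "set_integrable lebesgue {a..b} g"
    using borel_integrable_atLeastAtMost'[OF assms] integrable_completion[OF meas]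
    by (simp add: set_integrable_def)
  show "(LINT r:{a..b}|lebesgue. g r) = (LINT r:{a..b}|lborel. g r)"
    unfolding set_lebesgue_integral_def by (rule integral_completion[OF meas])
qed

lemma set_integral_nonneg_mono_set:
  fixes f :: "'a \<Rightarrow> real"
  assumes "set_integrable M B f" "A \<in> sets M" "A \<subseteq> B" "\<And>x. x \<in> B \<Longrightarrow> 0 \<le> f x"
  shows "(LINT x:A|M. f x) \<le> (LINT x:B|M. f x)"
proof -
  have A: "integrable M (\<lambda>x. indicator A x *\<^sub>R f x)"
    using set_integrable_subset[OF assms(1-3)] unfolding set_integrable_def .
  show ?thesis
    unfolding set_lebesgue_integral_def
  proof (rule integral_mono[OF A assms(1)[unfolded set_integrable_def]])
    show "indicator A x *\<^sub>R f x \<le> indicator B x *\<^sub>R f x" for x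
      using assms(3) assms(4)[of x] by (auto simp: indicator_def)
  qed
qed

lemma integral_exp_decay_le:
  fixes \<mu> s :: real
  assumes "\<mu> > 0" "0 \<le> s"
  shows "(LINT r:{0..s}|lebesgue. exp (- \<mu> * (s - r))) \<le> 1 / \<mu>"
proof -
  have "(LINT r:{0..s}|lebesgue. exp (- \<mu> * (s - r))) = (LINT r:{0..s}|lborel. exp (- \<mu> * (s - r)))"
    by (rule set_integral_lebesgue_Icc(2)) (intro continuous_intros)
  also have "\<dots> = exp (- \<mu> * (s - s)) / \<mu> - exp (- \<mu> * (s - 0)) / \<mu>"
    unfolding set_lebesgue_integral_def
  proof (rule integral_FTC_atLeastAtMost[OF \<open>0 \<le> s\<close>])
    show "((\<lambda>r. exp (- \<mu> * (s - r)) / \<mu>) has_vector_derivative exp (- \<mu> * (s - x))) (at x within {0..s})" for x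
      unfolding has_real_derivative_iff_has_vector_derivative[symmetric]
      using \<open>\<mu> > 0\<close> by (auto intro!: derivative_eq_intros)
  qed (intro continuous_intros)
  also have "\<dots> \<le> 1 / \<mu>" using assms by simp
  finally show ?thesis .
qed

lemma infnorm_le_iff_cart: "infnorm (x :: real^'n) \<le> c \<longleftrightarrow> (\<forall>i. \<bar>x $ i\<bar> \<le> c)"
proof
  assume "infnorm x \<le> c"
  then show "\<forall>i. \<bar>x $ i\<bar> \<le> c" using component_le_infnorm_cart order_trans by blast
next
  assume "\<forall>i. \<bar>x $ i\<bar> \<le> c"
  then show "infnorm x \<le> c"
    unfolding infnorm_cart by (intro cSup_least) auto
qed

context driven_system
begin

text \<open>Substitutes the input time \<open>r = s - \<sigma>\<close>, the variable of the mild
  equation; negative \<open>r\<close> contribute nothing since \<open>v\<close> vanishes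
  there.\<close>

lemma conv_int_reflect:
  assumes "s \<in> {0..t}"
  shows "conv_int D s = (LINT r:{0..s}|lborel. T (s - r) (\<Sum>m\<in>UNIV. v r $ m *\<^sub>R D m r))"
proof -
  have "conv_int D s = (\<integral>r. indicator {0..t} (s - r) *\<^sub>R T (s - r) (\<Sum>m\<in>UNIV. v r $ m *\<^sub>R D m r) \<partial>lborel)"
    unfolding conv_int_def set_lebesgue_integral_def
    by (subst lborel_integral_real_affine[where c = "-1" and t = s]) simp_all
  also have "\<dots> = (LINT r:{0..s}|lborel. T (s - r) (\<Sum>m\<in>UNIV. v r $ m *\<^sub>R D m r))"
    unfolding set_lebesgue_integral_def
    using assms by (intro Bochner_Integration.integral_cong) (auto simp: indicator_def v_zero)
  finally show ?thesis .
qed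

lemma drive_continuous:
  assumes "s \<in> {0..t}" and D: "\<And>m. continuous_on {..t} (D m)"
  shows "continuous_on {0..s} (\<lambda>r. T (s - r) (\<Sum>m\<in>UNIV. v r $ m *\<^sub>R D m r))"
  using assms(1)
  by (intro T_continuous_compose continuous_intros continuous_on_subset[OF v_cont] continuous_on_subset[OF D]) auto

lemma conv_int_add:
  assumes s: "s \<in> {0..t}" and D: "\<And>m. continuous_on {..t} (D m)" "\<And>m. continuous_on {..t} (D' m)"
  shows "conv_int (\<lambda>m r. D m r + D' m r) s = conv_int D s + conv_int D' s"
proof -
  have "T (s - r) (\<Sum>m\<in>UNIV. v r $ m *\<^sub>R (D m r + D' m r))
     = T (s - r) (\<Sum>m\<in>UNIV. v r $ m *\<^sub>R D m r) + T (s - r) (\<Sum>m\<in>UNIV. v r $ m *\<^sub>R D' m r)" if "r \<in> {0..s}" for r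
    using that T_linear[of "s - r"]
    by (simp add: scaleR_add_right sum.distrib linear_add bounded_linear.linear)
  then have "conv_int (\<lambda>m r. D m r + D' m r) s
     = (LINT r:{0..s}|lborel. T (s - r) (\<Sum>m\<in>UNIV. v r $ m *\<^sub>R D m r) + T (s - r) (\<Sum>m\<in>UNIV. v r $ m *\<^sub>R D' m r))"
    unfolding conv_int_reflect[OF s] by (intro set_lebesgue_integral_cong) auto
  also have "\<dots> = conv_int D s + conv_int D' s"
    unfolding conv_int_reflect[OF s]
    by (intro set_integral_add(2) borel_integrable_atLeastAtMost' drive_continuous[OF s] D)
  finally show ?thesis .
qed

lemma N_add: "N m (x + y) = N m x + N m y"
  using N_linear by (simp add: linear_add bounded_linear.linear)

lemma N_zero [simp]: "N m 0 = 0"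
  using N_linear by (simp add: linear_0 bounded_linear.linear)

text \<open>The partial sums are the Picard iterates, started at 0, of the mild equation with
  control \<open>v\<close>.\<close>

lemma volterra_partial_sum:
  assumes "s \<in> {0..t}"
  shows "(\<Sum>k<Suc K. volterra k s) = conv_int (\<lambda>m r. psi m + N m (\<Sum>k<K. volterra k r)) s"
proof (induction K)
  case 0
  then show ?case by (simp add: volterra_def)
next
  case (Suc K)
  have N: "continuous_on {..t} (\<lambda>r. N m (f r))" if "continuous_on {..t} f" for m f
    using that by (rule bounded_linear.continuous_on[OF N_linear])
  have "(\<lambda>m r. psi m + N m (\<Sum>k<Suc K. volterra k r))
     = (\<lambda>m r. (psi m + N m (\<Sum>k<K. volterra k r)) + kernel_int (Suc K) m r)"
    by (intro ext) (simp add: N_add volterra_def add.assoc)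
  then have "conv_int (\<lambda>m r. psi m + N m (\<Sum>k<Suc K. volterra k r)) s
    = conv_int (\<lambda>m r. psi m + N m (\<Sum>k<K. volterra k r)) s + conv_int (kernel_int (Suc K)) s"
    by (simp only:) (intro conv_int_add assms kernel_int_continuous continuous_on_add continuous_on_const
        N continuous_on_sum volterra_continuous)
  also have "\<dots> = (\<Sum>k<Suc (Suc K). volterra k s)"
    unfolding Suc.IH[symmetric] by (simp add: volterra_def)
  finally show ?case by simp
qed

lemma N_bound: "norm (N m x) \<le> onorm (N m) * norm x"
  by (rule onorm[OF N_linear])

text \<open>Compares the Picard iterates for \<open>v\<close> with the solution for
  \<open>u\<close>. One iteration multiplies the error by \<open>q\<close>, where the decay of the
  semigroup and \<open>v\<close> are both used in L2, and adds a multiple of \<open>\<eta>\<close>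
  for the change of control. The start 0 has error at most \<open>\<Phi>\<close>.\<close>

lemma volterra_error:
  assumes M: "0 \<le> M" and T_exp: "\<And>s x. 0 \<le> s \<Longrightarrow> norm (T s x) \<le> M * exp (- \<nu> * s) * norm x" and "\<nu> > 0"
    and mild_int: "\<And>s. s \<in> {0..t} \<Longrightarrow> set_integrable lebesgue {0..s}
      (\<lambda>r. T (s - r) ((\<Sum>m\<in>UNIV. u r $ m *\<^sub>R N m (phi r)) + (\<Sum>m\<in>UNIV. u r $ m *\<^sub>R psi m)))"
    and mild: "\<And>s. s \<in> {0..t} \<Longrightarrow> phi s = (LINT r:{0..s}|lebesgue.
      T (s - r) ((\<Sum>m\<in>UNIV. u r $ m *\<^sub>R N m (phi r)) + (\<Sum>m\<in>UNIV. u r $ m *\<^sub>R psi m)))"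
    and \<Phi>: "\<And>s. s \<in> {0..t} \<Longrightarrow> norm (phi s) \<le> \<Phi>"
    and ud: "set_integrable lebesgue {0..t} (\<lambda>r. infnorm (u r - v r))" "(LINT r:{0..t}|lebesgue. infnorm (u r - v r)) \<le> \<eta>"
    and \<alpha>: "\<alpha> > 0" "(LINT r:{0..t}|lebesgue. (infnorm (v r))\<^sup>2) \<le> \<alpha>\<^sup>2"
    and q: "q = \<alpha> * M * Xi_const N / sqrt (2 * \<nu>)" "q < 1"
    and s: "s \<in> {0..t}"
  shows "norm (phi s - (\<Sum>k<K. volterra k s))
    \<le> q ^ K * \<Phi> + M * (Xi_const N * \<Phi> + (\<Sum>m\<in>UNIV. norm (psi m))) * \<eta> / (1 - q)"
proof -
  define \<Xi> where "\<Xi> = Xi_const N"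
  define \<Psi> where "\<Psi> = (\<Sum>m\<in>UNIV. norm (psi m))"
  define B where "B = M * (\<Xi> * \<Phi> + \<Psi>)"
  have \<Xi>: "0 \<le> \<Xi>" unfolding \<Xi>_def Xi_const_def by (intro sum_nonneg onorm_pos_le N_linear)
  have \<Psi>: "0 \<le> \<Psi>" unfolding \<Psi>_def by (intro sum_nonneg) auto
  have \<Phi>0: "0 \<le> \<Phi>" using \<Phi>[OF s] norm_ge_zero order_trans by blast
  have \<eta>: "0 \<le> \<eta>"
    using ud(2) by (rule order_trans[rotated]) (auto simp: set_lebesgue_integral_def infnorm_pos_le intro!: integral_nonneg_AE)
  \<comment> \<open>Exact solution of the recursion \<open>e (Suc K) = B * \<eta> + q * e K\<close>,
    with an initial value that dominates \<open>\<Phi>\<close>.\<close>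
  define e where "e K = q ^ K * \<Phi> + B * \<eta> / (1 - q)" for K
  define X where "X K r = (\<Sum>k<K. volterra k r)" for K r
  have qrec: "B * \<eta> + q * e K = e (Suc K)" for K
    using q(2) by (simp add: e_def field_simps)
  have "norm (phi s - X K s) \<le> e K" if "s \<in> {0..t}" for s K
    using that
  proof (induction K arbitrary: s)
    case 0
    have "0 \<le> B * \<eta> / (1 - q)" using M \<Xi> \<Psi> \<Phi>0 \<eta> q(2) by (simp add: B_def)
    then show ?case using \<Phi>[OF 0] by (simp add: X_def e_def)
  next
    case (Suc K)
    note s = Suc.prems
    have eK: "0 \<le> e K" using Suc.IH[OF s] norm_ge_zero order_trans by blast
    define F where "F r = T (s - r) ((\<Sum>m\<in>UNIV. u r $ m *\<^sub>R N m (phi r)) + (\<Sum>m\<in>UNIV. u r $ m *\<^sub>R psi m))" for r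
    define G where "G r = T (s - r) (\<Sum>m\<in>UNIV. v r $ m *\<^sub>R (psi m + N m (X K r)))" for r
    have D: "continuous_on {..t} (\<lambda>r. psi m + N m (X K r))" for m
      unfolding X_def by (intro continuous_intros bounded_linear.continuous_on[OF N_linear] volterra_continuous)
    have Gc: "continuous_on {0..s} G"
      unfolding G_def by (rule drive_continuous[OF s D])
    have XG: "X (Suc K) s = (LINT r:{0..s}|lebesgue. G r)"
      unfolding set_integral_lebesgue_Icc(2)[OF Gc]
      unfolding G_def X_def volterra_partial_sum[OF s] by (rule conv_int_reflect[OF s])
    have FI: "set_integrable lebesgue {0..s} F" unfolding F_def by (rule mild_int[OF s])
    have GI: "set_integrable lebesgue {0..s} G" by (rule set_integral_lebesgue_Icc(1)[OF Gc])
    have diff: "phi s - X (Suc K) s = (LINT r:{0..s}|lebesgue. F r - G r)"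
      unfolding XG set_integral_diff(2)[OF FI GI] using mild[OF s] unfolding F_def by (rule arg_cong)
    \<comment> \<open>The weight in Young's inequality that turns the bound into \<open>\<alpha> / sqrt (2 * \<nu>)\<close>.\<close>
    define lam where "lam = \<alpha> * sqrt (2 * \<nu>)"
    have lam: "lam > 0" using \<alpha>(1) \<open>\<nu> > 0\<close> by (simp add: lam_def)
    define H where "H r = B * infnorm (u r - v r) + M * \<Xi> * e K *
      (lam / 2 * exp (- (2 * \<nu>) * (s - r)) + (infnorm (v r))\<^sup>2 / (2 * lam))" for r
    have bound: "norm (F r - G r) \<le> H r" if r: "r \<in> {0..s}" for r
    proof -
      have rt: "r \<in> {0..t}" using r s by auto
      \<comment> \<open>\<open>a\<close> changes the control while the state stays
        \<open>phi\<close>; \<open>b\<close> changes the state while the control stays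
        \<open>v\<close>.\<close>
      define a where "a = (\<Sum>m\<in>UNIV. (u r $ m - v r $ m) *\<^sub>R (N m (phi r) + psi m))"
      define b where "b = (\<Sum>m\<in>UNIV. v r $ m *\<^sub>R N m (phi r - X K r))"
      have ab: "((\<Sum>m\<in>UNIV. u r $ m *\<^sub>R N m (phi r)) + (\<Sum>m\<in>UNIV. u r $ m *\<^sub>R psi m))
          - (\<Sum>m\<in>UNIV. v r $ m *\<^sub>R (psi m + N m (X K r))) = a + b"
        unfolding a_def b_def sum.distrib[symmetric] sum_subtractf[symmetric]
        by (intro sum.cong refl) (simp add: linear_diff[OF bounded_linear.linear[OF N_linear]] algebra_simps)
      have sr: "0 \<le> s - r" using r by simp
      have FG: "F r - G r = T (s - r) a + T (s - r) b"
        unfolding F_def G_def T_diff[OF sr, symmetric] ab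
        by (rule linear_add[OF bounded_linear.linear[OF T_linear[OF sr]]])
      have "norm a \<le> (\<Sum>m\<in>UNIV. infnorm (u r - v r) * (onorm (N m) * \<Phi> + norm (psi m)))"
        unfolding a_def
      proof (rule sum_norm_le)
        fix m
        have "norm (N m (phi r) + psi m) \<le> onorm (N m) * \<Phi> + norm (psi m)"
          using N_bound[of m "phi r"] mult_left_mono[OF \<Phi>[OF rt] onorm_pos_le[OF N_linear[of m]]]
          by (intro norm_triangle_le) linarith
        moreover have "\<bar>u r $ m - v r $ m\<bar> \<le> infnorm (u r - v r)"
          using component_le_infnorm_cart[of "u r - v r" m] by simp
        ultimately show "norm ((u r $ m - v r $ m) *\<^sub>R (N m (phi r) + psi m)) \<le> infnorm (u r - v r) * (onorm (N m) * \<Phi> + norm (psi m))"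
          by (auto intro!: mult_mono infnorm_pos_le)
      qed
      also have "\<dots> = infnorm (u r - v r) * (\<Xi> * \<Phi> + \<Psi>)"
        by (simp add: \<Xi>_def Xi_const_def \<Psi>_def sum.distrib sum_distrib_right flip: sum_distrib_left)
      finally have a: "norm a \<le> infnorm (u r - v r) * (\<Xi> * \<Phi> + \<Psi>)" .
      have "norm b \<le> (\<Sum>m\<in>UNIV. infnorm (v r) * (onorm (N m) * e K))"
        unfolding b_def
      proof (rule sum_norm_le)
        fix m
        have "norm (N m (phi r - X K r)) \<le> onorm (N m) * e K"
          using N_bound[of m "phi r - X K r"] mult_left_mono[OF Suc.IH[OF rt] onorm_pos_le[OF N_linear[of m]]]
          by linarith
        then show "norm (v r $ m *\<^sub>R N m (phi r - X K r)) \<le> infnorm (v r) * (onorm (N m) * e K)"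
          using component_le_infnorm_cart[of "v r" m] by (auto intro!: mult_mono infnorm_pos_le)
      qed
      also have "\<dots> = infnorm (v r) * (\<Xi> * e K)"
        by (simp add: \<Xi>_def Xi_const_def sum_distrib_right flip: sum_distrib_left)
      finally have b: "norm b \<le> infnorm (v r) * (\<Xi> * e K)" .
      \<comment> \<open>The difference of the controls is small in L1, so the bound \<open>M\<close>
        is enough here; the exponential decay is spent on \<open>b\<close>.\<close>
      have "norm (T (s - r) a) \<le> M * norm a" using r by (intro T_bound) auto
      also have "\<dots> \<le> M * (infnorm (u r - v r) * (\<Xi> * \<Phi> + \<Psi>))" using M a by (rule mult_left_mono[rotated])
      finally have Ta: "norm (T (s - r) a) \<le> B * infnorm (u r - v r)" by (simp add: B_def ac_simps)
      define x where "x = exp (- \<nu> * (s - r))"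
      have "norm (T (s - r) b) \<le> M * x * norm b" unfolding x_def using r by (intro T_exp) auto
      also have "\<dots> \<le> M * x * (infnorm (v r) * (\<Xi> * e K))" using M by (intro mult_left_mono b) (auto simp: x_def)
      also have "\<dots> = M * \<Xi> * e K * (x * infnorm (v r))" by (simp add: ac_simps)
      also have "\<dots> \<le> M * \<Xi> * e K * (lam / 2 * x\<^sup>2 + (infnorm (v r))\<^sup>2 / (2 * lam))"
      proof (rule mult_left_mono)
        have "0 \<le> (lam * x - infnorm (v r))\<^sup>2 / (2 * lam)" using lam by simp
        also have "\<dots> = lam / 2 * x\<^sup>2 + (infnorm (v r))\<^sup>2 / (2 * lam) - x * infnorm (v r)"
          using lam by (simp add: power2_eq_square field_simps)
        finally show "x * infnorm (v r) \<le> lam / 2 * x\<^sup>2 + (infnorm (v r))\<^sup>2 / (2 * lam)" by simp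
      qed (use M \<Xi> eK in simp)
      also have "x\<^sup>2 = exp (- (2 * \<nu>) * (s - r))"
        unfolding x_def by (simp add: power2_eq_square flip: exp_add)
      finally have Tb: "norm (T (s - r) b) \<le> M * \<Xi> * e K *
         (lam / 2 * exp (- (2 * \<nu>) * (s - r)) + (infnorm (v r))\<^sup>2 / (2 * lam))" .
      show ?thesis unfolding FG H_def using Ta Tb by (intro norm_triangle_le) linarith
    qed
    have sub: "{0..s} \<subseteq> {0..t}" "{0..s} \<in> sets lebesgue" using s by auto
    have i1: "set_integrable lebesgue {0..s} (\<lambda>r. infnorm (u r - v r))"
      by (rule set_integrable_subset[OF ud(1) sub(2,1)])
    have i2: "set_integrable lebesgue {0..s} (\<lambda>r. exp (- (2 * \<nu>) * (s - r)))"
      by (intro set_integral_lebesgue_Icc continuous_intros)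
    have vc: "continuous_on S (\<lambda>r. (infnorm (v r))\<^sup>2)" for S
      by (intro continuous_intros continuous_on_subset[OF v_cont]) auto
    have i3: "set_integrable lebesgue {0..s} (\<lambda>r. (infnorm (v r))\<^sup>2)"
      by (intro set_integral_lebesgue_Icc vc)
    have i23: "set_integrable lebesgue {0..s} (\<lambda>r. lam / 2 * exp (- (2 * \<nu>) * (s - r)) + (infnorm (v r))\<^sup>2 / (2 * lam))"
      using i2 i3 by (intro set_integral_add set_integrable_mult_right set_integrable_divide)
    have HI: "set_integrable lebesgue {0..s} H"
      unfolding H_def
      by (rule set_integral_add(1)[OF set_integrable_mult_right[OF i1] set_integrable_mult_right[OF i23]])
    have "norm (phi s - X (Suc K) s) \<le> (LINT r:{0..s}|lebesgue. norm (F r - G r))"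
      unfolding diff by (rule set_integral_norm_bound[OF set_integral_diff(1)[OF FI GI]])
    also have "\<dots> \<le> (LINT r:{0..s}|lebesgue. H r)"
      by (rule set_integral_mono[OF set_integrable_norm[OF set_integral_diff(1)[OF FI GI]] HI bound])
    also have "\<dots> = B * (LINT r:{0..s}|lebesgue. infnorm (u r - v r)) + M * \<Xi> * e K *
      (lam / 2 * (LINT r:{0..s}|lebesgue. exp (- (2 * \<nu>) * (s - r))) + (LINT r:{0..s}|lebesgue. (infnorm (v r))\<^sup>2) / (2 * lam))"
      unfolding H_def
      apply (subst set_integral_add(2)[OF set_integrable_mult_right[OF i1] set_integrable_mult_right[OF i23]])
      apply (simp only: set_integral_mult_right)
      apply (subst set_integral_add(2)[OF set_integrable_mult_right[OF i2] set_integrable_divide[OF i3]])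
      apply (simp only: set_integral_mult_right set_integral_divide_zero)
      done
    also have "\<dots> \<le> B * \<eta> + M * \<Xi> * e K * (lam / 2 * (1 / (2 * \<nu>)) + \<alpha>\<^sup>2 / (2 * lam))"
    proof (intro add_mono mult_left_mono divide_right_mono)
      show "(LINT r:{0..s}|lebesgue. infnorm (u r - v r)) \<le> \<eta>"
        using set_integral_nonneg_mono_set[OF ud(1) sub(2,1)] ud(2) by (simp add: infnorm_pos_le)
      show "(LINT r:{0..s}|lebesgue. exp (- (2 * \<nu>) * (s - r))) \<le> 1 / (2 * \<nu>)"
        using integral_exp_decay_le[of "2 * \<nu>" s] \<open>\<nu> > 0\<close> s by simp
      have "(LINT r:{0..s}|lebesgue. (infnorm (v r))\<^sup>2) \<le> (LINT r:{0..t}|lebesgue. (infnorm (v r))\<^sup>2)"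
        by (rule set_integral_nonneg_mono_set[OF _ sub(2,1)]) (intro set_integral_lebesgue_Icc vc, simp)
      then show "(LINT r:{0..s}|lebesgue. (infnorm (v r))\<^sup>2) \<le> \<alpha>\<^sup>2" using \<alpha>(2) by linarith
    qed (use M \<Xi> \<Psi> \<Phi>0 eK lam in \<open>simp_all add: B_def\<close>)
    also have "lam / 2 * (1 / (2 * \<nu>)) + \<alpha>\<^sup>2 / (2 * lam) = \<alpha> / sqrt (2 * \<nu>)"
    proof -
      define w where "w = sqrt (2 * \<nu>)"
      have w: "w > 0" "2 * \<nu> = w * w" using \<open>\<nu> > 0\<close> by (auto simp: w_def)
      show ?thesis
        unfolding lam_def w_def[symmetric] w(2) using w(1) \<alpha>(1) by (simp add: power2_eq_square field_simps)
    qed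
    also have "B * \<eta> + M * \<Xi> * e K * (\<alpha> / sqrt (2 * \<nu>)) = B * \<eta> + q * e K"
      unfolding q(1) \<Xi>_def by simp
    finally show ?case unfolding qrec .
  qed
  from this[OF s, of K] show ?thesis
    by (simp add: X_def e_def B_def \<Xi>_def \<Psi>_def)
qed

end

section \<open>Approximation of the control and conclusion\<close>

lemma infnorm_diff_le: "infnorm (x - y) \<le> infnorm x + infnorm (y :: 'a::euclidean_space)"
  using infnorm_triangle[of x "- y"] by (simp add: infnorm_neg)

text \<open>Lebesgue measurable functions are a.e. limits of continuous ones; these are truncated to
  \<open>[-U, U]\<^sup>n\<close> and cut off at \<open>0\<close>.\<close>
lemma continuous_control_approx:
  fixes u :: "real \<Rightarrow> real^'n"
  assumes u_meas: "set_borel_measurable lebesgue {0<..} u"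
    and u_L2: "set_integrable lebesgue {0<..} (\<lambda>s. (infnorm (u s))\<^sup>2)"
    and bound: "AE s in lebesgue. 0 < s \<longrightarrow> infnorm (u s) \<le> U" and "0 \<le> U" "0 < t" "0 < \<epsilon>"
  obtains v :: "real \<Rightarrow> real^'n" where "continuous_on UNIV v" "\<And>s. s \<le> 0 \<Longrightarrow> v s = 0"
    "\<And>s. infnorm (v s) \<le> U"
    "set_integrable lebesgue {0..t} (\<lambda>s. infnorm (u s - v s))"
    "(LINT s:{0..t}|lebesgue. infnorm (u s - v s)) \<le> \<epsilon>"
    "(LINT s:{0..t}|lebesgue. (infnorm (v s))\<^sup>2) \<le> (LINT s:{0<..}|lebesgue. (infnorm (u s))\<^sup>2) + 2 * U * \<epsilon>"
proof -
  \<comment> \<open>Measurability of \<open>u\<close> is given on positive times only, hence the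
    extension by 0.\<close>
  define w where "w s = indicator {0<..} s *\<^sub>R u s" for s
  have w_meas: "w \<in> borel_measurable lebesgue"
    using u_meas by (simp add: set_borel_measurable_def w_def[abs_def])
  then have "w measurable_on UNIV"
    by (rule lebesgue_measurable_imp_measurable_on) simp
  then obtain Z g where "negligible Z" and g: "\<And>n. continuous_on UNIV (g n)"
    and lim: "\<And>s. s \<notin> Z \<Longrightarrow> (\<lambda>n. g n s) \<longlonglongrightarrow> w s"
    unfolding measurable_on_def by auto
  have AE_Z: "AE s in lebesgue. s \<notin> Z"
    using \<open>negligible Z\<close> by (simp add: negligible_iff_null_sets AE_not_in)
  have AE_0: "AE s in lebesgue. s \<noteq> (0::real)"
    using AE_lborel_singleton[of "0::real"] by (rule AE_completion)
  define cl :: "real^'n \<Rightarrow> real^'n" where "cl x = (\<chi> i. max (- U) (min U (x $ i)))" for x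
  have cl_cont: "continuous_on UNIV cl"
    unfolding cl_def by (intro continuous_on_vec_lambda continuous_intros)
  have cl_bound: "infnorm (cl x) \<le> U" for x
    using \<open>0 \<le> U\<close> by (auto simp: infnorm_le_iff_cart cl_def)
  have cl_id: "cl x = x" if "infnorm x \<le> U" for x
  proof -
    have "- U \<le> x $ i" "x $ i \<le> U" for i
      using that by (auto simp: infnorm_le_iff_cart abs_le_iff minus_le_iff)
    then show ?thesis by (simp add: cl_def vec_eq_iff)
  qed
  \<comment> \<open>The ramp vanishes at nonpositive times and equals 1 from 1/n on, so it does not
    affect the limit at any positive time.\<close>
  define V where "V n s = max 0 (min 1 (real n * s)) *\<^sub>R cl (g n s)" for n s
  have V_cont: "continuous_on UNIV (V n)" for n
    unfolding V_def by (intro continuous_intros continuous_on_compose2[OF cl_cont g]) auto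
  have V_0: "V n s = 0" if "s \<le> 0" for n s
  proof -
    have "real n * s \<le> 0" using that by (simp add: mult_nonneg_nonpos)
    then show ?thesis by (simp add: V_def)
  qed
  have V_bound: "infnorm (V n s) \<le> U" for n s
  proof -
    have "infnorm (V n s) = max 0 (min 1 (real n * s)) * infnorm (cl (g n s))"
      by (simp add: V_def infnorm_mul)
    also have "\<dots> \<le> 1 * U"
      by (intro mult_mono cl_bound) (auto simp: infnorm_pos_le)
    finally show ?thesis by simp
  qed
  have V_lim: "(\<lambda>n. V n s) \<longlonglongrightarrow> u s" if "s \<notin> Z" "0 < s" "infnorm (u s) \<le> U" for s
  proof -
    have "(\<lambda>n. g n s) \<longlonglongrightarrow> u s" using lim[OF that(1)] that(2) by (simp add: w_def)
    moreover have "isCont cl (u s)" using cl_cont by (simp add: continuous_on_eq_continuous_at)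
    ultimately have "(\<lambda>n. cl (g n s)) \<longlonglongrightarrow> cl (u s)" by (rule isCont_tendsto_compose[rotated])
    then have 1: "(\<lambda>n. cl (g n s)) \<longlonglongrightarrow> u s" using cl_id[OF that(3)] by simp
    have "\<forall>\<^sub>F n in sequentially. 1 / s \<le> real n"
      by (rule eventually_at_top_linorderI[of "nat \<lceil>1 / s\<rceil>"]) linarith
    then have "\<forall>\<^sub>F n in sequentially. V n s = cl (g n s)"
      by eventually_elim (use \<open>0 < s\<close> in \<open>simp add: V_def divide_le_eq min_def max_def\<close>)
    then show ?thesis using 1 by (simp add: tendsto_cong)
  qed
  define f where "f n s = indicator {0..t} s *\<^sub>R infnorm (u s - V n s)" for n s
  have infnorm_meas: "infnorm \<in> borel_measurable (borel :: (real^'n) measure)"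
    by (intro borel_measurable_continuous_onI continuous_intros)
  have V_meas: "V n \<in> borel_measurable lebesgue" for n
    using borel_measurable_continuous_onI[OF V_cont[of n]] by (intro measurable_completion) simp
  have f_meas: "f n \<in> borel_measurable lebesgue" for n
  proof -
    \<comment> \<open>Splits off the point 0, where \<open>u\<close> need not agree with its
      extension \<open>w\<close>.\<close>
    have "f n = (\<lambda>s. indicator {0<..t} s * infnorm (w s - V n s) + indicator {0} s * infnorm (u 0 - V n 0))"
      using \<open>0 < t\<close> by (auto simp: fun_eq_iff f_def w_def indicator_def)
    moreover have "(\<lambda>s. infnorm (w s - V n s)) \<in> borel_measurable lebesgue"
      by (rule measurable_compose[OF borel_measurable_diff[OF w_meas V_meas] infnorm_meas])
    ultimately show ?thesis
      by (simp only:) (intro borel_measurable_add borel_measurable_times borel_measurable_const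
        borel_measurable_indicator, auto)
  qed
  have f_bound: "AE s in lebesgue. norm (f n s) \<le> indicator {0..t} s * (2 * U)" for n
    using bound AE_0
  proof eventually_elim
    case (elim s)
    show ?case
      using elim infnorm_diff_le[of "u s" "V n s"] V_bound[of n s]
      by (auto simp: f_def indicator_def infnorm_pos_le)
  qed
  have f_lim: "AE s in lebesgue. (\<lambda>n. f n s) \<longlonglongrightarrow> 0"
    using bound AE_0 AE_Z
  proof eventually_elim
    case (elim s)
    show ?case
    proof (cases "s \<in> {0..t}")
      case True
      then have "(\<lambda>n. infnorm (u s - V n s)) \<longlonglongrightarrow> infnorm (u s - u s)"
        using elim by (intro tendsto_intros V_lim) auto
      then show ?thesis using True by (simp add: f_def infnorm_0)
    qed (simp add: f_def)
  qed
  have dom: "integrable lebesgue (\<lambda>s. indicator {0..t} s * (2 * U))"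
    by (intro integrable_mult_left integrable_real_indicator) (auto simp: emeasure_lborel_Icc_eq)
  have f_int: "integrable lebesgue (f n)" for n
    by (rule integrable_dominated_convergence2[OF _ f_meas dom f_lim f_bound]) simp
  have "(\<lambda>n. integral\<^sup>L lebesgue (f n)) \<longlonglongrightarrow> integral\<^sup>L lebesgue (\<lambda>_ :: real. 0 :: real)"
    by (rule integral_dominated_convergence[OF _ f_meas dom f_lim f_bound]) simp
  then have "(\<lambda>n. integral\<^sup>L lebesgue (f n)) \<longlonglongrightarrow> 0" by simp
  then have "\<forall>\<^sub>F n in sequentially. integral\<^sup>L lebesgue (f n) < \<epsilon>"
    using \<open>0 < \<epsilon>\<close> by (rule order_tendstoD)
  then obtain n where n: "integral\<^sup>L lebesgue (f n) < \<epsilon>"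
    by (auto simp: eventually_sequentially)
  show ?thesis
  proof (rule that[of "V n"])
    show "set_integrable lebesgue {0..t} (\<lambda>s. infnorm (u s - V n s))"
      using f_int[of n] by (simp add: set_integrable_def f_def[abs_def])
    show "(LINT s:{0..t}|lebesgue. infnorm (u s - V n s)) \<le> \<epsilon>"
      using n by (simp add: set_lebesgue_integral_def f_def[abs_def])
    have vi: "integrable lebesgue (\<lambda>s. indicator {0..t} s *\<^sub>R (infnorm (V n s))\<^sup>2)"
    proof -
      have "continuous_on {0..t} (\<lambda>s. (infnorm (V n s))\<^sup>2)"
        by (intro continuous_intros continuous_on_subset[OF V_cont]) auto
      from set_integral_lebesgue_Icc(1)[OF this] show ?thesis
        unfolding set_integrable_def .
    qed
    have ui: "integrable lebesgue (\<lambda>s. indicator {0<..} s *\<^sub>R (infnorm (u s))\<^sup>2)"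
      using u_L2 by (simp add: set_integrable_def)
    have "(LINT s:{0..t}|lebesgue. (infnorm (V n s))\<^sup>2)
      \<le> (\<integral>s. indicator {0<..} s *\<^sub>R (infnorm (u s))\<^sup>2 + 2 * U * f n s \<partial>lebesgue)"
      unfolding set_lebesgue_integral_def
    proof (rule integral_mono_AE[OF vi Bochner_Integration.integrable_add[OF ui integrable_mult_right[OF f_int]]])
      show "AE s in lebesgue. indicator {0..t} s *\<^sub>R (infnorm (V n s))\<^sup>2
        \<le> indicator {0<..} s *\<^sub>R (infnorm (u s))\<^sup>2 + 2 * U * f n s"
        using bound AE_0
      proof eventually_elim
        case (elim s)
        show ?case
        proof (cases "s \<in> {0..t}")
          case True
          then have s: "0 < s" "infnorm (u s) \<le> U" using elim by auto
          let ?a = "infnorm (V n s)" and ?b = "infnorm (u s)"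
          have "?a\<^sup>2 - ?b\<^sup>2 = (?a - ?b) * (?a + ?b)" by (simp add: power2_eq_square algebra_simps)
          \<comment> \<open>Both norms are at most \<open>U\<close>, which is the origin of the
            factor \<open>2 * U\<close> in front of \<epsilon>.\<close>
          also have "\<dots> \<le> \<bar>?a - ?b\<bar> * (2 * U)"
            using s V_bound[of n s] infnorm_pos_le[of "V n s"] infnorm_pos_le[of "u s"]
            by (intro mult_mono) auto
          also have "\<dots> \<le> infnorm (u s - V n s) * (2 * U)"
            using absdiff_infnorm[of "V n s" "u s"] \<open>0 \<le> U\<close> by (intro mult_right_mono) (auto simp: infnorm_sub)
          finally show ?thesis using True s by (simp add: f_def ac_simps)
        next
          case False
          then show ?thesis by (auto simp: f_def indicator_def)
        qed
      qed
    qed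
    also have "\<dots> = (LINT s:{0<..}|lebesgue. (infnorm (u s))\<^sup>2) + 2 * U * integral\<^sup>L lebesgue (f n)"
      unfolding set_lebesgue_integral_def
      by (subst Bochner_Integration.integral_add[OF ui integrable_mult_right[OF f_int]]) simp
    also have "\<dots> \<le> (LINT s:{0<..}|lebesgue. (infnorm (u s))\<^sup>2) + 2 * U * \<epsilon>"
      using n \<open>0 \<le> U\<close> by (intro add_left_mono mult_left_mono) auto
    finally show "(LINT s:{0..t}|lebesgue. (infnorm (V n s))\<^sup>2) \<le> (LINT s:{0<..}|lebesgue. (infnorm (u s))\<^sup>2) + 2 * U * \<epsilon>" .
  qed (use V_cont V_0 V_bound in auto)
qed

section \<open>Estimates for both systems at a fixed time\<close>

lemma bilinear_system_exp_bound:
  assumes "bilinear_system T N psi C M \<nu>" "0 \<le> s"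
  shows "norm (T s x) \<le> M * exp (- \<nu> * s) * norm x"
proof -
  have "norm (T s x) \<le> onorm (T s) * norm x"
    using assms by (intro onorm) (auto simp: bilinear_system_def C0_semigroup_def)
  also have "\<dots> \<le> M * exp (- \<nu> * s) * norm x"
    using assms by (intro mult_right_mono) (auto simp: bilinear_system_def)
  finally show ?thesis .
qed

lemma bilinear_system_bounded:
  fixes T :: "real \<Rightarrow> 'x::{real_inner,banach,second_countable_topology} \<Rightarrow> 'x" and N :: "'n::finite \<Rightarrow> 'x \<Rightarrow> 'x"
    and C :: "'x \<Rightarrow> real^'m::finite"
  assumes "bilinear_system T N psi C M \<nu>"
  shows "bounded_semigroup_system T N C M"
proof -
  have M: "M \<ge> 1" "\<nu> > 0" and c0: "C0_semigroup T" using assms by (auto simp: bilinear_system_def)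
  have "norm (T t x) \<le> M * norm x" if "0 \<le> t" for t x
  proof -
    have "norm (T t x) \<le> M * exp (- \<nu> * t) * norm x"
      by (rule bilinear_system_exp_bound[OF assms that])
    also have "\<dots> \<le> M * 1 * norm x"
      using M that by (intro mult_mono mult_left_mono) auto
    finally show ?thesis by simp
  qed
  then show ?thesis
    using c0 assms unfolding bounded_semigroup_system_def
    by (auto simp: C0_semigroup_def bilinear_system_def)
qed

lemma mild_solution_bounded:
  assumes "mild_solution T N psi u phi0 phi"
  obtains \<Phi> where "0 \<le> \<Phi>" "\<And>s. s \<in> {0..t} \<Longrightarrow> norm (phi s) \<le> \<Phi>"
proof -
  have "continuous_on {0..t} phi"
    using assms by (auto simp: mild_solution_def intro: continuous_on_subset)
  then have "bounded (phi ` {0..t})"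
    by (intro compact_imp_bounded compact_continuous_image compact_Icc)
  then obtain b where "b > 0" "\<forall>x\<in>phi ` {0..t}. norm x \<le> b"
    using bounded_pos by blast
  then show ?thesis by (intro that[of b]) auto
qed

text \<open>For the two parts of the bound in \<open>volterra_error\<close>. The contraction factor
  and the constants are fixed beforehand, so accuracy of the control and truncation order can be
  chosen independently; \<open>2 * l\<close> terms contain \<open>l\<close> even and
  \<open>l\<close> odd orders.\<close>

lemma error_terms_small:
  fixes q B \<Phi> K e :: real
  assumes "0 \<le> q" "q < 1" "e > 0"
  shows "\<forall>\<^sub>F \<epsilon> in at_right 0. K * (B * \<epsilon> / (1 - q)) < e"
    and "\<forall>\<^sub>F l in sequentially. K * (q ^ (2 * l) * \<Phi>) < e"
proof -
  have "((\<lambda>\<epsilon>. K * (B * \<epsilon> / (1 - q))) \<longlongrightarrow> K * (B * 0 / (1 - q))) (at_right 0)"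
    using assms by (intro tendsto_intros) auto
  then show "\<forall>\<^sub>F \<epsilon> in at_right 0. K * (B * \<epsilon> / (1 - q)) < e"
    using assms by (intro order_tendstoD(2)) auto
  have "norm (q\<^sup>2) < 1" using assms abs_square_less_1[of q] by simp
  then have "(\<lambda>l. (q\<^sup>2) ^ l) \<longlonglongrightarrow> 0" by (rule LIMSEQ_power_zero)
  from tendsto_mult[OF tendsto_const tendsto_mult[OF this tendsto_const]]
  have "(\<lambda>l. K * ((q\<^sup>2) ^ l * \<Phi>)) \<longlonglongrightarrow> K * (0 * \<Phi>)" .
  then show "\<forall>\<^sub>F l in sequentially. K * (q ^ (2 * l) * \<Phi>) < e"
    using assms by (intro order_tendstoD(2)) (auto simp: power_mult)
qed

text \<open>The tolerance \<open>e\<close> absorbs truncation of the series and replacement of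
  \<open>u\<close> by a continuous control. The trace norm is an extended real, hence the form
  conditional on a finite value \<open>r\<close>.\<close>

lemma output_difference_bound:
  fixes T :: "real \<Rightarrow> 'x::{real_inner,banach,second_countable_topology} \<Rightarrow> 'x"
    and N :: "'n::finite \<Rightarrow> 'x \<Rightarrow> 'x" and psi :: "'n \<Rightarrow> 'x" and C :: "'x \<Rightarrow> real^'m::finite"
    and T' :: "real \<Rightarrow> 'y::{real_inner,banach,second_countable_topology} \<Rightarrow> 'y"
    and N' :: "'n::finite \<Rightarrow> 'y \<Rightarrow> 'y" and psi' :: "'n \<Rightarrow> 'y" and C' :: "'y \<Rightarrow> real^'m"
    and u :: "real \<Rightarrow> real^'n"
  defines "\<Delta> \<equiv> \<lambda>f k s jns. Hankel T N psi C f k s jns - Hankel T' N' psi' C' f k s jns"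
  assumes sys: "bilinear_system T N psi C M \<nu>"
    and sys': "bilinear_system T' N' psi' C' M' \<nu>'"
    and u_meas: "set_borel_measurable lebesgue {0<..} u"
    and u_L2: "set_integrable lebesgue {0<..} (\<lambda>t. (infnorm (u t))\<^sup>2)"
    and bound: "AE s in lebesgue. 0 < s \<longrightarrow> infnorm (u s) \<le> U" and "0 < U"
    and small_n: "L2inf_norm u < 1 / sqrt (real CARD('n))"
    and small: "L2inf_norm u * M * Xi_const N < sqrt (2 * \<nu>)"
    and small': "L2inf_norm u * M' * Xi_const N' < sqrt (2 * \<nu>')"
    and mild: "mild_solution T N psi u 0 phi"
    and mild': "mild_solution T' N' psi' u 0 phi'"
    and "0 < t" "0 < e"
  shows "0 \<le> trace_norm \<Delta> \<and> (\<forall>r. trace_norm \<Delta> = ereal r \<longrightarrow>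
      norm (C (phi t) - C' (phi' t)) \<le> 4 * sqrt (real CARD('n)) * r * U + e)"
proof -
  interpret B: bounded_semigroup_system T N psi C M by (rule bilinear_system_bounded[OF sys])
  interpret B': bounded_semigroup_system T' N' psi' C' M' by (rule bilinear_system_bounded[OF sys'])
  have M: "0 \<le> M" "0 < \<nu>" "0 \<le> M'" "0 < \<nu>'" using sys sys' by (auto simp: bilinear_system_def)
  have \<Xi>: "0 \<le> Xi_const N" "0 \<le> Xi_const N'"
    unfolding Xi_const_def by (auto intro!: sum_nonneg onorm_pos_le B.N_linear B'.N_linear)
  define L where "L = L2inf_norm u"
  have L: "0 \<le> L" "L\<^sup>2 = (LINT s:{0<..}|lebesgue. (infnorm (u s))\<^sup>2)"
  proof -
    have "0 \<le> (LINT s:{0<..}|lebesgue. (infnorm (u s))\<^sup>2)"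
      unfolding set_lebesgue_integral_def by (intro integral_nonneg_AE) auto
    then show "0 \<le> L" "L\<^sup>2 = (LINT s:{0<..}|lebesgue. (infnorm (u s))\<^sup>2)"
      by (auto simp: L_def L2inf_norm_def)
  qed
  have "\<forall>\<^sub>F \<alpha> in at_right L. L < \<alpha> \<and> \<alpha> < 1 / sqrt (real CARD('n)) \<and> \<alpha> * M * Xi_const N < sqrt (2 * \<nu>)
      \<and> \<alpha> * M' * Xi_const N' < sqrt (2 * \<nu>')"
    using small_n small small' unfolding L_def[symmetric]
    by (intro eventually_conj eventually_at_right_less order_tendstoD(2)[where f = "\<lambda>\<alpha>. \<alpha>"]
        order_tendstoD(2)[where f = "\<lambda>\<alpha>. \<alpha> * M * Xi_const N"] order_tendstoD(2)[where f = "\<lambda>\<alpha>. \<alpha> * M' * Xi_const N'"])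
       (auto intro!: tendsto_eq_intros)
  \<comment> \<open>\<open>\<alpha>\<close> will bound the L2 norm of the approximating control,
    which may slightly exceed that of \<open>u\<close>; it stays strictly below all
    thresholds.\<close>
  then obtain \<alpha> where \<alpha>: "L < \<alpha>" "\<alpha> < 1 / sqrt (real CARD('n))" "\<alpha> * M * Xi_const N < sqrt (2 * \<nu>)"
      "\<alpha> * M' * Xi_const N' < sqrt (2 * \<nu>')"
    using eventually_happens'[OF trivial_limit_at_right_real] by blast
  have "\<alpha> > 0" using \<alpha> L by linarith
  define q where "q = \<alpha> * M * Xi_const N / sqrt (2 * \<nu>)"
  define q' where "q' = \<alpha> * M' * Xi_const N' / sqrt (2 * \<nu>')"
  have q: "0 \<le> q" "q < 1" "0 \<le> q'" "q' < 1"
    using \<alpha> M \<Xi> \<open>\<alpha> > 0\<close> by (auto simp: q_def q'_def)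
  obtain \<Phi> where \<Phi>: "0 \<le> \<Phi>" "\<And>s. s \<in> {0..t} \<Longrightarrow> norm (phi s) \<le> \<Phi>"
    using mild_solution_bounded[OF mild] by blast
  obtain \<Phi>' where \<Phi>': "0 \<le> \<Phi>'" "\<And>s. s \<in> {0..t} \<Longrightarrow> norm (phi' s) \<le> \<Phi>'"
    using mild_solution_bounded[OF mild'] by blast
  obtain K where K: "K > 0" "\<And>x. norm (C x) \<le> norm x * K"
    using bounded_linear.pos_bounded[OF B.C_linear] by blast
  obtain K' where K': "K' > 0" "\<And>x. norm (C' x) \<le> norm x * K'"
    using bounded_linear.pos_bounded[OF B'.C_linear] by blast
  define b where "b = M * (Xi_const N * \<Phi> + (\<Sum>m\<in>UNIV. norm (psi m)))"
  define b' where "b' = M' * (Xi_const N' * \<Phi>' + (\<Sum>m\<in>UNIV. norm (psi' m)))"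
  have "e / 4 > 0" using \<open>0 < e\<close> by simp
  have "\<forall>\<^sub>F \<epsilon> in at_right 0. 0 < \<epsilon> \<and> K * (b * \<epsilon> / (1 - q)) < e / 4 \<and> K' * (b' * \<epsilon> / (1 - q')) < e / 4
      \<and> L\<^sup>2 + 2 * U * \<epsilon> < \<alpha>\<^sup>2"
  proof (intro eventually_conj eventually_at_right_less error_terms_small q \<open>e / 4 > 0\<close>)
    have "((\<lambda>\<epsilon>. L\<^sup>2 + 2 * U * \<epsilon>) \<longlongrightarrow> L\<^sup>2 + 2 * U * 0) (at_right 0)" by (intro tendsto_intros)
    moreover have "L\<^sup>2 + 2 * U * 0 < \<alpha>\<^sup>2" using \<alpha>(1) L(1) by (simp add: power_strict_mono)
    ultimately show "\<forall>\<^sub>F \<epsilon> in at_right 0. L\<^sup>2 + 2 * U * \<epsilon> < \<alpha>\<^sup>2" by (rule order_tendstoD(2))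
  qed
  then obtain \<epsilon> where \<epsilon>: "0 < \<epsilon>" "K * (b * \<epsilon> / (1 - q)) < e / 4" "K' * (b' * \<epsilon> / (1 - q')) < e / 4"
      "L\<^sup>2 + 2 * U * \<epsilon> < \<alpha>\<^sup>2"
    using eventually_happens'[OF trivial_limit_at_right_real] by blast
  have "\<forall>\<^sub>F l in sequentially. K * (q ^ (2 * l) * \<Phi>) < e / 4 \<and> K' * (q' ^ (2 * l) * \<Phi>') < e / 4"
    by (intro eventually_conj error_terms_small q \<open>e / 4 > 0\<close>)
  then obtain l where l: "K * (q ^ (2 * l) * \<Phi>) < e / 4" "K' * (q' ^ (2 * l) * \<Phi>') < e / 4"
    by (auto simp: eventually_sequentially)
  have "0 \<le> U" using \<open>0 < U\<close> by simp
  obtain v where v: "continuous_on UNIV v" "\<And>s. s \<le> 0 \<Longrightarrow> v s = 0" "\<And>s. infnorm (v s) \<le> U"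
    "set_integrable lebesgue {0..t} (\<lambda>s. infnorm (u s - v s))"
    "(LINT s:{0..t}|lebesgue. infnorm (u s - v s)) \<le> \<epsilon>"
    "(LINT s:{0..t}|lebesgue. (infnorm (v s))\<^sup>2) \<le> (LINT s:{0<..}|lebesgue. (infnorm (u s))\<^sup>2) + 2 * U * \<epsilon>"
    using continuous_control_approx[OF u_meas u_L2 bound \<open>0 \<le> U\<close> \<open>0 < t\<close> \<epsilon>(1)] by blast
  have vcomp: "\<bar>v s $ m\<bar> \<le> infnorm (v s)" for s m by (rule component_le_infnorm_cart)
  define x where "x = C (phi t) - C' (phi' t)"
  obtain w where w: "norm w = 1" "x \<bullet> w = norm x"
  proof (cases "x = 0")
    case True
    then show ?thesis using that[of "axis undefined 1"] by simp
  next
    case False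
    then have "x \<bullet> ((1 / norm x) *\<^sub>R x) = norm x"
      by (simp add: dot_square_norm power2_eq_square)
    then show ?thesis using that[of "(1 / norm x) *\<^sub>R x"] False by simp
  qed
  interpret P: system_pair T N psi C M T' N' psi' C' M' v t U w
    using \<open>0 < t\<close> v(1,2) \<open>0 \<le> U\<close> order_trans[OF vcomp v(3)] by unfold_locales auto
  have \<Delta>: "P.diff_hankel = \<Delta>" by (simp add: P.diff_hankel_def \<Delta>_def)
  have v2: "(LINT s:{0..t}|lebesgue. (infnorm (v s))\<^sup>2) \<le> \<alpha>\<^sup>2" using v(6) \<epsilon>(4) L(2) by linarith
  have vc: "continuous_on S (\<lambda>r. (infnorm (v r))\<^sup>2)" for S
    by (intro continuous_intros continuous_on_subset[OF v(1)]) auto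
  \<comment> \<open>Passing from the maximum norm to the Euclidean norm costs a factor n in the
    squares; this is what the threshold 1 / sqrt n pays for.\<close>
  have sq: "(LINT s:{0..t}|lborel. (\<Sum>m\<in>UNIV. (v s $ m)\<^sup>2)) < 1"
  proof -
    have "(LINT s:{0..t}|lborel. (\<Sum>m\<in>UNIV. (v s $ m)\<^sup>2)) \<le> (LINT s:{0..t}|lborel. real CARD('n) * (infnorm (v s))\<^sup>2)"
    proof (rule set_integral_mono)
      show "set_integrable lborel {0..t} (\<lambda>s. \<Sum>m\<in>UNIV. (v s $ m)\<^sup>2)"
        by (intro borel_integrable_atLeastAtMost' continuous_intros continuous_on_subset[OF v(1)]) auto
      show "set_integrable lborel {0..t} (\<lambda>s. real CARD('n) * (infnorm (v s))\<^sup>2)"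
        by (intro borel_integrable_atLeastAtMost' continuous_on_mult continuous_on_const vc)
      fix s
      have "(\<Sum>m\<in>UNIV. (v s $ m)\<^sup>2) \<le> (\<Sum>m\<in>(UNIV :: 'n set). (infnorm (v s))\<^sup>2)"
        using vcomp by (intro sum_mono power2_le_iff_abs_le[THEN iffD2] infnorm_pos_le)
      then show "(\<Sum>m\<in>UNIV. (v s $ m)\<^sup>2) \<le> real CARD('n) * (infnorm (v s))\<^sup>2" by simp
    qed
    also have "\<dots> = real CARD('n) * (LINT s:{0..t}|lebesgue. (infnorm (v s))\<^sup>2)"
      by (simp add: set_integral_lebesgue_Icc(2)[OF vc])
    also have "\<dots> \<le> real CARD('n) * \<alpha>\<^sup>2" using v2 by (intro mult_left_mono) auto
    also have "\<dots> < real CARD('n) * (1 / sqrt (real CARD('n)))\<^sup>2"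
      using \<alpha>(2) \<open>\<alpha> > 0\<close> by (intro mult_strict_left_mono power_strict_mono) auto
    also have "\<dots> = 1" by (simp add: power_divide)
    finally show ?thesis .
  qed
  have mild_s: "set_integrable lebesgue {0..s}
      (\<lambda>r. T (s - r) ((\<Sum>m\<in>UNIV. u r $ m *\<^sub>R N m (phi r)) + (\<Sum>m\<in>UNIV. u r $ m *\<^sub>R psi m)))"
    "phi s = (LINT r:{0..s}|lebesgue.
      T (s - r) ((\<Sum>m\<in>UNIV. u r $ m *\<^sub>R N m (phi r)) + (\<Sum>m\<in>UNIV. u r $ m *\<^sub>R psi m)))" if "s \<in> {0..t}" for s
    using mild that by (auto simp: mild_solution_def)
  have mild_s': "set_integrable lebesgue {0..s}
      (\<lambda>r. T' (s - r) ((\<Sum>m\<in>UNIV. u r $ m *\<^sub>R N' m (phi' r)) + (\<Sum>m\<in>UNIV. u r $ m *\<^sub>R psi' m)))"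
    "phi' s = (LINT r:{0..s}|lebesgue.
      T' (s - r) ((\<Sum>m\<in>UNIV. u r $ m *\<^sub>R N' m (phi' r)) + (\<Sum>m\<in>UNIV. u r $ m *\<^sub>R psi' m)))" if "s \<in> {0..t}" for s
    using mild' that by (auto simp: mild_solution_def)
  have tt: "t \<in> {0..t}" using \<open>0 < t\<close> by simp
  define X where "X = (\<Sum>k<2 * l. P.S.volterra k t)"
  define X' where "X' = (\<Sum>k<2 * l. P.S'.volterra k t)"
  have err: "norm (phi t - X) \<le> q ^ (2 * l) * \<Phi> + b * \<epsilon> / (1 - q)"
    unfolding X_def b_def
    by (rule P.S.volterra_error[OF M(1) bilinear_system_exp_bound[OF sys] M(2) mild_s \<Phi>(2) v(4,5) \<open>\<alpha> > 0\<close> v2 q_def q(2) tt])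
  have err': "norm (phi' t - X') \<le> q' ^ (2 * l) * \<Phi>' + b' * \<epsilon> / (1 - q')"
    unfolding X'_def b'_def
    by (rule P.S'.volterra_error[OF M(3) bilinear_system_exp_bound[OF sys'] M(4) mild_s' \<Phi>'(2) v(4,5) \<open>\<alpha> > 0\<close> v2 q'_def q(4) tt])
  \<comment> \<open>With no orders at all the bound for the partial sums reads as
    nonnegativity.\<close>
  have "0 \<le> trace_norm \<Delta>"
    using P.diff_volterra_half_sum[OF w(1) \<open>0 < U\<close> sq, where ?L0.0 = 0] unfolding \<Delta> by (simp add: zero_ereal_def)
  moreover have "norm x \<le> 4 * sqrt (real CARD('n)) * r * U + e" if r: "trace_norm \<Delta> = ereal r" for r
  proof -
    have sum: "(\<Sum>k<2 * l. P.diff_volterra k) = C X \<bullet> w - C' X' \<bullet> w"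
      unfolding P.diff_volterra_def X_def X'_def
      by (simp add: sum_subtractf linear_sum[OF bounded_linear.linear[OF B.C_linear]]
          linear_sum[OF bounded_linear.linear[OF B'.C_linear]] inner_sum_left)
    have Cb: "\<bar>C y \<bullet> w\<bar> \<le> K * norm y" for y
      using Cauchy_Schwarz_ineq2[of "C y" w] K(2)[of y] w(1) by (simp add: mult.commute)
    have Cb': "\<bar>C' y \<bullet> w\<bar> \<le> K' * norm y" for y
      using Cauchy_Schwarz_ineq2[of "C' y" w] K'(2)[of y] w(1) by (simp add: mult.commute)
    have "norm x = (\<Sum>k<2 * l. P.diff_volterra k) + C (phi t - X) \<bullet> w - C' (phi' t - X') \<bullet> w"
      using w(2) unfolding sum x_def
      by (simp add: linear_diff[OF bounded_linear.linear[OF B.C_linear]]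
          linear_diff[OF bounded_linear.linear[OF B'.C_linear]] inner_diff_left)
    also have "\<dots> \<le> (\<Sum>k<2 * l. P.diff_volterra k) + K * norm (phi t - X) + K' * norm (phi' t - X')"
      using Cb[of "phi t - X"] Cb'[of "phi' t - X'"] by linarith
    also have "(\<Sum>k<2 * l. P.diff_volterra k) \<le> 4 * sqrt (real CARD('n)) * r * U"
      using P.diff_volterra_sum[OF w(1) \<open>0 < U\<close> sq] r unfolding \<Delta> by blast
    also have "K * norm (phi t - X) \<le> K * (q ^ (2 * l) * \<Phi> + b * \<epsilon> / (1 - q))"
      using err K(1) by (intro mult_left_mono) auto
    also have "K' * norm (phi' t - X') \<le> K' * (q' ^ (2 * l) * \<Phi>' + b' * \<epsilon> / (1 - q'))"
      using err' K'(1) by (intro mult_left_mono) auto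
    finally show ?thesis
      using l \<epsilon>(2,3) distrib_left[of K "q ^ (2 * l) * \<Phi>" "b * \<epsilon> / (1 - q)"]
        distrib_left[of K' "q' ^ (2 * l) * \<Phi>'" "b' * \<epsilon> / (1 - q')"] by linarith
  qed
  ultimately show ?thesis unfolding x_def by blast
qed

theorem theorem1p4:
  fixes T :: "real \<Rightarrow> 'x::{real_inner,banach,second_countable_topology} \<Rightarrow> 'x"
    and N :: "'n::finite \<Rightarrow> 'x \<Rightarrow> 'x" and psi :: "'n \<Rightarrow> 'x" and C :: "'x \<Rightarrow> real^'m::finite"
    and T' :: "real \<Rightarrow> 'y::{real_inner,banach,second_countable_topology} \<Rightarrow> 'y"
    and N' :: "'n \<Rightarrow> 'y \<Rightarrow> 'y" and psi' :: "'n \<Rightarrow> 'y" and C' :: "'y \<Rightarrow> real^'m"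
    and M \<nu> M' \<nu>' :: real
    and u :: "real \<Rightarrow> real^'n"
    and phi :: "real \<Rightarrow> 'x" and phi' :: "real \<Rightarrow> 'y"
  assumes sys: "bilinear_system T N psi C M \<nu>"
    and sys': "bilinear_system T' N' psi' C' M' \<nu>'"
    and u_meas: "set_borel_measurable lebesgue {0<..} u"
    and u_L2: "set_integrable lebesgue {0<..} (\<lambda>t. (infnorm (u t))\<^sup>2)"
    and u_Linf: "Linf_norm u < \<infinity>"
    and small_n: "L2inf_norm u < 1 / sqrt (real CARD('n))"
    and small: "L2inf_norm u * M * Xi_const N < sqrt (2 * \<nu>)"
    and small': "L2inf_norm u * M' * Xi_const N' < sqrt (2 * \<nu>')"
    and mild: "mild_solution T N psi u 0 phi"
    and mild': "mild_solution T' N' psi' u 0 phi'"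
  shows "(SUP t\<in>{0<..}. ereal (norm (C (phi t) - C' (phi' t))))
           \<le> ereal (4 * sqrt (real CARD('n)))
             * trace_norm (\<lambda>f k s jns. Hankel T N psi C f k s jns - Hankel T' N' psi' C' f k s jns)
             * Linf_norm u"
proof -
  define tr where "tr = trace_norm (\<lambda>f k s jns. Hankel T N psi C f k s jns - Hankel T' N' psi' C' f k s jns)"
  have AE: "AE s in lebesgue. 0 < s \<longrightarrow> ereal (infnorm (u s)) \<le> Linf_norm u"
    using esssup_AE[of "\<lambda>t. ereal (infnorm (u t))" "restrict_space lebesgue {0<..}"]
    unfolding Linf_norm_def by (subst (asm) AE_restrict_space_iff) auto
  \<comment> \<open>An almost everywhere bound holds at some positive time, as the interval from 0
    to 1 is not a null set; this makes the essential supremum nonnegative.\<close>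
  have "\<exists>s. 0 < s \<and> ereal (infnorm (u s)) \<le> Linf_norm u"
  proof (rule ccontr)
    assume "\<not> (\<exists>s. 0 < s \<and> ereal (infnorm (u s)) \<le> Linf_norm u)"
    then have "AE s in lebesgue. s \<notin> {0<..1 :: real}"
      using AE by (auto elim!: eventually_mono)
    then have "{0<..1 :: real} \<in> null_sets lebesgue"
      by (simp add: AE_iff_null_sets)
    then have "emeasure lebesgue {0<..1 :: real} = 0" by (rule null_setsD1)
    then show False by simp
  qed
  then have "0 \<le> Linf_norm u"
    using infnorm_pos_le order_trans by (metis ereal_less_eq(5))
  with u_Linf obtain U where U: "Linf_norm u = ereal U" "0 \<le> U"
    by (cases "Linf_norm u") auto
  have bound: "AE s in lebesgue. 0 < s \<longrightarrow> infnorm (u s) \<le> U"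
    using AE unfolding U by simp
  have "ereal (norm (C (phi t) - C' (phi' t))) \<le> ereal (4 * sqrt (real CARD('n))) * tr * ereal U" if "0 < t" for t
  proof (cases "U = 0")
    \<comment> \<open>In extended reals infinity times 0 is 0, so the right-hand side is 0 whatever
      the trace norm, and the outputs have to vanish.\<close>
    case True
    have u0: "AE r in lebesgue. r \<in> {0..t} \<longrightarrow> u r = 0"
      using bound AE_completion[OF AE_lborel_singleton[of "0::real"]]
    proof eventually_elim
      case (elim r)
      then show ?case using True infnorm_pos_lt[of "u r"] by auto
    qed
    interpret B: bounded_semigroup_system T N psi C M by (rule bilinear_system_bounded[OF sys])
    interpret B': bounded_semigroup_system T' N' psi' C' M' by (rule bilinear_system_bounded[OF sys'])
    have "phi t = (LINT r:{0..t}|lebesgue. T (t - r) ((\<Sum>m\<in>UNIV. u r $ m *\<^sub>R N m (phi r)) + (\<Sum>m\<in>UNIV. u r $ m *\<^sub>R psi m)))"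
      using mild \<open>0 < t\<close> by (simp add: mild_solution_def)
    also have "\<dots> = 0"
      unfolding set_lebesgue_integral_def
      by (rule integral_eq_zero_AE) (use u0 in eventually_elim, auto simp: indicator_def)
    finally have "phi t = 0" .
    have "phi' t = (LINT r:{0..t}|lebesgue. T' (t - r) ((\<Sum>m\<in>UNIV. u r $ m *\<^sub>R N' m (phi' r)) + (\<Sum>m\<in>UNIV. u r $ m *\<^sub>R psi' m)))"
      using mild' \<open>0 < t\<close> by (simp add: mild_solution_def)
    also have "\<dots> = 0"
      unfolding set_lebesgue_integral_def
      by (rule integral_eq_zero_AE) (use u0 in eventually_elim, auto simp: indicator_def)
    finally have "phi' t = 0" .
    with \<open>phi t = 0\<close> show ?thesis
      using True B.C_linear B'.C_linear
      by (simp add: linear_0 bounded_linear.linear flip: zero_ereal_def)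
  next
    case False
    then have "0 < U" using U by simp
    have key: "0 \<le> tr \<and> (\<forall>r. tr = ereal r \<longrightarrow> norm (C (phi t) - C' (phi' t)) \<le> 4 * sqrt (real CARD('n)) * r * U + e)"
      if "0 < e" for e
      unfolding tr_def
      by (rule output_difference_bound[OF sys sys' u_meas u_L2 bound \<open>0 < U\<close> small_n small small' mild mild' \<open>0 < t\<close> that])
    show ?thesis
    proof (cases tr)
      case (real r)
      have "norm (C (phi t) - C' (phi' t)) \<le> 4 * sqrt (real CARD('n)) * r * U"
      \<comment> \<open>The approximating control depends on \<open>e\<close>, but neither side of
        the limiting inequality does.\<close>
      proof (rule field_le_epsilon)
        fix e :: real assume "0 < e"
        from key[OF this] real show "norm (C (phi t) - C' (phi' t)) \<le> 4 * sqrt (real CARD('n)) * r * U + e"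
          by blast
      qed
      then show ?thesis using real by simp
    next
      case PInf
      then show ?thesis using \<open>0 < U\<close> by simp
    next
      case MInf
      then show ?thesis using key[of 1] by simp
    qed
  qed
  then show ?thesis
    unfolding tr_def U by (intro SUP_least) auto
qed

end
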